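(* Let $X^*\in\mathbb{R}^{m\times n}$ have rank $r\ge1$, let $\mathcal{A}:\mathbb{R}^{m\times n}\to\mathbb{R}^l$ be a linear operator satisfying the $4r$-RIP with constant $\delta_{4r}\in(0,\frac{19}{119})$, and let $y=\mathcal{A}(X^* )+\omega$, where the entries $\omega_1,\dots,\omega_l$ of $\omega$ are i.i.d. sub-Gaussian with parameter $\sigma_\omega^2$. Let $F(X)=\|\mathcal{A}(X)-y\|_2^2$, $q\in(0,2)$, $\lambda>0$, and $$\Phi_\lambda(U,V)=F(UV^T)+\frac{\lambda}{q}\left(\|U\|_{2,q}^q+\|V\|_{2,q}^q\right),\qquad (U,V)\in\mathbb{R}^{m\times d}\times\mathbb{R}^{n\times d}.$$ Put $\alpha=2l(1-\delta_{4r})$ and $\beta=2l(1+\delta_{4r})$. Then there are constants $\gamma_1,\gamma_2,\gamma_3>0$ depending only on $c,\alpha,\beta,q$ such that, with probability at least $1-\frac1{mn}$, the following holds: if $(U,V)$ is an S-critical point of $\Phi_\lambda$ with all columns nonzero, $X=UV^T$, $\operatorname{rank}(X)\le r$, $\sigma_{\min}(X)\ge\frac1{10}\sigma_{\min}(X^* )$, and $\nabla^2\Phi_\lambda(U,V)$ is positive semi-definite, then $$\|UV^T-X^*\|_F^2\le\gamma_1 r\,\sigma_\omega^2\ln(nm)(1+\delta_{4r})+\gamma_2\lambda\,\sigma_{\min}(X^* )^{\frac q2-1}\|X^*\|_*-\gamma_3\lambda\|X\|_{S_{q/2}}^{q/2}.$$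
   Context: $A_{:,i}$ denotes the $i$-th column of $A$ and $\|A\|_{2,q}^q=\sum_i\|A_{:,i}\|_2^q$. $\|\cdot\|_*,\|\cdot\|_F$ are the nuclear and Frobenius norms; $\sigma_{\min}$ is the smallest nonzero singular value; $\|X\|_{S_{q/2}}^{q/2}=\sum_i\sigma_i(X)^{q/2}$. RIP: $\mathcal{A}$ with components $\mathcal{A}(H)_i=\langle A_i,H\rangle$, $i=1,\dots,l$, satisfies the $s$-RIP with constant $\delta_s$ if $(1-\delta_s)\|H\|_F^2\le\frac1l\sum_{i=1}^l\langle A_i,H\rangle^2\le(1+\delta_s)\|H\|_F^2$ for all $H\in\mathbb{R}^{m\times n}$ of rank at most $s$. Sub-Gaussian with parameter $\sigma^2$ means $\mathbb{E}\,e^{t\omega_i}\le e^{\sigma^2t^2/2}$ for all $t\in\mathbb{R}$. $c>0$ is an absolute constant such that, for every fixed $\tau\in\mathbb{R}^l$, $|\tau^T\omega|\le c\,\sigma_\omega\sqrt{\ln(nm)}\,\|\tau\|_2$ with probability at least $1-\frac1{mn}$. A critical point is a point where $0$ belongs to the limiting Fréchet subdifferential (where all columns of $U,V$ are nonzero, $\Phi_\lambda$ is twice differentiable and this means $\nabla\Phi_\lambda(U,V)=0$). A critical point $(U,V)$ of $\Phi_\lambda$ is an S-critical point if there exists $(\bar U,\bar V)\in\mathbb{R}^{m\times d}\times\mathbb{R}^{n\times d}$, with the columns of $\bar U$ mutually orthogonal and the columns of $\bar V$ mutually orthogonal, such that $UV^T=\bar U\bar V^T$ and $(\bar U,\bar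 V)$ is also a critical point of $\Phi_\lambda$.
   Formalization: The formal theorem adds the assumption d ≥ r (for d < r the claim fails, e.g. X* = diag(2,1), d = 1, no noise, small λ), and takes the noise on a probability space of real sequences, to which the general case reduces via the joint law of ω. *)

theory Defs
  imports
    "HOL-Probability.Probability"
    "Jordan_Normal_Form.Char_Poly"
    "Jordan_Normal_Form.DL_Rank"
begin

text \<open>
  The constants of the theorem must not depend on the dimensions, so matrices are carrier-based
  (type \<open>real mat\<close>) instead of being indexed by types.  The type \<open>real mat\<close> has no norm, hence
  derivatives and subdifferentials on the space of factor pairs are spelled out with respect to
  the Frobenius norm.  A vector in $R^l$ is a function of type \<open>nat \<Rightarrow> real\<close>, read on \<open>{..<l}\<close>;
  its Euclidean norm is \<open>L2_set\<close>.
\<close>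

section \<open>Matrix norms and singular values\<close>

definition frob_inner :: "real mat \<Rightarrow> real mat \<Rightarrow> real" where
  "frob_inner A B = (\<Sum>i<dim_row A. \<Sum>j<dim_col A. A $$ (i, j) * B $$ (i, j))"

definition frob_norm :: "real mat \<Rightarrow> real" where
  "frob_norm A = sqrt (frob_inner A A)"

definition col_norm :: "real mat \<Rightarrow> nat \<Rightarrow> real" where
  "col_norm A i = L2_set (\<lambda>k. A $$ (k, i)) {..<dim_row A}"

text \<open>This is $\|A\|_{2,q}^q$, i.e. already raised to the power $q$.\<close>

definition norm_2q_pow :: "real \<Rightarrow> real mat \<Rightarrow> real" where
  "norm_2q_pow q A = (\<Sum>i<dim_col A. col_norm A i powr q)"

definition mat_rank :: "real mat \<Rightarrow> nat" where
  "mat_rank A = vec_space.rank (dim_row A) A"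

text \<open>
  Square roots of the eigenvalues of $X^T X$ with multiplicity.  There are \<open>dim_col X\<close> of them;
  zeros do not affect the sums below, as \<open>0 powr p = 0\<close>.
\<close>

definition singular_values :: "real mat \<Rightarrow> real multiset" where
  "singular_values X = image_mset sqrt (proots (char_poly (transpose_mat X * X)))"

definition nuclear_norm :: "real mat \<Rightarrow> real" where
  "nuclear_norm X = (\<Sum>s\<in>#singular_values X. s)"

text \<open>This is $\|X\|_{S_p}^p$, i.e. already raised to the power $p$.\<close>

definition schatten_pow :: "real \<Rightarrow> real mat \<Rightarrow> real" where
  "schatten_pow p X = (\<Sum>s\<in>#singular_values X. s powr p)"

text \<open>Smallest nonzero singular value; the value 0 for the zero matrix is a convention.\<close>

definition sigma_min :: "real mat \<Rightarrow> real" where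
  "sigma_min X = (let S = {s \<in> set_mset (singular_values X). s \<noteq> 0}
                  in if S = {} then 0 else Min S)"

section \<open>First- and second-order calculus on pairs of factors\<close>

definition factors :: "nat \<Rightarrow> nat \<Rightarrow> nat \<Rightarrow> (real mat \<times> real mat) set" where
  "factors m n d = carrier_mat m d \<times> carrier_mat n d"

definition pair_inner :: "real mat \<times> real mat \<Rightarrow> real mat \<times> real mat \<Rightarrow> real" where
  "pair_inner z w = frob_inner (fst z) (fst w) + frob_inner (snd z) (snd w)"

definition pair_norm :: "real mat \<times> real mat \<Rightarrow> real" where
  "pair_norm z = sqrt (pair_inner z z)"

definition pair_scale :: "real \<Rightarrow> real mat \<times> real mat \<Rightarrow> real mat \<times> real mat" where
  "pair_scale a z = (a \<cdot>\<^sub>m fst z, a \<cdot>\<^sub>m snd z)"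

definition frechet_subdiff ::
  "nat \<Rightarrow> nat \<Rightarrow> nat \<Rightarrow> (real mat \<times> real mat \<Rightarrow> real) \<Rightarrow> real mat \<times> real mat \<Rightarrow> (real mat \<times> real mat) set"
where
  "frechet_subdiff m n d f z =
     {g \<in> factors m n d. \<forall>\<epsilon>>0. \<exists>\<eta>>0. \<forall>h\<in>factors m n d. pair_norm h < \<eta> \<longrightarrow>
        f (z + h) \<ge> f z + pair_inner g h - \<epsilon> * pair_norm h}"

definition limiting_subdiff ::
  "nat \<Rightarrow> nat \<Rightarrow> nat \<Rightarrow> (real mat \<times> real mat \<Rightarrow> real) \<Rightarrow> real mat \<times> real mat \<Rightarrow> (real mat \<times> real mat) set"
where
  "limiting_subdiff m n d f z =
     {g \<in> factors m n d. \<exists>zs gs.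
        (\<forall>k::nat. zs k \<in> factors m n d \<and> gs k \<in> frechet_subdiff m n d f (zs k)) \<and>
        (\<lambda>k. pair_norm (zs k - z)) \<longlonglongrightarrow> 0 \<and>
        (\<lambda>k. f (zs k)) \<longlonglongrightarrow> f z \<and>
        (\<lambda>k. pair_norm (gs k - g)) \<longlonglongrightarrow> 0}"

definition critical_point ::
  "nat \<Rightarrow> nat \<Rightarrow> nat \<Rightarrow> (real mat \<times> real mat \<Rightarrow> real) \<Rightarrow> real mat \<times> real mat \<Rightarrow> bool"
where
  "critical_point m n d f z \<longleftrightarrow>
     z \<in> factors m n d \<and> (0\<^sub>m m d, 0\<^sub>m n d) \<in> limiting_subdiff m n d f z"

definition orthogonal_cols :: "real mat \<Rightarrow> bool" where
  "orthogonal_cols A \<longleftrightarrow>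
     (\<forall>i<dim_col A. \<forall>j<dim_col A. i \<noteq> j \<longrightarrow> scalar_prod (col A i) (col A j) = 0)"

definition S_critical ::
  "nat \<Rightarrow> nat \<Rightarrow> nat \<Rightarrow> (real mat \<times> real mat \<Rightarrow> real) \<Rightarrow> real mat \<Rightarrow> real mat \<Rightarrow> bool"
where
  "S_critical m n d f U V \<longleftrightarrow>
     critical_point m n d f (U, V) \<and>
     (\<exists>U' \<in> carrier_mat m d. \<exists>V' \<in> carrier_mat n d.
        orthogonal_cols U' \<and> orthogonal_cols V' \<and>
        U * transpose_mat V = U' * transpose_mat V' \<and>
        critical_point m n d f (U', V'))"

definition has_gradient ::
  "nat \<Rightarrow> nat \<Rightarrow> nat \<Rightarrow> (real mat \<times> real mat \<Rightarrow> real) \<Rightarrow> real mat \<times> real mat \<Rightarrow> real mat \<times> real mat \<Rightarrow> bool"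
where
  "has_gradient m n d f z g \<longleftrightarrow>
     g \<in> factors m n d \<and>
     (\<forall>\<epsilon>>0. \<exists>\<eta>>0. \<forall>h\<in>factors m n d. pair_norm h < \<eta> \<longrightarrow>
        \<bar>f (z + h) - f z - pair_inner g h\<bar> \<le> \<epsilon> * pair_norm h)"

text \<open>
  \<open>L\<close> is the Hessian of \<open>f\<close> at \<open>z\<close>, as a linear operator: \<open>f\<close> is differentiable near \<open>z\<close> and
  its gradient field \<open>G\<close> is differentiable at \<open>z\<close> with derivative \<open>L\<close>.
\<close>

definition has_hessian ::
  "nat \<Rightarrow> nat \<Rightarrow> nat \<Rightarrow> (real mat \<times> real mat \<Rightarrow> real) \<Rightarrow> real mat \<times> real mat
     \<Rightarrow> (real mat \<times> real mat \<Rightarrow> real mat \<times> real mat) \<Rightarrow> bool"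
where
  "has_hessian m n d f z L \<longleftrightarrow>
     (\<forall>h\<in>factors m n d. L h \<in> factors m n d) \<and>
     (\<forall>h\<in>factors m n d. \<forall>k\<in>factors m n d. L (h + k) = L h + L k) \<and>
     (\<forall>a. \<forall>h\<in>factors m n d. L (pair_scale a h) = pair_scale a (L h)) \<and>
     (\<exists>G. (\<exists>\<rho>>0. \<forall>h\<in>factors m n d. pair_norm h < \<rho> \<longrightarrow> has_gradient m n d f (z + h) (G (z + h))) \<and>
          (\<forall>\<epsilon>>0. \<exists>\<eta>>0. \<forall>h\<in>factors m n d. pair_norm h < \<eta> \<longrightarrow>
             pair_norm (G (z + h) - G z - L h) \<le> \<epsilon> * pair_norm h))"

definition psd_hessian ::
  "nat \<Rightarrow> nat \<Rightarrow> nat \<Rightarrow> (real mat \<times> real mat \<Rightarrow> real) \<Rightarrow> real mat \<times> real mat \<Rightarrow> bool"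
where
  "psd_hessian m n d f z \<longleftrightarrow>
     (\<exists>L. has_hessian m n d f z L \<and> (\<forall>h\<in>factors m n d. pair_inner h (L h) \<ge> 0))"

section \<open>Measurements, noise and the objective\<close>

text \<open>A linear operator into $R^l$ is given by its representing matrices \<open>A 0, \<dots>, A (l - 1)\<close>.\<close>

definition meas :: "(nat \<Rightarrow> real mat) \<Rightarrow> real mat \<Rightarrow> nat \<Rightarrow> real" where
  "meas A H i = frob_inner (A i) H"

definition RIP :: "nat \<Rightarrow> nat \<Rightarrow> nat \<Rightarrow> (nat \<Rightarrow> real mat) \<Rightarrow> nat \<Rightarrow> real \<Rightarrow> bool" where
  "RIP m n l A s \<delta> \<longleftrightarrow>
     (\<forall>H\<in>carrier_mat m n. mat_rank H \<le> s \<longrightarrow>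
        (1 - \<delta>) * (frob_norm H)\<^sup>2 \<le> 1 / real l * (\<Sum>i<l. (meas A H i)\<^sup>2) \<and>
        1 / real l * (\<Sum>i<l. (meas A H i)\<^sup>2) \<le> (1 + \<delta>) * (frob_norm H)\<^sup>2)"

definition loss :: "nat \<Rightarrow> (nat \<Rightarrow> real mat) \<Rightarrow> (nat \<Rightarrow> real) \<Rightarrow> real mat \<Rightarrow> real" where
  "loss l A y X = (L2_set (\<lambda>i. meas A X i - y i) {..<l})\<^sup>2"

definition Phi ::
  "nat \<Rightarrow> (nat \<Rightarrow> real mat) \<Rightarrow> (nat \<Rightarrow> real) \<Rightarrow> real \<Rightarrow> real \<Rightarrow> real mat \<times> real mat \<Rightarrow> real"
where
  "Phi l A y q lam = (\<lambda>(U, V). loss l A y (U * transpose_mat V)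
                       + lam / q * (norm_2q_pow q U + norm_2q_pow q V))"

text \<open>
  Sub-Gaussian with parameter $\sigma^2$.  Integrability is required explicitly because the
  Bochner integral of a non-integrable function is 0.
\<close>

definition sub_gaussian :: "'a measure \<Rightarrow> ('a \<Rightarrow> real) \<Rightarrow> real \<Rightarrow> bool" where
  "sub_gaussian M X \<sigma> \<longleftrightarrow>
     (\<forall>t. integrable M (\<lambda>x. exp (t * X x)) \<and>
          integral\<^sup>L M (\<lambda>x. exp (t * X x)) \<le> exp (\<sigma>\<^sup>2 * t\<^sup>2 / 2))"

definition iid_sub_gaussian :: "'a measure \<Rightarrow> nat \<Rightarrow> (nat \<Rightarrow> 'a \<Rightarrow> real) \<Rightarrow> real \<Rightarrow> bool" where
  "iid_sub_gaussian M l \<omega> \<sigma> \<longleftrightarrow>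
     prob_space.indep_vars M (\<lambda>_. borel) \<omega> {..<l} \<and>
     (\<forall>i<l. \<forall>j<l. distr M borel (\<omega> i) = distr M borel (\<omega> j)) \<and>
     (\<forall>i<l. sub_gaussian M (\<omega> i) \<sigma>)"

definition tail_constant ::
  "'a measure \<Rightarrow> nat \<Rightarrow> nat \<Rightarrow> nat \<Rightarrow> (nat \<Rightarrow> 'a \<Rightarrow> real) \<Rightarrow> real \<Rightarrow> real \<Rightarrow> bool"
where
  "tail_constant M m n l \<omega> \<sigma> c \<longleftrightarrow>
     (\<forall>\<tau> :: nat \<Rightarrow> real.
        measure M {x \<in> space M. \<bar>\<Sum>i<l. \<tau> i * \<omega> i x\<bar>
                      \<le> c * \<sigma> * sqrt (ln (real (n * m))) * L2_set \<tau> {..<l}}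
          \<ge> 1 - 1 / real (m * n))"

text \<open>
  The property \<open>P\<close> of outcomes, not assumed measurable, holds with probability at least \<open>p\<close>.
\<close>

definition holds_with_prob :: "'a measure \<Rightarrow> real \<Rightarrow> ('a \<Rightarrow> bool) \<Rightarrow> bool" where
  "holds_with_prob M p P \<longleftrightarrow> (\<exists>E \<in> sets M. measure M E \<ge> p \<and> (\<forall>x\<in>E. P x))"

end

theory Submission
  imports Defs
begin

text \<open>
  Since $l = (\alpha + \beta)/4$, the constants may depend on \<open>l\<close>, and a union bound over the
  coordinates controls $\|\omega\|_2^2$ outside an event of probability $1/(mn)$.

  On the good event, comparing the first-order conditions at $(U, V)$ and at $(\bar U, \bar V)$
  shows that \<open>U\<close> and \<open>V\<close> have orthogonal columns with equal norms, so $U = PS$, $V = QS$ with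
  \<open>P\<close>, \<open>Q\<close> orthonormal, and $\nabla F(X)$ acts on the ranges of \<open>P\<close> and \<open>Q\<close> as
  $-\lambda P S^{q-2} Q^T$.  Factor $X^* = U_* V_*^T$ with $U_*^T U_* = V_*^T V_*$ and rotate so
  that $P^T U_* + Q^T V_*$ is symmetric.  The components $L$, $R$ of $U_*$, $V_*$ orthogonal to
  $P$, $Q$ form a direction along which the Hessian bounds $-\langle\nabla F(X), L R^T\rangle$ by
  $\|\mathcal{A}(L V^T + U R^T)\|^2$ plus regularization terms, and
  $\|L V^T + U R^T\|_F \le \|X - X^*\|_F$.  Inserting this into
  $\langle\nabla F(X), X - X^*\rangle = 2\|\mathcal{A}(X - X^*)\|^2 - 2\langle\omega, \mathcal{A}(X - X^*)\rangle$
  leaves a positive multiple of $\|X - X^*\|_F^2$, because $\beta/2 < 0.69\,\alpha$ for $\delta < 19/119$.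
\<close>

section \<open>The Frobenius inner product\<close>

text \<open>The two critical points have the same product, hence the same gradient \<open>G\<close>
  of the loss; this is what makes their first-order conditions comparable. The obstacle is that the
  orthogonal pair may have zero columns, where the regularizer need not be differentiable, so first
  derivatives are taken only in directions that keep those columns zero. Nonzero orthogonal columns
  give X the rank d, hence d = r. Once \<open>G\<close> is known on the ranges of \<open>P\<close>
  and \<open>Q\<close>, the only unknown part of its pairing with \<open>Xs\<close> is the one with
  L R^T, and this is exactly the second-order term of the line through (U, V) in direction (L, R).
  The quadratic terms then compare as follows: the gradient pairing contains twice the measured
  square of E = X - Xs, the Hessian costs once the measured square of K = L V^T + U R^T, and |K|
  \<le> |E| holds with constant 1. Noise takes 3/5 of the factor 2 by Young's inequality; the
  remaining 7/5 must exceed (1 + \<delta>)/(1 - \<delta>), which stays below 69/50 for \<delta> <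
  19/119.\<close>

lemma index_mult_mat_sum:
  assumes "A \<in> carrier_mat m k" "B \<in> carrier_mat k n" "i < m" "j < n"
  shows "(A * B) $$ (i, j) = (\<Sum>l<k. A $$ (i, l) * B $$ (l, j))"
  using assms by (auto simp: scalar_prod_def lessThan_atLeast0 intro!: sum.cong)

lemma frob_inner_carrier:
  assumes "A \<in> carrier_mat m n"
  shows "frob_inner A B = (\<Sum>i<m. \<Sum>j<n. A $$ (i, j) * B $$ (i, j))"
  using assms by (auto simp: frob_inner_def)

lemma frob_inner_commute:
  assumes "A \<in> carrier_mat m n" "B \<in> carrier_mat m n"
  shows "frob_inner A B = frob_inner B A"
  using assms by (auto simp: frob_inner_def mult.commute)

lemma frob_inner_add_left:
  assumes "A \<in> carrier_mat m n" "B \<in> carrier_mat m n"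
  shows "frob_inner (A + B) C = frob_inner A C + frob_inner B C"
  using assms by (auto simp: frob_inner_def sum.distrib algebra_simps)

lemma frob_inner_add_right:
  assumes "A \<in> carrier_mat m n" "B \<in> carrier_mat m n" "C \<in> carrier_mat m n"
  shows "frob_inner A (B + C) = frob_inner A B + frob_inner A C"
  using assms by (auto simp: frob_inner_def sum.distrib algebra_simps)

lemma frob_inner_minus_left:
  assumes "A \<in> carrier_mat m n" "B \<in> carrier_mat m n"
  shows "frob_inner (A - B) C = frob_inner A C - frob_inner B C"
  using assms by (auto simp: frob_inner_def sum_subtractf algebra_simps)

lemma frob_inner_minus_right:
  assumes "A \<in> carrier_mat m n" "B \<in> carrier_mat m n" "C \<in> carrier_mat m n"
  shows "frob_inner A (B - C) = frob_inner A B - frob_inner A C"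
  using assms by (auto simp: frob_inner_def sum_subtractf algebra_simps)

lemma frob_inner_smult_left:
  "frob_inner (a \<cdot>\<^sub>m A) B = a * frob_inner A B"
  by (auto simp: frob_inner_def sum_distrib_left algebra_simps)

lemma frob_inner_smult_right:
  assumes "A \<in> carrier_mat m n" "B \<in> carrier_mat m n"
  shows "frob_inner A (a \<cdot>\<^sub>m B) = a * frob_inner A B"
  using assms by (auto simp: frob_inner_def sum_distrib_left algebra_simps)

lemma frob_inner_zero_left [simp]: "frob_inner (0\<^sub>m m n) B = 0"
  by (simp add: frob_inner_def)

lemma frob_inner_zero_right:
  assumes "A \<in> carrier_mat m n"
  shows "frob_inner A (0\<^sub>m m n) = 0"
  using assms by (simp add: frob_inner_def)

lemma frob_inner_transpose:
  assumes "A \<in> carrier_mat m n" "B \<in> carrier_mat m n"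
  shows "frob_inner (A\<^sup>T) (B\<^sup>T) = frob_inner A B"
proof -
  have "frob_inner (A\<^sup>T) (B\<^sup>T) = (\<Sum>i<n. \<Sum>j<m. A $$ (j, i) * B $$ (j, i))"
    using assms by (subst frob_inner_carrier[of _ n m]) (auto intro!: sum.cong)
  also have "\<dots> = (\<Sum>j<m. \<Sum>i<n. A $$ (j, i) * B $$ (j, i))" by (rule sum.swap)
  finally show ?thesis using frob_inner_carrier[OF assms(1)] by simp
qed

lemma frob_inner_self_nonneg [simp]: "frob_inner A A \<ge> 0"
  by (auto simp: frob_inner_def intro!: sum_nonneg)

lemma frob_norm_square: "(frob_norm A)\<^sup>2 = frob_inner A A"
  by (simp add: frob_norm_def)

lemma frob_inner_self_eq_0:
  assumes "A \<in> carrier_mat m n" "frob_inner A A = 0"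
  shows "A = 0\<^sub>m m n"
proof (rule eq_matI)
  fix i j assume ij: "i < dim_row (0\<^sub>m m n)" "j < dim_col (0\<^sub>m m n)"
  have "(\<Sum>i<m. \<Sum>j<n. A $$ (i, j) * A $$ (i, j)) = 0"
    using assms(2) frob_inner_carrier[OF assms(1), of A] by simp
  hence "\<forall>i\<in>{..<m}. (\<Sum>j<n. A $$ (i, j) * A $$ (i, j)) = 0"
    by (subst (asm) sum_nonneg_eq_0_iff) (auto intro!: sum_nonneg)
  hence "(\<Sum>j<n. A $$ (i, j) * A $$ (i, j)) = 0" using ij by auto
  hence "\<forall>j\<in>{..<n}. A $$ (i, j) * A $$ (i, j) = 0"
    by (subst (asm) sum_nonneg_eq_0_iff) auto
  thus "A $$ (i, j) = 0\<^sub>m m n $$ (i, j)" using ij by auto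
qed (use assms in auto)

text \<open>With its three variants this is the tool for isolating orthonormal factors: a factor of
  a product crosses the inner product as its transpose, and products such as
  \<open>P\<^sup>T * P\<close> then cancel.\<close>

lemma frob_inner_mult_left:
  assumes "A \<in> carrier_mat m k" "B \<in> carrier_mat k n" "C \<in> carrier_mat m n"
  shows "frob_inner (A * B) C = frob_inner B (A\<^sup>T * C)"
proof -
  have "frob_inner (A * B) C = (\<Sum>i<m. \<Sum>j<n. \<Sum>l<k. A $$ (i, l) * B $$ (l, j) * C $$ (i, j))"
    using assms by (subst frob_inner_carrier[of _ m n])
      (auto simp: sum_distrib_right index_mult_mat_sum[OF assms(1,2)] simp del: index_mult_mat(1) intro!: sum.cong)
  also have "\<dots> = (\<Sum>i<m. \<Sum>l<k. \<Sum>j<n. A $$ (i, l) * B $$ (l, j) * C $$ (i, j))"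
    by (rule sum.cong[OF refl], rule sum.swap)
  also have "\<dots> = (\<Sum>l<k. \<Sum>i<m. \<Sum>j<n. A $$ (i, l) * B $$ (l, j) * C $$ (i, j))"
    by (rule sum.swap)
  also have "\<dots> = (\<Sum>l<k. \<Sum>j<n. \<Sum>i<m. A $$ (i, l) * B $$ (l, j) * C $$ (i, j))"
    by (rule sum.cong[OF refl], rule sum.swap)
  also have "\<dots> = frob_inner B (A\<^sup>T * C)"
    using assms by (subst frob_inner_carrier[of _ k n])
      (auto simp: sum_distrib_left index_mult_mat_sum[of "A\<^sup>T" k m C n] mult_ac simp del: index_mult_mat(1) intro!: sum.cong)
  finally show ?thesis .
qed

lemma frob_inner_mult_left':
  assumes "A \<in> carrier_mat m k" "B \<in> carrier_mat k n" "C \<in> carrier_mat m n"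
  shows "frob_inner (A * B) C = frob_inner A (C * B\<^sup>T)"
proof -
  have "frob_inner (A * B) C = frob_inner (B\<^sup>T * A\<^sup>T) (C\<^sup>T)"
    using assms frob_inner_transpose[of "A * B" m n C] by (simp add: transpose_mult[OF assms(1,2)])
  also have "\<dots> = frob_inner (A\<^sup>T) (B * C\<^sup>T)"
    using assms by (subst frob_inner_mult_left[of _ n k _ m]) auto
  also have "\<dots> = frob_inner A (C * B\<^sup>T)"
    using assms frob_inner_transpose[of A m k "C * B\<^sup>T"]
    by (simp add: transpose_mult[of C m n])
  finally show ?thesis .
qed

lemma frob_inner_mult_right:
  assumes "A \<in> carrier_mat m k" "B \<in> carrier_mat k n" "C \<in> carrier_mat m n"
  shows "frob_inner C (A * B) = frob_inner (A\<^sup>T * C) B"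
  using frob_inner_mult_left[OF assms] assms
    frob_inner_commute[of C m n "A * B"] frob_inner_commute[of B k n "A\<^sup>T * C"] by simp

lemma frob_inner_mult_right':
  assumes "A \<in> carrier_mat m k" "B \<in> carrier_mat k n" "C \<in> carrier_mat m n"
  shows "frob_inner C (A * B) = frob_inner (C * B\<^sup>T) A"
  using frob_inner_mult_left'[OF assms] assms
    frob_inner_commute[of C m n "A * B"] frob_inner_commute[of A m k "C * B\<^sup>T"] by simp

text \<open>Through this bound, convergence in the Frobenius norm is later read entry by
  entry.\<close>

lemma square_entry_le_frob_inner:
  assumes "A \<in> carrier_mat m n" "i < m" "j < n"
  shows "(A $$ (i, j))\<^sup>2 \<le> frob_inner A A"
proof -
  have "(A $$ (i, j))\<^sup>2 \<le> (\<Sum>j<n. A $$ (i, j) * A $$ (i, j))"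
    using assms member_le_sum[of j "{..<n}" "\<lambda>j. A $$ (i, j) * A $$ (i, j)"] by (auto simp: power2_eq_square)
  also have "\<dots> \<le> (\<Sum>i<m. \<Sum>j<n. A $$ (i, j) * A $$ (i, j))"
    by (rule member_le_sum[of i "{..<m}" "\<lambda>i. \<Sum>j<n. A $$ (i, j) * A $$ (i, j)"])
      (use assms in \<open>auto intro!: sum_nonneg\<close>)
  finally show ?thesis using assms by (simp add: frob_inner_carrier[of A m n])
qed

section \<open>Diagonal matrices and weighted columns\<close>

definition dmat :: "nat \<Rightarrow> (nat \<Rightarrow> real) \<Rightarrow> real mat" where
  "dmat d f = Matrix.mat d d (\<lambda>(i, j). if i = j then f i else 0)"

lemma dmat_carrier [simp]: "dmat d f \<in> carrier_mat d d"
  by (simp add: dmat_def)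

lemma dim_dmat [simp]: "dim_row (dmat d f) = d" "dim_col (dmat d f) = d"
  by (simp_all add: dmat_def)

lemma transpose_dmat [simp]: "(dmat d f)\<^sup>T = dmat d f"
  by (rule eq_matI) (auto simp: dmat_def)

lemma index_mult_dmat_right:
  assumes "A \<in> carrier_mat m d" "i < m" "j < d"
  shows "(A * dmat d f) $$ (i, j) = A $$ (i, j) * f j"
proof -
  have "(A * dmat d f) $$ (i, j) = (\<Sum>l<d. A $$ (i, l) * dmat d f $$ (l, j))"
    using assms by (intro index_mult_mat_sum) auto
  also have "\<dots> = (\<Sum>l<d. if l = j then A $$ (i, l) * f l else 0)"
    using assms by (intro sum.cong) (auto simp: dmat_def)
  finally show ?thesis using assms by simp
qed

lemma index_mult_dmat_left:
  assumes "A \<in> carrier_mat d n" "i < d" "j < n"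
  shows "(dmat d f * A) $$ (i, j) = f i * A $$ (i, j)"
proof -
  have "(dmat d f * A) $$ (i, j) = (\<Sum>l<d. dmat d f $$ (i, l) * A $$ (l, j))"
    using assms by (intro index_mult_mat_sum) auto
  also have "\<dots> = (\<Sum>l<d. if l = i then f l * A $$ (l, j) else 0)"
    using assms by (intro sum.cong) (auto simp: dmat_def)
  finally show ?thesis using assms by simp
qed

lemma dmat_mult: "dmat d f * dmat d g = dmat d (\<lambda>i. f i * g i)"
  by (rule eq_matI) (auto simp: index_mult_dmat_left[OF dmat_carrier] simp del: index_mult_mat(1), auto simp: dmat_def)

lemma dmat_one: "dmat d (\<lambda>_. 1) = 1\<^sub>m d"
  by (rule eq_matI) (auto simp: dmat_def)

lemma dmat_cong: "(\<And>i. i < d \<Longrightarrow> f i = g i) \<Longrightarrow> dmat d f = dmat d g"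
  by (rule eq_matI) (auto simp: dmat_def)

lemma frob_inner_dmat:
  assumes "B \<in> carrier_mat d d"
  shows "frob_inner (dmat d f) B = (\<Sum>i<d. f i * B $$ (i, i))"
proof -
  have "frob_inner (dmat d f) B = (\<Sum>i<d. \<Sum>j<d. if j = i then f i * B $$ (i, i) else 0)"
    unfolding frob_inner_carrier[OF dmat_carrier] by (intro sum.cong refl) (auto simp: dmat_def)
  thus ?thesis by simp
qed

section \<open>Orthogonal matrices and the singular value decomposition\<close>

text \<open>Orthogonal matrices are encoded as functions on index pairs because the product topology
  on functions then supplies compactness. Fixing the value 0 outside the square is what keeps every
  coordinate bounded.\<close>

definition orthf :: "nat \<Rightarrow> (nat \<times> nat \<Rightarrow> real) set" where
  "orthf n = {f. (\<forall>i j. \<not> (i < n \<and> j < n) \<longrightarrow> f (i, j) = 0) \<and>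
     (\<forall>i<n. \<forall>j<n. (\<Sum>a<n. f (a, i) * f (a, j)) = (if i = j then 1 else 0))}"

lemma orthf_bounded:
  assumes "f \<in> orthf n"
  shows "f p \<in> {-1..1}"
proof (cases p)
  case (Pair a i)
  show ?thesis
  proof (cases "a < n \<and> i < n")
    case True
    have "(f (a, i))\<^sup>2 \<le> (\<Sum>a<n. f (a, i) * f (a, i))"
      using True member_le_sum[of a "{..<n}" "\<lambda>a. f (a, i) * f (a, i)"] by (auto simp: power2_eq_square)
    also have "\<dots> = 1" using assms True by (auto simp: orthf_def)
    finally show ?thesis using Pair abs_square_le_1[of "f (a, i)"] by (auto simp: abs_le_iff)
  next
    case False
    thus ?thesis using assms Pair by (auto simp: orthf_def)
  qed
qed

text \<open>Tychonoff gives a compact cube, \<open>orthf_bounded\<close> places the set inside it,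
  and each defining equation is a closed condition on finitely many coordinates.\<close>

lemma compact_orthf: "compact (orthf n)"
proof -
  have "compactin (product_topology (\<lambda>_::nat\<times>nat. euclidean :: real topology) UNIV) (PiE UNIV (\<lambda>_. {-1..1}))"
    by (simp add: compactin_PiE)
  hence 1: "compact (PiE UNIV (\<lambda>_::nat\<times>nat. {-1..1::real}))"
    by (simp add: euclidean_product_topology)
  have eq: "orthf n = (\<Inter>i. \<Inter>j. {f. (\<not> (i < n \<and> j < n) \<longrightarrow> f (i, j) = 0)}) \<inter>
     (\<Inter>i\<in>{..<n}. \<Inter>j\<in>{..<n}. {f. (\<Sum>a<n. f (a, i) * f (a, j)) = (if i = j then 1 else 0)})"
    by (auto simp: orthf_def)
  have "closed {f :: nat \<times> nat \<Rightarrow> real. P \<longrightarrow> f p = 0}" for p P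
    by (cases P) (auto intro!: closed_Collect_eq continuous_intros)
  moreover have "closed {f :: nat \<times> nat \<Rightarrow> real. (\<Sum>a<n. f (a, i) * f (a, j)) = c}" for i j c
    by (intro closed_Collect_eq continuous_intros continuous_on_product_coordinates)
  ultimately have 2: "closed (orthf n)"
    unfolding eq by (intro closed_Int closed_INT ballI) auto
  have "orthf n = PiE UNIV (\<lambda>_. {-1..1}) \<inter> orthf n"
    using orthf_bounded by (auto simp: PiE_def)
  thus ?thesis using compact_Int_closed[OF 1 2] by simp
qed

lemma orthf_nonempty: "orthf n \<noteq> {}"
proof -
  have "(\<Sum>a<n. (if a = i then 1 else 0) * (if a = j then 1 else 0)) = (if i = j then 1 else (0::real))"
    if "i < n" for i j
  proof -
    have "(\<Sum>a<n. (if a = i then 1 else 0) * (if a = j then 1 else (0::real)))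
        = (\<Sum>a<n. if a = i then (if i = j then 1 else 0) else 0)"
      by (rule sum.cong) auto
    thus ?thesis using that by simp
  qed
  hence "(\<lambda>(i, j). if i < n \<and> i = j then 1 else 0) \<in> orthf n"
    by (auto simp: orthf_def intro!: sum.neutral)
  thus ?thesis by blast
qed

text \<open>Stationarity under the plane rotation of the columns \<open>i\<close> and \<open>j\<close>.\<close>

lemma orthf_max_symmetric:
  assumes Y: "Y \<in> orthf n"
    and max: "\<And>Y'. Y' \<in> orthf n \<Longrightarrow> (\<Sum>k<n. \<Sum>a<n. Y' (a, k) * W a k) \<le> (\<Sum>k<n. \<Sum>a<n. Y (a, k) * W a k)"
    and ij: "i < n" "j < n"
  shows "(\<Sum>a<n. Y (a, j) * W a i) = (\<Sum>a<n. Y (a, i) * W a j)"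
proof (cases "i = j")
  case False
  define P where "P k l = (\<Sum>a<n. Y (a, k) * W a l)" for k l
  define R where "R t = (\<lambda>(a, k). if k = i then cos t * Y (a, i) + sin t * Y (a, j)
     else if k = j then - sin t * Y (a, i) + cos t * Y (a, j) else Y (a, k))" for t
  have on: "(\<Sum>a<n. Y (a, k) * Y (a, l)) = (if k = l then 1 else 0)" if "k < n" "l < n" for k l
    using Y that by (auto simp: orthf_def)
  have z: "Y (a, k) = 0" if "\<not> (a < n \<and> k < n)" for a k
    using Y that by (auto simp: orthf_def)
  have lin: "(\<Sum>a<n. (x * Y (a, k) + y * Y (a, l)) * (x' * Y (a, k') + y' * Y (a, l'))) =
      x * x' * (\<Sum>a<n. Y (a, k) * Y (a, k')) + x * y' * (\<Sum>a<n. Y (a, k) * Y (a, l'))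
    + y * x' * (\<Sum>a<n. Y (a, l) * Y (a, k')) + y * y' * (\<Sum>a<n. Y (a, l) * Y (a, l'))"
    for x y x' y' k l k' l'
    by (simp add: sum.distrib sum_distrib_left algebra_simps)
  have cs: "cos t * cos t + sin t * sin t = (1::real)" for t
    by (metis power2_eq_square sin_cos_squared_add2)
  have cs': "sin t * sin t + cos t * cos t = (1::real)" for t
    by (subst add.commute) (rule cs)
  \<comment> \<open>Every column of \<open>R t\<close> is a combination of two columns of
    \<open>Y\<close> with one of three coefficient patterns, so orthonormality reduces to the
    bilinear expansion \<open>lin\<close> and a case check.\<close>
  have comb: "\<exists>x y k1 k2. (\<forall>a. R t (a, k) = x * Y (a, k1) + y * Y (a, k2)) \<and> k1 < n \<and> k2 < n \<and>
      (k = i \<and> x = cos t \<and> y = sin t \<and> k1 = i \<and> k2 = j \<or>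
       k = j \<and> x = - sin t \<and> y = cos t \<and> k1 = i \<and> k2 = j \<or>
       k \<noteq> i \<and> k \<noteq> j \<and> x = 1 \<and> y = 0 \<and> k1 = k \<and> k2 = k)" if "k < n" for t k
  proof -
    consider "k = i" | "k = j" | "k \<noteq> i" "k \<noteq> j" by blast
    thus ?thesis
    proof cases
      case 1 thus ?thesis using ij
        by (intro exI[of _ "cos t"] exI[of _ "sin t"] exI[of _ i] exI[of _ j]) (auto simp: R_def)
    next
      case 2 thus ?thesis using ij False
        by (intro exI[of _ "- sin t"] exI[of _ "cos t"] exI[of _ i] exI[of _ j]) (auto simp: R_def)
    next
      case 3 thus ?thesis using that
        by (intro exI[of _ 1] exI[of _ 0] exI[of _ k]) (auto simp: R_def)
    qed
  qed
  have orth: "(\<Sum>a<n. R t (a, k) * R t (a, l)) = (if k = l then 1 else 0)" if kl: "k < n" "l < n" for t k l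
  proof -
    obtain x y k1 k2 where k: "\<forall>a. R t (a, k) = x * Y (a, k1) + y * Y (a, k2)" "k1 < n" "k2 < n"
      and kc: "k = i \<and> x = cos t \<and> y = sin t \<and> k1 = i \<and> k2 = j \<or>
       k = j \<and> x = - sin t \<and> y = cos t \<and> k1 = i \<and> k2 = j \<or>
       k \<noteq> i \<and> k \<noteq> j \<and> x = 1 \<and> y = 0 \<and> k1 = k \<and> k2 = k"
      using comb[OF kl(1), of t] by (elim exE conjE) blast
    obtain x' y' l1 l2 where l: "\<forall>a. R t (a, l) = x' * Y (a, l1) + y' * Y (a, l2)" "l1 < n" "l2 < n"
      and lc: "l = i \<and> x' = cos t \<and> y' = sin t \<and> l1 = i \<and> l2 = j \<or>
       l = j \<and> x' = - sin t \<and> y' = cos t \<and> l1 = i \<and> l2 = j \<or>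
       l \<noteq> i \<and> l \<noteq> j \<and> x' = 1 \<and> y' = 0 \<and> l1 = l \<and> l2 = l"
      using comb[OF kl(2), of t] by (elim exE conjE) blast
    show ?thesis
      unfolding k(1)[rule_format] l(1)[rule_format] lin on[OF k(2) l(2)] on[OF k(2) l(3)] on[OF k(3) l(2)] on[OF k(3) l(3)]
      using kc lc False cs[of t] cs'[of t] by auto
  qed
  have R: "R t \<in> orthf n" for t
    using orth ij z by (auto simp: orthf_def R_def)
  define s where "s = (\<Sum>k\<in>{..<n} - {i} - {j}. P k k)"
  have split: "(\<Sum>k<n. g k) = g i + g j + (\<Sum>k\<in>{..<n} - {i} - {j}. g k)" for g :: "nat \<Rightarrow> real"
    using ij False by (subst sum.remove[of _ i], simp, simp, subst sum.remove[of _ j]) auto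
  have "(\<Sum>k<n. \<Sum>a<n. R t (a, k) * W a k) =
     cos t * P i i + sin t * P j i + (- sin t * P i j + cos t * P j j) + s" for t
  proof -
    have "(\<Sum>a<n. R t (a, i) * W a i) = cos t * P i i + sin t * P j i"
      by (simp add: R_def P_def sum.distrib sum_distrib_left algebra_simps)
    moreover have "(\<Sum>a<n. R t (a, j) * W a j) = - sin t * P i j + cos t * P j j"
      using False by (simp add: R_def P_def sum.distrib sum_subtractf sum_distrib_left sum_negf algebra_simps)
    moreover have "(\<Sum>k\<in>{..<n} - {i} - {j}. \<Sum>a<n. R t (a, k) * W a k) = s"
      unfolding s_def P_def by (rule sum.cong) (auto simp: R_def)
    ultimately show ?thesis unfolding split[of "\<lambda>k. \<Sum>a<n. R t (a, k) * W a k"] by simp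
  qed
  moreover have "(\<Sum>k<n. \<Sum>a<n. Y (a, k) * W a k) = P i i + P j j + s"
    unfolding split[of "\<lambda>k. \<Sum>a<n. Y (a, k) * W a k"] by (simp add: P_def s_def)
  ultimately have le: "cos t * P i i + sin t * P j i + (- sin t * P i j + cos t * P j j) + s \<le> P i i + P j j + s" for t
    using max[OF R[of t]] by simp
  \<comment> \<open>At angle 0 the rotation is the identity and the objective is maximal, so this
    derivative vanishes; its two terms are the sums to be compared.\<close>
  have "((\<lambda>t. cos t * P i i + sin t * P j i + (- sin t * P i j + cos t * P j j) + s)
      has_real_derivative (P j i - P i j)) (at 0)"
    by (auto intro!: derivative_eq_intros)
  from DERIV_local_max[OF this, of 1] le have "P j i - P i j = 0" by simp
  thus ?thesis by (simp add: P_def)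
qed simp

lemma orthf_mat:
  assumes "f \<in> orthf n"
  defines "Y \<equiv> Matrix.mat n n f"
  shows "Y\<^sup>T * Y = 1\<^sub>m n"
proof (rule eq_matI)
  fix i j assume "i < dim_row (1\<^sub>m n :: real mat)" "j < dim_col (1\<^sub>m n :: real mat)"
  thus "(Y\<^sup>T * Y) $$ (i, j) = 1\<^sub>m n $$ (i, j)"
    using assms by (subst index_mult_mat_sum[of _ n n _ n]) (auto simp: orthf_def)
qed (auto simp: Y_def)

text \<open>Some orthogonal \<open>Q\<close> maximizes the trace of \<open>T * Q\<close>, and
  stationarity under plane rotations makes \<open>T * Q\<close> symmetric there. This is the
  symmetry part of a polar decomposition; no sign of the eigenvalues is claimed.\<close>

lemma ex_orthogonal_symmetric:
  fixes T :: "real mat"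
  assumes T: "T \<in> carrier_mat n n"
  shows "\<exists>Q \<in> carrier_mat n n. Q\<^sup>T * Q = 1\<^sub>m n \<and>
     (\<forall>i<n. \<forall>j<n. (T * Q) $$ (i, j) = (T * Q) $$ (j, i))"
proof -
  define S where "S f = (\<Sum>k<n. \<Sum>a<n. f (a, k) * T $$ (k, a))" for f :: "nat \<times> nat \<Rightarrow> real"
  have "continuous_on (orthf n) S"
    unfolding S_def
    by (intro continuous_intros continuous_on_subset[OF continuous_on_product_coordinates subset_UNIV])
  from continuous_attains_sup[OF compact_orthf orthf_nonempty this]
  obtain Y where Y: "Y \<in> orthf n" "\<And>Y'. Y' \<in> orthf n \<Longrightarrow> S Y' \<le> S Y" by blast
  define Q where "Q = Matrix.mat n n Y"
  have Q: "Q \<in> carrier_mat n n" by (simp add: Q_def)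
  have "(T * Q) $$ (i, j) = (T * Q) $$ (j, i)" if "i < n" "j < n" for i j
    using orthf_max_symmetric[OF Y(1), of "\<lambda>a k. T $$ (k, a)" i j] Y(2) that
    unfolding index_mult_mat_sum[OF T Q that] index_mult_mat_sum[OF T Q that(2,1)]
    by (simp add: S_def Q_def mult.commute)
  thus ?thesis using orthf_mat[OF Y(1)] Q by (auto simp: Q_def)
qed

text \<open>
  The weights \<open>i + 1\<close> are distinct, so stationarity of the weighted trace of $Y^T T Z$ under
  rotations of the columns of \<open>Y\<close> and of \<open>Z\<close> forces the off-diagonal entries to vanish.
\<close>

lemma svd_obtain:
  fixes T :: "real mat"
  assumes T: "T \<in> carrier_mat m n"
  obtains Y Z where "Y \<in> carrier_mat m m" "Y\<^sup>T * Y = 1\<^sub>m m"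
    "Z \<in> carrier_mat n n" "Z\<^sup>T * Z = 1\<^sub>m n"
    "\<And>i j. i < m \<Longrightarrow> j < n \<Longrightarrow> i \<noteq> j \<Longrightarrow> (Y\<^sup>T * T * Z) $$ (i, j) = 0"
proof -
  \<comment> \<open>The weight is 0 from \<open>min m n\<close> on, so the weighted trace may be
    summed over \<open>m\<close> or over \<open>n\<close> indices; \<open>S1\<close> and
    \<open>S2\<close> use this to bring it into the form needed for rotating \<open>Y\<close> and
    \<open>Z\<close>.\<close>
  define c where "c i = (if i < min m n then real (i + 1) else 0)" for i
  define D :: "(nat \<times> nat \<Rightarrow> real) \<times> (nat \<times> nat \<Rightarrow> real) \<Rightarrow> nat \<Rightarrow> nat \<Rightarrow> real"
    where "D YZ i j = (\<Sum>a<m. \<Sum>b<n. fst YZ (a, i) * T $$ (a, b) * snd YZ (b, j))" for YZ i j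
  define S where "S YZ = (\<Sum>i<min m n. c i * D YZ i i)" for YZ
  have cp: "continuous_on UNIV (\<lambda>f :: nat \<times> nat \<Rightarrow> real. f p)" for p
    by (rule continuous_on_product_coordinates)
  have c: "continuous_on (orthf m \<times> orthf n) (\<lambda>x. fst x p)"
    "continuous_on (orthf m \<times> orthf n) (\<lambda>x. snd x p)" for p
    using continuous_on_compose2[OF cp continuous_on_fst[OF continuous_on_id] subset_UNIV, of "orthf m \<times> orthf n" p]
      continuous_on_compose2[OF cp continuous_on_snd[OF continuous_on_id] subset_UNIV, of "orthf m \<times> orthf n" p]
    by auto
  have "continuous_on (orthf m \<times> orthf n)
      (\<lambda>x. \<Sum>i<min m n. c i * (\<Sum>a<m. \<Sum>b<n. fst x (a, i) * T $$ (a, b) * snd x (b, i)))"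
    by (rule continuous_on_sum, rule continuous_on_mult, rule continuous_on_const,
        rule continuous_on_sum, rule continuous_on_sum, rule continuous_on_mult,
        rule continuous_on_mult, rule c, rule continuous_on_const, rule c)
  hence "continuous_on (orthf m \<times> orthf n) S"
    by (simp add: S_def[abs_def] D_def)
  from continuous_attains_sup[OF compact_Times[OF compact_orthf compact_orthf] _ this]
  obtain Y Z where Y: "Y \<in> orthf m" and Z: "Z \<in> orthf n"
    and max: "\<And>Y' Z'. Y' \<in> orthf m \<Longrightarrow> Z' \<in> orthf n \<Longrightarrow> S (Y', Z') \<le> S (Y, Z)"
    using orthf_nonempty by fastforce
  have S1: "S (Y', Z') = (\<Sum>k<m. \<Sum>a<m. Y' (a, k) * (c k * (\<Sum>b<n. T $$ (a, b) * Z' (b, k))))" for Y' Z'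
  proof -
    have "S (Y', Z') = (\<Sum>k<m. c k * D (Y', Z') k k)"
      unfolding S_def by (rule sum.mono_neutral_left) (auto simp: c_def)
    thus ?thesis by (simp add: D_def sum_distrib_left mult_ac)
  qed
  have S2: "S (Y', Z') = (\<Sum>k<n. \<Sum>b<n. Z' (b, k) * (c k * (\<Sum>a<m. T $$ (a, b) * Y' (a, k))))" for Y' Z'
  proof -
    have "S (Y', Z') = (\<Sum>k<n. c k * D (Y', Z') k k)"
      unfolding S_def by (rule sum.mono_neutral_left) (auto simp: c_def)
    also have "\<dots> = (\<Sum>k<n. c k * (\<Sum>b<n. \<Sum>a<m. Y' (a, k) * T $$ (a, b) * Z' (b, k)))"
      unfolding D_def by (simp, rule sum.cong[OF refl], rule arg_cong[where f = "(*) _"], rule sum.swap)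
    finally show ?thesis by (simp add: sum_distrib_left mult_ac)
  qed
  have E1: "c i * D (Y, Z) j i = c j * D (Y, Z) i j" if "i < m" "j < m" for i j
    using orthf_max_symmetric[OF Y, of "\<lambda>a k. c k * (\<Sum>b<n. T $$ (a, b) * Z (b, k))", OF _ that] max[OF _ Z]
    unfolding S1 by (simp add: D_def sum_distrib_left mult_ac)
  have E2: "c j * D (Y, Z) j i = c i * D (Y, Z) i j" if "i < n" "j < n" for i j
  proof -
    have "(\<Sum>b<n. Z (b, j) * (c i * (\<Sum>a<m. T $$ (a, b) * Y (a, i)))) =
        (\<Sum>b<n. Z (b, i) * (c j * (\<Sum>a<m. T $$ (a, b) * Y (a, j))))"
      using orthf_max_symmetric[OF Z, of "\<lambda>b k. c k * (\<Sum>a<m. T $$ (a, b) * Y (a, k))", OF _ that] max[OF Y]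
      unfolding S2 by simp
    moreover have "(\<Sum>b<n. Z (b, j) * (c i * (\<Sum>a<m. T $$ (a, b) * Y (a, i)))) = c i * D (Y, Z) i j" for i j
      unfolding D_def by (simp add: sum_distrib_left mult_ac, rule sum.swap)
    ultimately show ?thesis by simp
  qed
  have D0: "D (Y, Z) i j = 0" if ij: "i < m" "j < n" "i \<noteq> j" for i j
  proof -
    \<comment> \<open>Outside the common square one of the two weights is 0 and a single
      stationarity relation suffices; inside it the two relations are combined.\<close>
    consider "i \<ge> n" | "j \<ge> m" | "i < n" "j < m" by linarith
    thus ?thesis
    proof cases
      case 1
      thus ?thesis using E1[of j i] ij by (auto simp: c_def)
    next
      case 2
      thus ?thesis using E2[of i j] ij by (auto simp: c_def)
    next
      case 3
      have "(c i)\<^sup>2 * D (Y, Z) i j = c j * (c i * D (Y, Z) j i)"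
        using E2[of i j] ij 3 by (simp add: power2_eq_square)
      also have "\<dots> = (c j)\<^sup>2 * D (Y, Z) i j"
        using E1[of i j] ij 3 by (simp add: power2_eq_square)
      finally have "((c i)\<^sup>2 - (c j)\<^sup>2) * D (Y, Z) i j = 0" by (simp add: algebra_simps)
      moreover have "(c i)\<^sup>2 \<noteq> (c j)\<^sup>2"
        using ij 3 by (auto simp: c_def power2_eq_iff)
      ultimately show ?thesis by simp
    qed
  qed
  have YTZ: "((Matrix.mat m m Y)\<^sup>T * T * Matrix.mat n n Z) $$ (i, j) = D (Y, Z) i j"
    if ij: "i < m" "j < n" for i j
  proof -
    have "((Matrix.mat m m Y)\<^sup>T * T) \<in> carrier_mat m n"
      using T by (intro mult_carrier_mat[of _ m m]) auto
    hence "((Matrix.mat m m Y)\<^sup>T * T * Matrix.mat n n Z) $$ (i, j)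
        = (\<Sum>b<n. ((Matrix.mat m m Y)\<^sup>T * T) $$ (i, b) * Matrix.mat n n Z $$ (b, j))"
      using ij by (intro index_mult_mat_sum) auto
    also have "\<dots> = (\<Sum>b<n. (\<Sum>a<m. Y (a, i) * T $$ (a, b)) * Z (b, j))"
      using ij T by (intro sum.cong refl, subst index_mult_mat_sum[of _ m m _ n]) auto
    also have "\<dots> = D (Y, Z) i j"
      unfolding D_def by (simp add: sum_distrib_right, rule sum.swap)
    finally show ?thesis .
  qed
  have off: "((Matrix.mat m m Y)\<^sup>T * T * Matrix.mat n n Z) $$ (i, j) = 0"
    if "i < m" "j < n" "i \<noteq> j" for i j
    using YTZ[OF that(1,2)] D0[OF that] by (simp only:)
  show ?thesis
    by (rule that[OF mat_carrier orthf_mat[OF Y] mat_carrier orthf_mat[OF Z] off])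
qed

section \<open>Rank\<close>

text \<open>Each column of \<open>A * B\<close> is \<open>A\<close> applied to a column of
  \<open>B\<close>, so the column span of the product lies in that of \<open>A\<close>.\<close>

lemma mat_rank_mult_le_left:
  assumes A: "A \<in> carrier_mat m k" and B: "B \<in> carrier_mat k n"
  shows "mat_rank (A * B) \<le> mat_rank A"
proof -
  interpret vec_space "TYPE(real)" m .
  have AB: "A * B \<in> carrier_mat m n" using A B by simp
  have "set (cols (A * B)) \<subseteq> span (set (cols A))"
  proof
    fix x assume "x \<in> set (cols (A * B))"
    then obtain j where j: "j < n" "x = col (A * B) j"
      using AB by (metis carrier_matD(2) cols_length cols_nth in_set_conv_nth)
    have "x = A *\<^sub>v col B j" using col_mult2[OF A B j(1)] j(2) by metis
    thus "x \<in> span (set (cols A))"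
      using col_space_eq[OF A] A B j(1) unfolding col_space_def by auto
  qed
  moreover have sA: "subspace class_ring (span (set (cols A))) V"
    using A span_is_subspace cols_dim by (metis carrier_matD(1))
  moreover have sAB: "subspace class_ring (span (set (cols (A * B)))) V"
    using AB span_is_subspace cols_dim by (metis carrier_matD(1))
  ultimately have "span (set (cols (A * B))) \<subseteq> span (set (cols A))"
    using span_is_subset by (simp add: subspace_def)
  hence "subspace class_ring (span (set (cols (A * B)))) (span_vs (set (cols A)))"
    using nested_subspaces[OF sA sAB] by simp
  hence "vectorspace.dim class_ring (span_vs (set (cols (A * B)))) \<le> vectorspace.dim class_ring (span_vs (set (cols A)))"
    using vectorspace.subspace_dim[OF subspace_is_vs[OF sA]] fin_dim_span_cols[OF A] fin_dim_span_cols[OF AB] by simp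
  thus ?thesis using A AB by (simp add: mat_rank_def rank_def)
qed

lemma mat_rank_mult_le:
  assumes A: "A \<in> carrier_mat m k" and B: "B \<in> carrier_mat k n"
  shows "mat_rank (A * B) \<le> k"
  using mat_rank_mult_le_left[OF A B] vec_space.rank_le_nc[OF A] A by (simp add: mat_rank_def)

lemma mat_rank_add_le:
  assumes "A \<in> carrier_mat m n" "B \<in> carrier_mat m n"
  shows "mat_rank (A + B) \<le> mat_rank A + mat_rank B"
  using vec_space.rank_subadditive[OF assms] assms by (simp add: mat_rank_def)

text \<open>\<open>B\<close> lists a maximal independent set of columns of \<open>A\<close>; by
  maximality they span all columns, and \<open>C\<close> records the coordinates.\<close>

lemma rank_factorization:
  assumes A: "A \<in> carrier_mat m n"
  obtains B C where "B \<in> carrier_mat m (mat_rank A)" "C \<in> carrier_mat (mat_rank A) n" "A = B * C"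
proof -
  interpret vec_space "TYPE(real)" m .
  have fin: "finite (set (cols A))" and sub: "set (cols A) \<subseteq> carrier_vec m"
    using A cols_dim[of A] by auto
  obtain S where S: "maximal S (\<lambda>T. T \<subseteq> set (cols A) \<and> lin_indpt T)"
    using maximal_exists_superset[OF fin, of "\<lambda>T. T \<subseteq> set (cols A) \<and> lin_indpt T" "{}"]
      finite_lin_indpt2 by (metis (no_types, lifting) empty_iff empty_subsetI finite.emptyI)
  have card: "rank A = card S" using rank_card_indpt[OF A S] .
  have Ssub: "S \<subseteq> set (cols A)" and Sli: "lin_indpt S" using S by (auto simp: maximal_def)
  have Sfin: "finite S" using Ssub fin finite_subset by blast
  obtain xs where xs: "set xs = S" "distinct xs" using finite_distinct_list[OF Sfin] by blast
  have len: "length xs = rank A" using xs card distinct_card by fastforce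
  have xsc: "set xs \<subseteq> carrier_vec m" using xs Ssub sub by auto
  define B where "B = mat_of_cols m xs"
  have B: "B \<in> carrier_mat m (rank A)" unfolding B_def len[symmetric] by simp
  have colsB: "cols B = xs" using xsc by (simp add: B_def)
  have "\<exists>v\<in>carrier_vec (rank A). col A j = B *\<^sub>v v" if "j < n" for j
  proof -
    have c: "col A j \<in> set (cols A)" using A that by (auto simp: cols_def)
    have "col A j \<in> span S"
    proof (rule ccontr)
      assume n: "col A j \<notin> span S"
      hence nS: "col A j \<notin> S" using span_mem Ssub sub by blast
      have "lin_indpt (insert (col A j) S)"
        using lin_dep_iff_in_span[of S "col A j"] Sli n nS c sub Ssub by auto
      hence "insert (col A j) S = S"
        using S c Ssub unfolding maximal_def by blast
      thus False using nS by blast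
    qed
    hence "col A j \<in> col_space B" by (simp add: col_space_def colsB xs)
    then obtain y where "y \<in> carrier_vec (rank A)" "B *\<^sub>v y = col A j"
      unfolding col_space_eq[OF B] using B by auto
    thus ?thesis by (intro bexI[of _ y]) auto
  qed
  hence "\<forall>j. \<exists>y. j < n \<longrightarrow> y \<in> carrier_vec (rank A) \<and> col A j = B *\<^sub>v y" by blast
  from choice[OF this] obtain v
    where v: "\<And>j. j < n \<Longrightarrow> v j \<in> carrier_vec (rank A) \<and> col A j = B *\<^sub>v v j" by blast
  define C where "C = mat_of_cols (rank A) (map v [0..<n])"
  have C: "C \<in> carrier_mat (rank A) n" unfolding C_def by (rule carrier_matI) auto
  have "col (B * C) j = col A j" if "j < n" for j
  proof -
    have "col C j = v j" using v that by (simp add: C_def)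
    thus ?thesis using v that by (simp add: col_mult2[OF B C])
  qed
  hence "A = B * C" using A B C by (intro mat_col_eqI) auto
  moreover have "mat_rank A = rank A" using A by (simp add: mat_rank_def)
  ultimately show ?thesis using that[of B C] B C by metis
qed

lemma rank_one: "mat_rank (1\<^sub>m k) = k"
  using vec_space.det_rank_iff[of "1\<^sub>m k :: real mat" k] by (simp add: mat_rank_def)

text \<open>The identity of size \<open>k\<close> then factors through the width of a rank
  factorization of \<open>X\<close>. This bounds a rank from below without exhibiting independent
  columns.\<close>

lemma mat_rank_ge:
  assumes X: "X \<in> carrier_mat m n" and P: "P \<in> carrier_mat k m" and Q: "Q \<in> carrier_mat n k"
    and PXQ: "P * X * Q = 1\<^sub>m k"
  shows "k \<le> mat_rank X"
proof -
  obtain B C where BC: "B \<in> carrier_mat m (mat_rank X)" "C \<in> carrier_mat (mat_rank X) n" "X = B * C"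
    using rank_factorization[OF X] .
  have PB: "P * B \<in> carrier_mat k (mat_rank X)" using P BC(1) by (rule mult_carrier_mat)
  have CQ: "C * Q \<in> carrier_mat (mat_rank X) k" using BC(2) Q by (rule mult_carrier_mat)
  have "1\<^sub>m k = P * (B * C) * Q" using PXQ BC(3) by simp
  also have "P * (B * C) = P * B * C" by (rule assoc_mult_mat[OF P BC(1,2), symmetric])
  also have "P * B * C * Q = (P * B) * (C * Q)" by (rule assoc_mult_mat[OF PB BC(2) Q])
  finally have "mat_rank (1\<^sub>m k) \<le> mat_rank X" using mat_rank_mult_le[OF PB CQ] by metis
  thus ?thesis by (simp add: rank_one)
qed

section \<open>Singular values and balanced factorizations\<close>

text \<open>
  Versions of the matrix laws with side conditions on the dimensions, which the simplifier
  can discharge without guessing the intermediate carrier.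
\<close>

lemma mult_assoc_dim:
  "dim_col A = dim_row B \<Longrightarrow> dim_col B = dim_row C \<Longrightarrow> (A * B) * C = A * (B * C)" for A :: "real mat"
  by (rule assoc_mult_mat[of _ "dim_row A" "dim_row B" _ "dim_row C" _ "dim_col C"]) auto

lemma transpose_mult_dim:
  "dim_col A = dim_row B \<Longrightarrow> (A * B)\<^sup>T = B\<^sup>T * A\<^sup>T" for A :: "real mat"
  by (rule transpose_mult[of _ "dim_row A" "dim_row B" _ "dim_col B"]) auto

lemma mult_add_dim:
  "dim_col A = dim_row B \<Longrightarrow> dim_row B = dim_row C \<Longrightarrow> dim_col B = dim_col C \<Longrightarrow> A * (B + C) = A * B + A * C"
  for A :: "real mat"
  by (rule mult_add_distrib_mat[of _ "dim_row A" "dim_row B" _ "dim_col B"]) auto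

lemma add_mult_dim:
  "dim_col A = dim_row C \<Longrightarrow> dim_row A = dim_row B \<Longrightarrow> dim_col A = dim_col B \<Longrightarrow> (A + B) * C = A * C + B * C"
  for A :: "real mat"
  by (rule add_mult_distrib_mat[of _ "dim_row A" "dim_col A" _ _ "dim_col C"]) auto

lemma mult_minus_dim:
  "dim_col A = dim_row B \<Longrightarrow> dim_row B = dim_row C \<Longrightarrow> dim_col B = dim_col C \<Longrightarrow> A * (B - C) = A * B - A * C"
  for A :: "real mat"
  by (rule mult_minus_distrib_mat[of _ "dim_row A" "dim_row B" _ "dim_col B"]) auto

lemma minus_mult_dim:
  "dim_col A = dim_row C \<Longrightarrow> dim_row A = dim_row B \<Longrightarrow> dim_col A = dim_col B \<Longrightarrow> (A - B) * C = A * C - B * C"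
  for A :: "real mat"
  by (rule minus_mult_distrib_mat[of _ "dim_row A" "dim_col A" _ _ "dim_col C"]) auto

text \<open>Once \<open>mult_assoc_dim\<close> has nested a product to the right, the two factors of
  an orthogonality relation no longer form a subterm when another factor follows; this form cancels
  them in place.\<close>

lemma mult_cancel_dim:
  "A * B = 1\<^sub>m n \<Longrightarrow> dim_col A = dim_row B \<Longrightarrow> dim_row C = n \<Longrightarrow> A * (B * C) = C" for A :: "real mat"
proof -
  assume a: "A * B = 1\<^sub>m n" "dim_col A = dim_row B" "dim_row C = n"
  have "dim_col B = n" using arg_cong[OF a(1), of dim_col] by simp
  hence "A * (B * C) = (A * B) * C" using a by (intro mult_assoc_dim[symmetric]) simp_all
  thus ?thesis using a(1) left_mult_one_mat'[OF a(3)] by metis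
qed

lemma frob_inner_add_right_dim:
  "dim_row B = dim_row A \<Longrightarrow> dim_col B = dim_col A \<Longrightarrow> dim_row C = dim_row A \<Longrightarrow> dim_col C = dim_col A \<Longrightarrow>
   frob_inner A (B + C) = frob_inner A B + frob_inner A C"
  by (rule frob_inner_add_right[of _ "dim_row A" "dim_col A"]) auto

lemma frob_inner_add_left_dim:
  "dim_row A = dim_row B \<Longrightarrow> dim_col A = dim_col B \<Longrightarrow> frob_inner (A + B) C = frob_inner A C + frob_inner B C"
  by (rule frob_inner_add_left[of _ "dim_row A" "dim_col A"]) auto

lemma frob_inner_minus_right_dim:
  "dim_row B = dim_row A \<Longrightarrow> dim_col B = dim_col A \<Longrightarrow> dim_row C = dim_row A \<Longrightarrow> dim_col C = dim_col A \<Longrightarrow>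
   frob_inner A (B - C) = frob_inner A B - frob_inner A C"
  by (rule frob_inner_minus_right[of _ "dim_row A" "dim_col A"]) auto

lemma frob_inner_minus_left_dim:
  "dim_row A = dim_row B \<Longrightarrow> dim_col A = dim_col B \<Longrightarrow> frob_inner (A - B) C = frob_inner A C - frob_inner B C"
  by (rule frob_inner_minus_left[of _ "dim_row A" "dim_col A"]) auto

lemmas mat_simps = mult_assoc_dim transpose_mult_dim mult_add_dim add_mult_dim mult_minus_dim minus_mult_dim
  frob_inner_add_right_dim frob_inner_add_left_dim frob_inner_minus_right_dim frob_inner_minus_left_dim

lemma frob_inner_eq_trace:
  assumes "A \<in> carrier_mat m n" "B \<in> carrier_mat m n"
  shows "frob_inner A B = (\<Sum>i<n. (A\<^sup>T * B) $$ (i, i))"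
proof -
  have "frob_inner A B = (\<Sum>j<n. \<Sum>i<m. A $$ (i, j) * B $$ (i, j))"
    unfolding frob_inner_carrier[OF assms(1)] by (rule sum.swap)
  also have "\<dots> = (\<Sum>i<n. (A\<^sup>T * B) $$ (i, i))"
    using assms by (intro sum.cong refl, subst index_mult_mat_sum[of _ n m _ n]) auto
  finally show ?thesis .
qed

section \<open>Singular values from a diagonalization of the Gram matrix\<close>

lemma transpose_left_inverse:
  fixes Q :: "real mat"
  assumes "Q \<in> carrier_mat n n" "Q\<^sup>T * Q = 1\<^sub>m n"
  shows "Q * Q\<^sup>T = 1\<^sub>m n"
  using mat_mult_left_right_inverse[of "Q\<^sup>T" n Q] assms by simp

text \<open>Similarity preserves the characteristic polynomial, and that of a diagonal matrix splits
  into linear factors, so its roots with multiplicity are the diagonal entries.\<close>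

lemma proots_char_poly_diagonalizable:
  fixes S :: "real mat"
  assumes S: "S \<in> carrier_mat n n" and Z: "Z \<in> carrier_mat n n" "Z\<^sup>T * Z = 1\<^sub>m n"
    and SZ: "S = Z * dmat n e * Z\<^sup>T"
  shows "proots (char_poly S) = image_mset e (mset_set {..<n})"
proof -
  have "similar_mat S (dmat n e)"
    using S Z transpose_left_inverse[OF Z] SZ by (intro similar_matI[of _ _ _ _ n]) auto
  hence "char_poly S = char_poly (dmat n e)" by (rule char_poly_similar)
  also have "\<dots> = (\<Prod>a\<leftarrow>diag_mat (dmat n e). [:- a, 1:])"
    by (rule char_poly_upper_triangular[OF dmat_carrier]) (auto simp: upper_triangular_def dmat_def)
  also have "diag_mat (dmat n e) = map e [0..<n]"
    by (auto simp: diag_mat_def dmat_def)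
  finally have eq: "char_poly S = (\<Prod>a\<leftarrow>map e [0..<n]. [:- a, 1:])" .
  have "proots (\<Prod>a\<leftarrow>xs. [:- a, 1:]) = mset xs" for xs :: "real list"
  proof (induction xs)
    case (Cons a xs)
    have "(\<Prod>a\<leftarrow>xs. [:- a, 1:]) \<noteq> (0 :: real poly)" by (auto simp: prod_list_zero_iff)
    thus ?case using Cons by (simp add: proots_mult del: mult_pCons_left)
  qed simp
  hence "proots (char_poly S) = mset (map e [0..<n])" by (simp only: eq)
  thus ?thesis by (simp add: lessThan_atLeast0 flip: mset_upt)
qed

text \<open>\<open>D\<close> need not be square, and its diagonal entries may have either sign. The
  Gram matrix has one eigenvalue per column of \<open>X\<close>, whence the value 0 in
  \<open>e\<close> for columns beyond the last row.\<close>

lemma singular_values_svd: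
  assumes X: "X \<in> carrier_mat m n" and Y: "Y \<in> carrier_mat m m" "Y\<^sup>T * Y = 1\<^sub>m m"
    and Z: "Z \<in> carrier_mat n n" "Z\<^sup>T * Z = 1\<^sub>m n"
    and D: "D = Y\<^sup>T * X * Z" and off: "\<And>i j. i < m \<Longrightarrow> j < n \<Longrightarrow> i \<noteq> j \<Longrightarrow> D $$ (i, j) = 0"
  defines "e \<equiv> (\<lambda>j. if j < m then (D $$ (j, j))\<^sup>2 else 0)"
  shows "X = Y * D * Z\<^sup>T"
    and "X\<^sup>T * X = Z * dmat n e * Z\<^sup>T"
    and "singular_values X = image_mset (\<lambda>j. sqrt (e j)) (mset_set {..<n})"
proof -
  note YY = transpose_left_inverse[OF Y] and ZZ = transpose_left_inverse[OF Z]
  have Dc: "D \<in> carrier_mat m n" unfolding D using X Y Z by simp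
  have dims: "dim_row X = m" "dim_col X = n" "dim_row Y = m" "dim_col Y = m" "dim_row Z = n" "dim_col Z = n"
    "dim_row D = m" "dim_col D = n" using X Y Z Dc by auto
  show 1: "X = Y * D * Z\<^sup>T"
    unfolding D using dims YY ZZ by (simp add: mat_simps mult_cancel_dim[OF YY])
  have DD: "D\<^sup>T * D = dmat n e"
  proof (rule eq_matI)
    fix i j assume ij: "i < dim_row (dmat n e)" "j < dim_col (dmat n e)"
    have "(D\<^sup>T * D) $$ (i, j) = (\<Sum>a<m. D $$ (a, i) * D $$ (a, j))"
      using Dc ij by (subst index_mult_mat_sum[of _ n m _ n]) auto
    also have "\<dots> = (\<Sum>a<m. if a = i then (if i = j then (D $$ (i, i))\<^sup>2 else 0) else 0)"
      using off ij by (intro sum.cong) (auto simp: power2_eq_square)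
    finally show "(D\<^sup>T * D) $$ (i, j) = dmat n e $$ (i, j)"
      using ij by (auto simp: e_def dmat_def)
  qed (use Dc in auto)
  have "X\<^sup>T * X = Z * (D\<^sup>T * D) * Z\<^sup>T"
    unfolding 1 using dims by (simp add: mat_simps mult_cancel_dim[OF Y(2)])
  thus 2: "X\<^sup>T * X = Z * dmat n e * Z\<^sup>T" unfolding DD .
  show "singular_values X = image_mset (\<lambda>j. sqrt (e j)) (mset_set {..<n})"
    unfolding singular_values_def using X Z
    by (subst proots_char_poly_diagonalizable[OF _ Z 2]) (auto simp: image_mset.compositionality comp_def)
qed

lemma singular_values_nonneg:
  assumes X: "X \<in> carrier_mat m n" and s: "s \<in># singular_values X"
  shows "s \<ge> 0"
proof -
  obtain Y Z where YZ: "Y \<in> carrier_mat m m" "Y\<^sup>T * Y = 1\<^sub>m m"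
    "Z \<in> carrier_mat n n" "Z\<^sup>T * Z = 1\<^sub>m n"
    "\<And>i j. i < m \<Longrightarrow> j < n \<Longrightarrow> i \<noteq> j \<Longrightarrow> (Y\<^sup>T * X * Z) $$ (i, j) = 0"
    by (fact svd_obtain[OF X])
  have "singular_values X = image_mset (\<lambda>j. sqrt (if j < m then ((Y\<^sup>T * X * Z) $$ (j, j))\<^sup>2 else 0)) (mset_set {..<n})"
    by (rule singular_values_svd(3)[OF X YZ(1-4) refl YZ(5)])
  thus ?thesis using s by auto
qed

text \<open>The thin decomposition with \<open>Q\<close> shows only the nonzero eigenvalues and is
  compared with a full one. An entry of \<open>t = Z\<^sup>T * Q\<close> can be nonzero only where
  \<open>e j = w i\<close>; its squares sum to 1 down every column, and along every row with
  \<open>e j \<noteq> 0\<close>. These squares carry the values of \<open>f\<close> from one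
  spectrum to the other without matching multiplicities, and \<open>f 0 = 0\<close> settles the
  remaining rows.\<close>

lemma sum_singular_values:
  assumes X: "X \<in> carrier_mat m n" and Q: "Q \<in> carrier_mat n d" "Q\<^sup>T * Q = 1\<^sub>m d"
    and XQ: "X\<^sup>T * X = Q * dmat d w * Q\<^sup>T" and w: "\<And>i. i < d \<Longrightarrow> w i > 0"
    and f0: "f 0 = (0 :: real)"
  shows "(\<Sum>s\<in>#singular_values X. f s) = (\<Sum>i<d. f (sqrt (w i)))"
proof -
  obtain Y Z where YZ: "Y \<in> carrier_mat m m" "Y\<^sup>T * Y = 1\<^sub>m m"
    "Z \<in> carrier_mat n n" "Z\<^sup>T * Z = 1\<^sub>m n"
    "\<And>i j. i < m \<Longrightarrow> j < n \<Longrightarrow> i \<noteq> j \<Longrightarrow> (Y\<^sup>T * X * Z) $$ (i, j) = 0"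
    by (fact svd_obtain[OF X])
  define e where "e = (\<lambda>j. if j < m then ((Y\<^sup>T * X * Z) $$ (j, j))\<^sup>2 else 0)"
  have e: "X\<^sup>T * X = Z * dmat n e * Z\<^sup>T"
     "singular_values X = image_mset (\<lambda>j. sqrt (e j)) (mset_set {..<n})"
    unfolding e_def by (rule singular_values_svd(2,3)[OF X YZ(1-4) refl YZ(5)]; assumption)+
  note ZZ = transpose_left_inverse[OF YZ(3,4)]
  define t where "t = Z\<^sup>T * Q"
  have tc: "t \<in> carrier_mat n d" using YZ(3) Q(1) by (simp add: t_def)
  have S: "X\<^sup>T * X \<in> carrier_mat n n" using X by simp
  have dims: "dim_row X = m" "dim_col X = n" "dim_row Z = n" "dim_col Z = n" "dim_row Q = n" "dim_col Q = d"
    using X YZ Q by auto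
  have "dmat n e * t = Z\<^sup>T * (Z * dmat n e * Z\<^sup>T) * Q"
    using dims by (simp add: t_def mat_simps mult_cancel_dim[OF YZ(4)])
  also have "\<dots> = Z\<^sup>T * (Q * dmat d w * Q\<^sup>T) * Q"
    using e(1) XQ by simp
  also have "\<dots> = t * dmat d w"
    using dims Q(2) by (simp add: t_def mat_simps)
  finally have eq: "dmat n e * t = t * dmat d w" .
  have et: "e j * t $$ (j, i) = w i * t $$ (j, i)" if "j < n" "i < d" for i j
    using arg_cong[OF eq, of "\<lambda>M. M $$ (j, i)"] index_mult_dmat_left[OF tc that, of e]
      index_mult_dmat_right[OF tc that, of w] by (simp del: index_mult_mat(1))
  have "t\<^sup>T * t = 1\<^sub>m d"
    using dims Q(2) by (simp add: t_def mat_simps mult_cancel_dim[OF ZZ])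
  hence tt: "(\<Sum>j<n. (t $$ (j, i))\<^sup>2) = 1" if "i < d" for i
    using that index_mult_mat_sum[of "t\<^sup>T" d n t d i i] tc by (simp add: power2_eq_square)
  have "dmat n e = Z\<^sup>T * (Z * dmat n e * Z\<^sup>T) * Z"
    using dims YZ(4) by (simp add: mat_simps mult_cancel_dim[OF YZ(4)])
  also have "\<dots> = Z\<^sup>T * (Q * dmat d w * Q\<^sup>T) * Z"
    using e(1) XQ by simp
  also have "\<dots> = t * dmat d w * t\<^sup>T"
    using dims by (simp add: t_def mat_simps)
  finally have ew: "dmat n e = t * dmat d w * t\<^sup>T" .
  have ejj: "e j = (\<Sum>i<d. w i * (t $$ (j, i))\<^sup>2)" if "j < n" for j
  proof -
    have "e j = dmat n e $$ (j, j)" using that by (simp add: dmat_def)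
    also have "\<dots> = (\<Sum>i<d. (t * dmat d w) $$ (j, i) * t\<^sup>T $$ (i, j))"
      unfolding ew using tc that by (intro index_mult_mat_sum) auto
    also have "\<dots> = (\<Sum>i<d. w i * (t $$ (j, i))\<^sup>2)"
      using tc that by (intro sum.cong refl, subst index_mult_dmat_right[OF tc]) (auto simp: power2_eq_square)
    finally show ?thesis .
  qed
  have row: "f (sqrt (e j)) = (\<Sum>i<d. f (sqrt (w i)) * (t $$ (j, i))\<^sup>2)" if j: "j < n" for j
  proof (cases "e j = 0")
    case True
    have "t $$ (j, i) = 0" if "i < d" for i using et[OF j that] True w[OF that] by simp
    thus ?thesis using True f0 by simp
  next
    case False
    have wt: "w i * (t $$ (j, i))\<^sup>2 = e j * (t $$ (j, i))\<^sup>2" if "i < d" for i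
      using et[OF j that] by (auto simp: power2_eq_square)
    \<comment> \<open>Each \<open>w i\<close> in the expansion \<open>ejj\<close> may be replaced by
      \<open>e j\<close>, because \<open>t\<close> vanishes where they differ; cancelling
      \<open>e j\<close> then gives a unit row.\<close>
    have "e j = e j * (\<Sum>i<d. (t $$ (j, i))\<^sup>2)"
      using ejj[OF j] wt by (simp add: sum_distrib_left)
    hence 1: "(\<Sum>i<d. (t $$ (j, i))\<^sup>2) = 1" using False by simp
    have "(\<Sum>i<d. f (sqrt (w i)) * (t $$ (j, i))\<^sup>2) = (\<Sum>i<d. f (sqrt (e j)) * (t $$ (j, i))\<^sup>2)"
    proof (rule sum.cong[OF refl])
      fix i assume "i \<in> {..<d}"
      thus "f (sqrt (w i)) * (t $$ (j, i))\<^sup>2 = f (sqrt (e j)) * (t $$ (j, i))\<^sup>2"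
        using et[OF j, of i] by (cases "t $$ (j, i) = 0") auto
    qed
    thus ?thesis using 1 by (simp flip: sum_distrib_left)
  qed
  have "(\<Sum>s\<in>#singular_values X. f s) = (\<Sum>j<n. f (sqrt (e j)))"
    by (simp add: e(2) image_mset.compositionality comp_def sum_unfold_sum_mset)
  also have "\<dots> = (\<Sum>j<n. \<Sum>i<d. f (sqrt (w i)) * (t $$ (j, i))\<^sup>2)"
    using row by simp
  also have "\<dots> = (\<Sum>i<d. \<Sum>j<n. f (sqrt (w i)) * (t $$ (j, i))\<^sup>2)" by (rule sum.swap)
  also have "\<dots> = (\<Sum>i<d. f (sqrt (w i)))" using tt by (simp flip: sum_distrib_left)
  finally show ?thesis .
qed

text \<open>Apply \<open>sum_singular_values\<close> to the indicator of \<open>sqrt (w i)\<close>: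
  the sum is then at least 1, so this value occurs among the singular values.\<close>

lemma sigma_min_le:
  assumes X: "X \<in> carrier_mat m n" and Q: "Q \<in> carrier_mat n d" "Q\<^sup>T * Q = 1\<^sub>m d"
    and XQ: "X\<^sup>T * X = Q * dmat d w * Q\<^sup>T" and w: "\<And>i. i < d \<Longrightarrow> w i > 0"
    and i: "i < d"
  shows "sigma_min X \<le> sqrt (w i)"
proof -
  define f where "f s = (if s = sqrt (w i) then 1 else 0 :: real)" for s
  have "(\<Sum>s\<in>#singular_values X. f s) = (\<Sum>k<d. f (sqrt (w k)))"
    using w[OF i] by (intro sum_singular_values[OF assms(1-5)]) (auto simp: f_def)
  also have "\<dots> \<ge> f (sqrt (w i))"
    using i by (intro member_le_sum) (auto simp: f_def)
  finally have pos: "(\<Sum>s\<in>#singular_values X. f s) \<noteq> 0" by (auto simp: f_def)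
  have "sqrt (w i) \<in># singular_values X"
  proof (rule ccontr)
    assume "sqrt (w i) \<notin># singular_values X"
    hence "image_mset f (singular_values X) = image_mset (\<lambda>_. 0) (singular_values X)"
      by (intro image_mset_cong) (auto simp: f_def)
    thus False using pos by simp
  qed
  hence "sqrt (w i) \<in> {s \<in> set_mset (singular_values X). s \<noteq> 0}" using w[OF i] by auto
  thus ?thesis unfolding sigma_min_def Let_def by (auto intro!: Min_le)
qed

text \<open>Serves both factors of a balanced factorization: their coefficients \<open>g\<close>
  differ only in sign, so both Gram matrices are the same diagonal matrix.\<close>

lemma gram_scaled_columns:
  fixes Y :: "real mat"
  assumes Y: "\<And>i j. i < m \<Longrightarrow> j < m \<Longrightarrow> (\<Sum>a<m. Y $$ (a, i) * Y $$ (a, j)) = (if i = j then 1 else 0)"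
    and h: "\<And>i. i < k \<Longrightarrow> h i < m" "\<And>i j. i < k \<Longrightarrow> j < k \<Longrightarrow> h i = h j \<longleftrightarrow> i = j"
    and W: "W = Matrix.mat m d (\<lambda>(a, i). if i < k then g i * Y $$ (a, h i) else 0)"
    and gc: "\<And>i. i < k \<Longrightarrow> g i * g i = c i"
  shows "W\<^sup>T * W = dmat d (\<lambda>i. if i < k then c i else 0)"
proof (rule eq_matI)
  fix i j assume "i < dim_row (dmat d (\<lambda>i. if i < k then c i else 0))"
    "j < dim_col (dmat d (\<lambda>i. if i < k then c i else 0))"
  hence ij: "i < d" "j < d" by auto
  have "(W\<^sup>T * W) $$ (i, j) = (\<Sum>a<m. W $$ (a, i) * W $$ (a, j))"
    using index_mult_mat_sum[of "W\<^sup>T" d m W d i j] ij by (simp add: W)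
  also have "\<dots> = (\<Sum>a<m. (if i < k \<and> j < k then g i * g j else 0) * (Y $$ (a, h i) * Y $$ (a, h j)))"
    using ij by (intro sum.cong) (auto simp: W)
  also have "\<dots> = (if i < k \<and> j < k then g i * g j else 0) * (\<Sum>a<m. Y $$ (a, h i) * Y $$ (a, h j))"
    by (simp add: sum_distrib_left)
  also have "\<dots> = dmat d (\<lambda>i. if i < k then c i else 0) $$ (i, j)"
    using ij Y h gc by (auto simp: dmat_def)
  finally show "(W\<^sup>T * W) $$ (i, j) = dmat d (\<lambda>i. if i < k then c i else 0) $$ (i, j)" .
qed (auto simp: W)

text \<open>For \<open>X = \<Sum> s\<^sub>i p\<^sub>i q\<^sub>i\<^sup>T\<close> the factors have the columns \<open>sqrt s\<^sub>i p\<^sub>i\<close> and \<open>sqrt s\<^sub>i q\<^sub>i\<close>, padded by zero columns.\<close>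

lemma balanced_factorization:
  assumes X: "X \<in> carrier_mat m n" and r: "mat_rank X \<le> d" and nz: "mat_rank X \<noteq> 0"
  shows "\<exists>U \<in> carrier_mat m d. \<exists>V \<in> carrier_mat n d. X = U * V\<^sup>T \<and>
     U\<^sup>T * U = V\<^sup>T * V \<and>
     frob_inner U U = nuclear_norm X \<and> frob_inner V V = nuclear_norm X"
    and "sigma_min X > 0"
proof -
  obtain Y Z where YZ: "Y \<in> carrier_mat m m" "Y\<^sup>T * Y = 1\<^sub>m m"
    "Z \<in> carrier_mat n n" "Z\<^sup>T * Z = 1\<^sub>m n"
    "\<And>i j. i < m \<Longrightarrow> j < n \<Longrightarrow> i \<noteq> j \<Longrightarrow> (Y\<^sup>T * X * Z) $$ (i, j) = 0"
    by (fact svd_obtain[OF X])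
  define D where "D = Y\<^sup>T * X * Z"
  have Dc: "D \<in> carrier_mat m n" unfolding D_def using X YZ by simp
  have off: "D $$ (i, j) = 0" if "i < m" "j < n" "i \<noteq> j" for i j using YZ(5) that by (simp add: D_def)
  have svd: "X = Y * D * Z\<^sup>T"
    "singular_values X = image_mset (\<lambda>j. sqrt (if j < m then (D $$ (j, j))\<^sup>2 else 0)) (mset_set {..<n})"
    by (rule singular_values_svd(1,3)[OF X YZ(1-4) D_def]; rule off; assumption)+
  define s where "s j = D $$ (j, j)" for j
  define J where "J = {j. j < min m n \<and> s j \<noteq> 0}"
  have finJ: "finite J" by (simp add: J_def)
  define k where "k = card J"
  obtain h where h: "bij_betw h {..<k} J"
    using ex_bij_betw_nat_finite[OF finJ] by (auto simp: k_def lessThan_atLeast0)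
  have hJ: "h i < m" "h i < n" "s (h i) \<noteq> 0" if "i < k" for i
    using bij_betwE[OF h] that by (auto simp: J_def)
  have hinj: "h i = h j \<longleftrightarrow> i = j" if "i < k" "j < k" for i j
    using bij_betw_imp_inj_on[OF h] that by (auto simp: inj_on_def)
  have Yo: "(\<Sum>a<m. Y $$ (a, i) * Y $$ (a, j)) = (if i = j then 1 else 0)" if "i < m" "j < m" for i j
    using index_mult_mat_sum[of "Y\<^sup>T" m m Y m i j] YZ(1,2) that by simp
  have Zo: "(\<Sum>a<n. Z $$ (a, i) * Z $$ (a, j)) = (if i = j then 1 else 0)" if "i < n" "j < n" for i j
    using index_mult_mat_sum[of "Z\<^sup>T" n n Z n i j] YZ(3,4) that by simp
  have Xe: "X $$ (a, b) = (\<Sum>j\<in>J. Y $$ (a, j) * s j * Z $$ (b, j))" if ab: "a < m" "b < n" for a b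
  proof -
    have "X $$ (a, b) = (\<Sum>j<n. (Y * D) $$ (a, j) * Z $$ (b, j))"
      using index_mult_mat_sum[of "Y * D" m n "Z\<^sup>T" n a b] svd(1) ab YZ(1,3) Dc by simp
    also have "\<dots> = (\<Sum>j<n. (if j < m then Y $$ (a, j) * s j else 0) * Z $$ (b, j))"
    proof (rule sum.cong[OF refl])
      fix j assume j: "j \<in> {..<n}"
      have "(Y * D) $$ (a, j) = (\<Sum>i<m. Y $$ (a, i) * D $$ (i, j))"
        using index_mult_mat_sum[OF YZ(1) Dc ab(1)] j by simp
      also have "\<dots> = (\<Sum>i<m. if i = j then Y $$ (a, j) * s j else 0)"
        using off j by (intro sum.cong) (auto simp: s_def)
      finally show "(Y * D) $$ (a, j) * Z $$ (b, j) = (if j < m then Y $$ (a, j) * s j else 0) * Z $$ (b, j)"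
        by simp
    qed
    also have "\<dots> = (\<Sum>j\<in>J. Y $$ (a, j) * s j * Z $$ (b, j))"
      by (rule sum.mono_neutral_cong_right) (auto simp: J_def)
    finally show ?thesis .
  qed
  \<comment> \<open>The nonzero diagonal entries make an identity of size \<open>k\<close> factor
    through \<open>X\<close>; hence the \<open>k\<close> columns fit into the \<open>d\<close>
    available ones.\<close>
  have "k \<le> mat_rank X"
  proof (rule mat_rank_ge[OF X])
    define P where "P = Matrix.mat k m (\<lambda>(i, a). Y $$ (a, h i) / s (h i))"
    define Q where "Q = Matrix.mat n k (\<lambda>(b, i). Z $$ (b, h i))"
    show P: "P \<in> carrier_mat k m" and Q: "Q \<in> carrier_mat n k" by (auto simp: P_def Q_def)
    show "P * X * Q = 1\<^sub>m k"
    proof (rule eq_matI)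
      fix i j assume ij: "i < dim_row (1\<^sub>m k :: real mat)" "j < dim_col (1\<^sub>m k :: real mat)"
      have YX: "Y\<^sup>T * X \<in> carrier_mat m n" using YZ(1) X by simp
      have PX: "P * X \<in> carrier_mat k n" using P X by simp
      have "(P * X * Q) $$ (i, j) = (\<Sum>b<n. (P * X) $$ (i, b) * Q $$ (b, j))"
        using ij by (intro index_mult_mat_sum[OF PX Q]) auto
      also have "\<dots> = (\<Sum>b<n. (Y\<^sup>T * X) $$ (h i, b) * Z $$ (b, h j) / s (h i))"
      proof (rule sum.cong[OF refl])
        fix b assume b: "b \<in> {..<n}"
        have "(P * X) $$ (i, b) = (Y\<^sup>T * X) $$ (h i, b) / s (h i)"
          using ij b hJ[of i] YZ(1) index_mult_mat_sum[OF P X, of i b] index_mult_mat_sum[of "Y\<^sup>T" m m X n "h i" b] X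
          by (simp add: P_def sum_divide_distrib)
        thus "(P * X) $$ (i, b) * Q $$ (b, j) = (Y\<^sup>T * X) $$ (h i, b) * Z $$ (b, h j) / s (h i)"
          using ij b by (simp add: Q_def)
      qed
      also have "\<dots> = D $$ (h i, h j) / s (h i)"
        using index_mult_mat_sum[OF YX YZ(3), of "h i" "h j"] ij hJ by (simp add: D_def sum_divide_distrib)
      also have "\<dots> = 1\<^sub>m k $$ (i, j)"
        using ij hJ off hinj by (auto simp: s_def)
      finally show "(P * X * Q) $$ (i, j) = 1\<^sub>m k $$ (i, j)" .
    qed (auto simp: P_def Q_def)
  qed
  hence kd: "k \<le> d" using r by simp
  have nuc: "nuclear_norm X = (\<Sum>i<k. \<bar>s (h i)\<bar>)"
  proof -
    have "nuclear_norm X = (\<Sum>j<n. sqrt (if j < m then (D $$ (j, j))\<^sup>2 else 0))"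
      by (simp add: nuclear_norm_def svd(2) sum_unfold_sum_mset)
    also have "\<dots> = (\<Sum>j\<in>J. \<bar>s j\<bar>)"
      by (rule sum.mono_neutral_cong_right) (auto simp: J_def s_def)
    also have "\<dots> = (\<Sum>i<k. \<bar>s (h i)\<bar>)"
      by (rule sum.reindex_bij_betw[OF h, symmetric])
    finally show ?thesis .
  qed
  have Jne: "J \<noteq> {}"
  proof
    assume "J = {}"
    hence "X = 0\<^sub>m m n" using Xe X by (intro eq_matI) auto
    thus False using nz vec_space.rank_0I[where n = m and nc = n and 'a = real] by (auto simp: mat_rank_def)
  qed
  show "sigma_min X > 0"
  proof -
    obtain j where j: "j \<in> J" using Jne by blast
    define S where "S = {s \<in> set_mset (singular_values X). s \<noteq> 0}"
    have "\<bar>s j\<bar> \<in> S"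
      using j unfolding S_def svd(2) by (auto simp: J_def s_def intro!: image_eqI[of _ _ j])
    hence ne: "S \<noteq> {}" by blast
    have "finite S" by (simp add: S_def)
    hence "Min S \<in> S" using ne by (rule Min_in)
    hence "Min S > 0" using singular_values_nonneg[OF X] by (fastforce simp: S_def)
    thus ?thesis using ne by (simp add: sigma_min_def S_def)
  qed
  define U where "U = Matrix.mat m d (\<lambda>(a, i). if i < k then sqrt \<bar>s (h i)\<bar> * Y $$ (a, h i) else 0)"
  \<comment> \<open>The diagonal entries \<open>s\<close> may be negative, so their signs are moved
    into the second factor.\<close>
  define V where "V = Matrix.mat n d (\<lambda>(a, i). if i < k then sgn (s (h i)) * sqrt \<bar>s (h i)\<bar> * Z $$ (a, h i) else 0)"
  have U: "U \<in> carrier_mat m d" and V: "V \<in> carrier_mat n d" by (auto simp: U_def V_def)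
  have sgn: "sgn x * (sqrt \<bar>x\<bar> * sqrt \<bar>x\<bar>) = x" for x :: real
    by (simp add: sgn_real_def abs_if)
  have "X = U * V\<^sup>T"
  proof (rule eq_matI)
    fix a b assume "a < dim_row (U * V\<^sup>T)" "b < dim_col (U * V\<^sup>T)"
    hence ab: "a < m" "b < n" using U V by auto
    have "(U * V\<^sup>T) $$ (a, b) = (\<Sum>i<d. U $$ (a, i) * V $$ (b, i))"
      using index_mult_mat_sum[of U m d "V\<^sup>T" n a b] U V ab by simp
    also have "\<dots> = (\<Sum>i<k. Y $$ (a, h i) * s (h i) * Z $$ (b, h i))"
    proof (rule sum.mono_neutral_cong_right)
      fix i assume i: "i \<in> {..<k}"
      have "U $$ (a, i) * V $$ (b, i) = Y $$ (a, h i) * (sgn (s (h i)) * (sqrt \<bar>s (h i)\<bar> * sqrt \<bar>s (h i)\<bar>)) * Z $$ (b, h i)"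
        using i ab kd by (simp add: U_def V_def mult_ac)
      thus "U $$ (a, i) * V $$ (b, i) = Y $$ (a, h i) * s (h i) * Z $$ (b, h i)" unfolding sgn .
    qed (use ab kd in \<open>auto simp: U_def\<close>)
    also have "\<dots> = X $$ (a, b)"
      unfolding Xe[OF ab] by (rule sum.reindex_bij_betw[OF h])
    finally show "X $$ (a, b) = (U * V\<^sup>T) $$ (a, b)" by simp
  qed (use X U V in auto)
  moreover define c where "c i = (if i < k then \<bar>s (h i)\<bar> else 0)" for i
  have "U\<^sup>T * U = dmat d c"
    unfolding c_def by (rule gram_scaled_columns[OF Yo hJ(1) hinj U_def]) auto
  moreover have "V\<^sup>T * V = dmat d c"
    unfolding c_def by (rule gram_scaled_columns[OF Zo hJ(2) hinj V_def]) (auto simp: sgn_real_def)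
  moreover have "(\<Sum>i<d. dmat d c $$ (i, i)) = nuclear_norm X"
  proof -
    have "(\<Sum>i<d. dmat d c $$ (i, i)) = (\<Sum>i<d. c i)" by (simp add: dmat_def)
    also have "\<dots> = (\<Sum>i<k. \<bar>s (h i)\<bar>)"
      using kd by (intro sum.mono_neutral_cong_right) (auto simp: c_def)
    finally show ?thesis using nuc by simp
  qed
  ultimately show "\<exists>U \<in> carrier_mat m d. \<exists>V \<in> carrier_mat n d. X = U * V\<^sup>T \<and>
     U\<^sup>T * U = V\<^sup>T * V \<and>
     frob_inner U U = nuclear_norm X \<and> frob_inner V V = nuclear_norm X"
    using U V frob_inner_eq_trace[OF U U] frob_inner_eq_trace[OF V V] by metis
qed

section \<open>Geometry of aligned factors\<close>

lemma frob_inner_minus_square: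
  assumes "A \<in> carrier_mat m n" "B \<in> carrier_mat m n"
  shows "frob_inner (A - B) (A - B) = frob_inner A A - 2 * frob_inner A B + frob_inner B B"
  using frob_inner_minus_left[OF assms, of "A - B"] frob_inner_minus_right[OF assms(1) assms]
    frob_inner_minus_right[OF assms(2) assms] frob_inner_commute[OF assms] by linarith

lemma frob_inner_add_square:
  assumes "A \<in> carrier_mat m n" "B \<in> carrier_mat m n"
  shows "frob_inner (A + B) (A + B) = frob_inner A A + 2 * frob_inner A B + frob_inner B B"
  using frob_inner_add_left[OF assms, of "A + B"] frob_inner_add_right[OF assms(1) assms]
    frob_inner_add_right[OF assms(2) assms] frob_inner_commute[OF assms] by linarith

lemma transpose_add_dim:
  "dim_row A = dim_row B \<Longrightarrow> dim_col A = dim_col B \<Longrightarrow> (A + B)\<^sup>T = A\<^sup>T + B\<^sup>T"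
  by (rule transpose_add[of _ "dim_row A" "dim_col A"]) auto

text \<open>A common orthogonal factor on the right of both \<open>U\<close> and \<open>V\<close>
  preserves the product, the balance and both norms. That freedom is spent on the symmetry
  condition.\<close>

lemma ex_aligned_factorization:
  assumes X: "X \<in> carrier_mat m n" and r: "mat_rank X \<le> d" and nz: "mat_rank X \<noteq> 0"
    and P: "P \<in> carrier_mat m d" and Q: "Q \<in> carrier_mat n d"
  obtains U V where "U \<in> carrier_mat m d" "V \<in> carrier_mat n d" "X = U * V\<^sup>T"
    "U\<^sup>T * U = V\<^sup>T * V"
    "frob_inner U U = nuclear_norm X" "frob_inner V V = nuclear_norm X"
    "\<And>i j. i < d \<Longrightarrow> j < d \<Longrightarrow> (P\<^sup>T * U) $$ (i, j) + (Q\<^sup>T * V) $$ (i, j)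
       = (P\<^sup>T * U) $$ (j, i) + (Q\<^sup>T * V) $$ (j, i)"
proof -
  obtain U V where U: "U \<in> carrier_mat m d" and V: "V \<in> carrier_mat n d" and UV: "X = U * V\<^sup>T"
    "U\<^sup>T * U = V\<^sup>T * V"
    "frob_inner U U = nuclear_norm X" "frob_inner V V = nuclear_norm X"
    using balanced_factorization(1)[OF X r nz] by metis
  define T where "T = P\<^sup>T * U + Q\<^sup>T * V"
  have T: "T \<in> carrier_mat d d" using P Q U V by (simp add: T_def)
  obtain W where W: "W \<in> carrier_mat d d" "W\<^sup>T * W = 1\<^sub>m d"
    and sym: "\<forall>i<d. \<forall>j<d. (T * W) $$ (i, j) = (T * W) $$ (j, i)"
    using ex_orthogonal_symmetric[OF T] by metis
  note WW = transpose_left_inverse[OF W]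
  have dims: "dim_row P = m" "dim_col P = d" "dim_row Q = n" "dim_col Q = d" "dim_row U = m" "dim_col U = d"
    "dim_row V = n" "dim_col V = d" "dim_row W = d" "dim_col W = d" using P Q U V W by auto
  have UW: "U * W \<in> carrier_mat m d" and VW: "V * W \<in> carrier_mat n d"
    using U V W by (auto intro: mult_carrier_mat)
  show ?thesis
  proof (rule that[OF UW VW])
    show "X = U * W * (V * W)\<^sup>T"
      unfolding UV(1) using dims by (simp add: mat_simps mult_cancel_dim[OF WW])
    have "(U * W)\<^sup>T * (U * W) = W\<^sup>T * (U\<^sup>T * U) * W"
      using dims by (simp add: mat_simps)
    also have "\<dots> = (V * W)\<^sup>T * (V * W)"
      unfolding UV(2) using dims by (simp add: mat_simps)
    finally show "(U * W)\<^sup>T * (U * W) = (V * W)\<^sup>T * (V * W)" .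
    show "frob_inner (U * W) (U * W) = nuclear_norm X"
      using frob_inner_mult_left'[OF U W(1) UW] U W UV(3) dims
      by (simp add: mult_assoc_dim WW)
    show "frob_inner (V * W) (V * W) = nuclear_norm X"
      using frob_inner_mult_left'[OF V W(1) VW] V W UV(4) dims
      by (simp add: mult_assoc_dim WW)
    fix i j assume ij: "i < d" "j < d"
    have TW: "T * W = P\<^sup>T * (U * W) + Q\<^sup>T * (V * W)"
      unfolding T_def using dims by (simp add: mat_simps)
    show "(P\<^sup>T * (U * W)) $$ (i, j) + (Q\<^sup>T * (V * W)) $$ (i, j)
       = (P\<^sup>T * (U * W)) $$ (j, i) + (Q\<^sup>T * (V * W)) $$ (j, i)"
      using sym ij unfolding TW using dims by (simp del: index_mult_mat(1))
  qed
qed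

text \<open>Pythagoras for the projection onto the range of \<open>P\<close>, kept at the level of
  Gram matrices because later sums weight their diagonal entries individually.\<close>

lemma gram_split:
  fixes P W :: "real mat"
  assumes P: "P \<in> carrier_mat m d" "P\<^sup>T * P = 1\<^sub>m d" and W: "W \<in> carrier_mat m d"
    and A: "A = P\<^sup>T * W" and L: "L = W - P * A"
  shows "P\<^sup>T * L = 0\<^sub>m d d" "L\<^sup>T * P = 0\<^sub>m d d" "W = P * A + L"
    "W\<^sup>T * W = A\<^sup>T * A + L\<^sup>T * L"
proof -
  have dims: "dim_row P = m" "dim_col P = d" "dim_row W = m" "dim_col W = d" "dim_row A = d" "dim_col A = d"
    "dim_row L = m" "dim_col L = d"
    using P W by (auto simp: A L)
  have c: "A \<in> carrier_mat d d" "A\<^sup>T * A \<in> carrier_mat d d" "L\<^sup>T * L \<in> carrier_mat d d"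
    using dims by (auto intro!: carrier_matI)
  have "P\<^sup>T * L = A - A"
    unfolding L using dims by (simp add: mat_simps mult_cancel_dim[OF P(2)]) (simp add: A)
  thus PL: "P\<^sup>T * L = 0\<^sub>m d d" using minus_r_inv_mat[OF c(1)] by simp
  have "L\<^sup>T * P = (P\<^sup>T * L)\<^sup>T" using dims by (simp add: mat_simps)
  thus LP: "L\<^sup>T * P = 0\<^sub>m d d" unfolding PL by simp
  show split: "W = P * A + L"
    unfolding L using dims by (intro eq_matI) auto
  have LPA: "L\<^sup>T * (P * A) = 0\<^sub>m d d"
    using dims by (simp add: LP flip: mult_assoc_dim)
  have "W\<^sup>T * W = (P * A + L)\<^sup>T * (P * A + L)" by (simp only: split[symmetric])
  also have "\<dots> = A\<^sup>T * A + L\<^sup>T * (P * A)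
      + (A\<^sup>T * (P\<^sup>T * L) + L\<^sup>T * L)"
    using dims by (simp add: mat_simps transpose_add_dim mult_cancel_dim[OF P(2)])
  also have "\<dots> = A\<^sup>T * A + L\<^sup>T * L"
    using c dims by (simp add: PL LPA)
  finally show "W\<^sup>T * W = A\<^sup>T * A + L\<^sup>T * L" .
qed

text \<open>In the application \<open>P\<close> and \<open>Q\<close> hold the singular vectors of
  \<open>U * V\<^sup>T\<close> and \<open>s\<close> the square roots of its singular values, while
  \<open>Us\<close> and \<open>Vs\<close> are aligned factors of the target. \<open>A\<close> and
  \<open>B\<close> are the coordinates of these factors inside the ranges of \<open>P\<close> and
  \<open>Q\<close>, and \<open>L\<close> and \<open>R\<close> are the parts outside.\<close>

locale factor_frame =
  fixes m n d :: nat and P Q U V Us Vs :: "real mat" and s :: "nat \<Rightarrow> real"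
  assumes P: "P \<in> carrier_mat m d" "P\<^sup>T * P = 1\<^sub>m d"
    and Q: "Q \<in> carrier_mat n d" "Q\<^sup>T * Q = 1\<^sub>m d"
    and U: "U = P * dmat d s" and V: "V = Q * dmat d s"
    and Us: "Us \<in> carrier_mat m d" and Vs: "Vs \<in> carrier_mat n d"
    and balanced: "Us\<^sup>T * Us = Vs\<^sup>T * Vs"
    and sym: "\<And>i j. i < d \<Longrightarrow> j < d \<Longrightarrow> (P\<^sup>T * Us) $$ (i, j) + (Q\<^sup>T * Vs) $$ (i, j)
       = (P\<^sup>T * Us) $$ (j, i) + (Q\<^sup>T * Vs) $$ (j, i)"
begin

definition A :: "real mat" where "A = P\<^sup>T * Us"
definition B :: "real mat" where "B = Q\<^sup>T * Vs"
definition L :: "real mat" where "L = Us - P * A"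
definition R :: "real mat" where "R = Vs - Q * B"

lemma dims:
  "dim_row P = m" "dim_col P = d" "dim_row Q = n" "dim_col Q = d" "dim_row Us = m" "dim_col Us = d"
  "dim_row Vs = n" "dim_col Vs = d" "dim_row A = d" "dim_col A = d" "dim_row B = d" "dim_col B = d"
  "dim_row L = m" "dim_col L = d" "dim_row R = n" "dim_col R = d"
  "dim_row U = m" "dim_col U = d" "dim_row V = n" "dim_col V = d"
  using P Q Us Vs by (auto simp: A_def B_def L_def R_def U V)

lemma carriers [simp]:
  "A \<in> carrier_mat d d" "B \<in> carrier_mat d d" "L \<in> carrier_mat m d" "R \<in> carrier_mat n d"
  "U \<in> carrier_mat m d" "V \<in> carrier_mat n d"
  using dims by (auto intro!: carrier_matI)

lemmas PL = gram_split(1)[OF P Us A_def L_def]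
lemmas QR = gram_split(1)[OF Q Vs B_def R_def]
lemmas LP = gram_split(2)[OF P Us A_def L_def]
lemmas Us_split = gram_split(3)[OF P Us A_def L_def]
lemmas Vs_split = gram_split(3)[OF Q Vs B_def R_def]
lemmas gram_split_U = gram_split(4)[OF P Us A_def L_def]
lemmas gram_split_V = gram_split(4)[OF Q Vs B_def R_def]

lemma frob_split_U: "frob_inner Us Us = frob_inner A A + frob_inner L L"
  using frob_inner_eq_trace[OF Us Us] frob_inner_eq_trace[of A d d A] frob_inner_eq_trace[of L m d L] dims
  by (simp add: gram_split_U sum.distrib del: index_mult_mat(1))

lemma frob_split_V: "frob_inner Vs Vs = frob_inner B B + frob_inner R R"
  using frob_inner_eq_trace[OF Vs Vs] frob_inner_eq_trace[of B d d B] frob_inner_eq_trace[of R n d R] dims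
  by (simp add: gram_split_V sum.distrib del: index_mult_mat(1))

text \<open>\<open>N\<close> has orthonormal columns and drops out of the norm, which leaves the
  columns of \<open>M\<close> weighted by \<open>s\<close>.\<close>

lemma dmat_frob_mult:
  assumes "M \<in> carrier_mat k d" "N \<in> carrier_mat j d" "N\<^sup>T * N = 1\<^sub>m d"
  shows "frob_inner (M * (N * dmat d s)\<^sup>T) (M * (N * dmat d s)\<^sup>T)
    = (\<Sum>i<d. (s i)\<^sup>2 * (M\<^sup>T * M) $$ (i, i))"
proof -
  let ?MN = "M * (N * dmat d s)\<^sup>T" and ?Ms = "M * dmat d s"
  have dm: "dim_row M = k" "dim_col M = d" "dim_row N = j" "dim_col N = d" using assms by auto
  have "frob_inner ?MN ?MN
    = frob_inner (M * dmat d s * N\<^sup>T) (M * dmat d s * N\<^sup>T)"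
    using dm by (simp add: mat_simps)
  also have "\<dots> = frob_inner ?Ms (M * dmat d s * N\<^sup>T * N)"
    using assms by (subst frob_inner_mult_left'[of _ k d _ j]) auto
  also have "M * dmat d s * N\<^sup>T * N = M * dmat d s"
    using dm assms(3) by (simp add: mat_simps)
  also have "frob_inner ?Ms ?Ms = (\<Sum>i<d. (s i)\<^sup>2 * (M\<^sup>T * M) $$ (i, i))"
  proof -
    have Ms: "M * dmat d s \<in> carrier_mat k d" using assms by (intro mult_carrier_mat) auto
    have "frob_inner ?Ms ?Ms = (\<Sum>i<d. \<Sum>a<k. (M $$ (a, i) * s i) * (M $$ (a, i) * s i))"
      unfolding frob_inner_carrier[OF Ms]
      by (subst sum.swap, intro sum.cong refl) (simp add: index_mult_dmat_right[OF assms(1)] del: index_mult_mat(1))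
    also have "\<dots> = (\<Sum>i<d. (s i)\<^sup>2 * (M\<^sup>T * M) $$ (i, i))"
      using assms(1) by (intro sum.cong refl, subst index_mult_mat_sum[of _ d k _ d])
        (auto simp: sum_distrib_left power2_eq_square mult_ac)
    finally show ?thesis .
  qed
  finally show ?thesis .
qed

lemma frob_X_Xs:
  assumes "E = P * dmat d w * Q\<^sup>T"
  shows "frob_inner E (Us * Vs\<^sup>T) = (\<Sum>i<d. w i * (\<Sum>j<d. A $$ (i, j) * B $$ (i, j)))"
proof -
  have "frob_inner E (Us * Vs\<^sup>T)
     = frob_inner (dmat d w * Q\<^sup>T) (P\<^sup>T * (Us * Vs\<^sup>T))"
  proof -
    have "E = P * (dmat d w * Q\<^sup>T)" unfolding assms using dims by (simp add: mat_simps)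
    thus ?thesis using P Q Us Vs by (simp only:) (intro frob_inner_mult_left, auto intro!: carrier_matI simp: dims)
  qed
  also have "\<dots> = frob_inner (dmat d w) (P\<^sup>T * (Us * Vs\<^sup>T) * Q)"
    using P Q Us Vs by (subst frob_inner_mult_left'[of _ d d _ n]) auto
  also have "P\<^sup>T * (Us * Vs\<^sup>T) * Q = A * B\<^sup>T"
    unfolding A_def B_def using dims by (simp add: mat_simps)
  also have "frob_inner (dmat d w) (A * B\<^sup>T) = (\<Sum>i<d. w i * (A * B\<^sup>T) $$ (i, i))"
    by (rule frob_inner_dmat) (auto intro!: carrier_matI simp: dims)
  also have "\<dots> = (\<Sum>i<d. w i * (\<Sum>j<d. A $$ (i, j) * B $$ (i, j)))"
    using dims by (intro sum.cong refl, subst index_mult_mat_sum[of _ d d _ d]) (auto intro!: carrier_matI)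
  finally show ?thesis .
qed

text \<open>
  With $C = U_*^T U_*$ and $S = \mathrm{diag}(s)$ the difference of the two sides is
  $\|S^2 - C\|_F^2 + \sum_{i,j} s_i^2 (A_{ji}^2 + B_{ji}^2 - 2 A_{ij} B_{ij})$, and symmetry of
  \<open>A + B\<close> makes every summand nonnegative.
\<close>

lemma hessian_direction_le:
  "frob_inner (L * V\<^sup>T + U * R\<^sup>T) (L * V\<^sup>T + U * R\<^sup>T)
   \<le> frob_inner (U * V\<^sup>T - Us * Vs\<^sup>T) (U * V\<^sup>T - Us * Vs\<^sup>T)"
proof -
  let ?X = "U * V\<^sup>T" and ?Xs = "Us * Vs\<^sup>T"
    and ?LV = "L * V\<^sup>T" and ?UR = "U * R\<^sup>T"
  let ?E = "?X - ?Xs" and ?K = "?LV + ?UR"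
  define C where "C = Us\<^sup>T * Us"
  have C: "C \<in> carrier_mat d d" using Us by (simp add: C_def)
  define w where "w i = (s i)\<^sup>2" for i
  have c1: "L * V\<^sup>T \<in> carrier_mat m n" and c2: "U * R\<^sup>T \<in> carrier_mat m n"
    and c3: "U * V\<^sup>T \<in> carrier_mat m n" and c4: "Us * Vs\<^sup>T \<in> carrier_mat m n"
    using dims by (auto intro!: carrier_matI)
  have UV: "U * V\<^sup>T = P * dmat d w * Q\<^sup>T"
    unfolding U V using dims by (simp add: mat_simps w_def[abs_def] power2_eq_square flip: dmat_mult)
  have UR: "frob_inner ?UR ?UR = frob_inner (R * U\<^sup>T) (R * U\<^sup>T)"
    using frob_inner_transpose[OF c2 c2] dims by (simp add: mat_simps)
  have cross: "frob_inner ?LV ?UR = 0"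
  proof -
    have "frob_inner ?LV ?UR = frob_inner (V\<^sup>T) (L\<^sup>T * ?UR)"
      using c2 by (intro frob_inner_mult_left[of _ m d _ n]) auto
    also have "L\<^sup>T * ?UR = 0\<^sub>m d n"
      unfolding U using dims by (simp add: mat_simps) (simp add: LP flip: mult_assoc_dim)
    finally show ?thesis using frob_inner_zero_right[of "V\<^sup>T" d n] by simp
  qed
  have K: "frob_inner ?K ?K
     = (\<Sum>i<d. w i * (L\<^sup>T * L) $$ (i, i)) + (\<Sum>i<d. w i * (R\<^sup>T * R) $$ (i, i))"
  proof -
    have "frob_inner ?K ?K
      = frob_inner ?LV ?LV + frob_inner ?UR ?UR"
      using cross frob_inner_add_square[OF c1 c2] by simp
    thus ?thesis unfolding UR
      using dmat_frob_mult[of L m Q n] dmat_frob_mult[of R n P m] P Q by (simp add: w_def U V)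
  qed
  have LL: "(L\<^sup>T * L) $$ (i, i) = C $$ (i, i) - (\<Sum>j<d. (A $$ (j, i))\<^sup>2)" if "i < d" for i
    using that dims index_mult_mat_sum[of "A\<^sup>T" d d A d i i]
    by (simp add: C_def gram_split_U power2_eq_square del: index_mult_mat(1))
  have RR: "(R\<^sup>T * R) $$ (i, i) = C $$ (i, i) - (\<Sum>j<d. (B $$ (j, i))\<^sup>2)" if "i < d" for i
    using that dims index_mult_mat_sum[of "B\<^sup>T" d d B d i i]
    by (simp add: C_def balanced gram_split_V power2_eq_square del: index_mult_mat(1))
  have XX: "frob_inner ?X ?X = (\<Sum>i<d. w i * w i)"
  proof -
    have "frob_inner ?X ?X = (\<Sum>i<d. (s i)\<^sup>2 * (U\<^sup>T * U) $$ (i, i))"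
      using dmat_frob_mult[of U m Q n] Q by (simp add: V)
    also have "U\<^sup>T * U = dmat d w"
      unfolding U using dims by (simp add: mat_simps mult_cancel_dim[OF P(2)] dmat_mult w_def[abs_def] power2_eq_square)
    finally show ?thesis by (simp add: w_def dmat_def)
  qed
  \<comment> \<open>Balance makes both Gram matrices equal to \<open>C\<close>, so the norm of the
    product is the norm of \<open>C\<close>.\<close>
  have XsXs: "frob_inner ?Xs ?Xs = frob_inner C C"
  proof -
    have "frob_inner ?Xs ?Xs = frob_inner (Vs\<^sup>T) (C * Vs\<^sup>T)"
      using c4 Us Vs dims by (subst frob_inner_mult_left[of _ m d _ n]) (auto simp: C_def mat_simps)
    also have "\<dots> = frob_inner (C * Vs\<^sup>T) (Vs\<^sup>T)"
      using C Vs by (intro frob_inner_commute[of _ d n]) auto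
    also have "\<dots> = frob_inner C (Vs\<^sup>T * Vs)"
      using C Vs by (subst frob_inner_mult_left'[of _ d d _ n]) auto
    finally show ?thesis by (simp add: C_def balanced)
  qed
  have E: "frob_inner ?E ?E
    = (\<Sum>i<d. w i * w i) - 2 * (\<Sum>i<d. w i * (\<Sum>j<d. A $$ (i, j) * B $$ (i, j))) + frob_inner C C"
    using frob_X_Xs[OF UV] XX XsXs frob_inner_minus_square[OF c3 c4] by simp
  have "0 \<le> frob_inner (dmat d w - C) (dmat d w - C)" by simp
  also have "\<dots> = (\<Sum>i<d. w i * w i) - 2 * (\<Sum>i<d. w i * C $$ (i, i)) + frob_inner C C"
    unfolding frob_inner_minus_square[OF dmat_carrier C] frob_inner_dmat[OF C] frob_inner_dmat[OF dmat_carrier]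
    by (simp add: dmat_def)
  finally have 1: "2 * (\<Sum>i<d. w i * C $$ (i, i)) \<le> (\<Sum>i<d. w i * w i) + frob_inner C C" by simp
  \<comment> \<open>The symmetry of \<open>A + B\<close> enters here. Bounding the product of the
    entries through the square of their sum allows the indices to be exchanged, which yields the
    column sums that occur in \<open>LL\<close> and \<open>RR\<close>.\<close>
  have 2: "(\<Sum>j<d. 2 * (A $$ (i, j) * B $$ (i, j))) \<le> (\<Sum>j<d. (A $$ (j, i))\<^sup>2 + (B $$ (j, i))\<^sup>2)" if "i < d" for i
  proof (rule sum_mono)
    fix j assume "j \<in> {..<d}"
    hence e: "A $$ (i, j) + B $$ (i, j) = A $$ (j, i) + B $$ (j, i)"
      using sym[of i j] that by (simp add: A_def B_def)
    have "4 * (A $$ (i, j) * B $$ (i, j)) \<le> (A $$ (i, j) + B $$ (i, j))\<^sup>2"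
      using zero_le_power2[of "A $$ (i, j) - B $$ (i, j)"] by (simp add: power2_eq_square algebra_simps)
    also have "\<dots> \<le> 2 * ((A $$ (j, i))\<^sup>2 + (B $$ (j, i))\<^sup>2)"
      unfolding e using zero_le_power2[of "A $$ (j, i) - B $$ (j, i)"] by (simp add: power2_eq_square algebra_simps)
    finally show "2 * (A $$ (i, j) * B $$ (i, j)) \<le> (A $$ (j, i))\<^sup>2 + (B $$ (j, i))\<^sup>2" by simp
  qed
  have "2 * (\<Sum>i<d. w i * (\<Sum>j<d. A $$ (i, j) * B $$ (i, j))) = (\<Sum>i<d. w i * (\<Sum>j<d. 2 * (A $$ (i, j) * B $$ (i, j))))"
    by (simp add: sum_distrib_left mult_ac)
  also have "\<dots> \<le> (\<Sum>i<d. w i * (\<Sum>j<d. (A $$ (j, i))\<^sup>2 + (B $$ (j, i))\<^sup>2))"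
  proof (rule sum_mono)
    fix i assume "i \<in> {..<d}"
    thus "w i * (\<Sum>j<d. 2 * (A $$ (i, j) * B $$ (i, j))) \<le> w i * (\<Sum>j<d. (A $$ (j, i))\<^sup>2 + (B $$ (j, i))\<^sup>2)"
      by (intro mult_left_mono[OF 2]) (auto simp: w_def)
  qed
  finally have 3: "2 * (\<Sum>i<d. w i * (\<Sum>j<d. A $$ (i, j) * B $$ (i, j)))
     \<le> (\<Sum>i<d. w i * (\<Sum>j<d. (A $$ (j, i))\<^sup>2)) + (\<Sum>i<d. w i * (\<Sum>j<d. (B $$ (j, i))\<^sup>2))"
    by (simp add: sum.distrib distrib_left)
  have "(\<Sum>i<d. w i * (L\<^sup>T * L) $$ (i, i)) = (\<Sum>i<d. w i * C $$ (i, i)) - (\<Sum>i<d. w i * (\<Sum>j<d. (A $$ (j, i))\<^sup>2))"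
    using LL by (simp add: right_diff_distrib sum_subtractf del: index_mult_mat(1))
  moreover have "(\<Sum>i<d. w i * (R\<^sup>T * R) $$ (i, i)) = (\<Sum>i<d. w i * C $$ (i, i)) - (\<Sum>i<d. w i * (\<Sum>j<d. (B $$ (j, i))\<^sup>2))"
    using RR by (simp add: right_diff_distrib sum_subtractf del: index_mult_mat(1))
  ultimately show ?thesis unfolding K E using 1 3 by linarith
qed

lemma U_orthogonal_L: "U\<^sup>T * L = 0\<^sub>m d d" and V_orthogonal_R: "V\<^sup>T * R = 0\<^sub>m d d"
  unfolding U V using dims by (simp_all add: mat_simps PL QR)

text \<open>
  Only the blocks $P A B^T Q^T$ and $L R^T$ of $U_* V_*^T$ contribute to the inner product with \<open>G\<close>,
  since the columns of \<open>P\<close> and \<open>Q\<close> are singular vectors of \<open>G\<close>.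
\<close>

lemma frob_gradient_split:
  assumes G: "G \<in> carrier_mat m n" and GQ: "G * Q = P * dmat d g" and GP: "G\<^sup>T * P = Q * dmat d g"
  shows "frob_inner G (Us * Vs\<^sup>T)
     = (\<Sum>i<d. g i * (\<Sum>j<d. A $$ (i, j) * B $$ (i, j))) + frob_inner G (L * R\<^sup>T)"
proof -
  have dG: "dim_row G = m" "dim_col G = n" using G by auto
  have PG: "P\<^sup>T * G = dmat d g * Q\<^sup>T"
    using arg_cong[OF GP, of transpose_mat] dims dG by (simp add: mat_simps)
  have "Us * Vs\<^sup>T = P * (A * Vs\<^sup>T) + L * Vs\<^sup>T"
    using arg_cong[OF Us_split, of "\<lambda>W. W * Vs\<^sup>T"] dims by (simp add: mat_simps)
  moreover have "L * Vs\<^sup>T = L * B\<^sup>T * Q\<^sup>T + L * R\<^sup>T"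
    using arg_cong[OF Vs_split, of "\<lambda>W. L * W\<^sup>T"] dims by (simp add: mat_simps transpose_add_dim)
  ultimately have "frob_inner G (Us * Vs\<^sup>T)
     = frob_inner G (P * (A * Vs\<^sup>T)) + (frob_inner G (L * B\<^sup>T * Q\<^sup>T) + frob_inner G (L * R\<^sup>T))"
    using dims dG by (simp add: mat_simps)
  also have "frob_inner G (L * B\<^sup>T * Q\<^sup>T) = 0"
  proof -
    have "frob_inner G (L * B\<^sup>T * Q\<^sup>T) = frob_inner (G * Q) (L * B\<^sup>T)"
      using G Q by (subst frob_inner_mult_right'[of _ m d _ n]) (auto intro!: carrier_matI simp: dims)
    also have "\<dots> = frob_inner (dmat d g) (P\<^sup>T * (L * B\<^sup>T))"
      unfolding GQ using P by (intro frob_inner_mult_left[of _ m d _ d]) (auto intro!: carrier_matI simp: dims)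
    also have "P\<^sup>T * (L * B\<^sup>T) = 0\<^sub>m d d"
      using dims by (simp add: PL flip: mult_assoc_dim)
    finally show ?thesis using frob_inner_zero_right[OF dmat_carrier] by simp
  qed
  also have "frob_inner G (P * (A * Vs\<^sup>T)) = frob_inner (dmat d g * Q\<^sup>T) (A * Vs\<^sup>T)"
    unfolding PG[symmetric] using G P Vs by (intro frob_inner_mult_right[of _ m d _ n]) (auto intro!: carrier_matI simp: dims)
  also have "\<dots> = frob_inner (dmat d g) (A * Vs\<^sup>T * Q)"
    using Q Vs by (subst frob_inner_mult_left'[of _ d d _ n]) (auto intro!: carrier_matI simp: dims)
  also have "A * Vs\<^sup>T * Q = A * B\<^sup>T"
    unfolding B_def using dims by (simp add: mat_simps)
  also have "frob_inner (dmat d g) (A * B\<^sup>T) = (\<Sum>i<d. g i * (A * B\<^sup>T) $$ (i, i))"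
    by (rule frob_inner_dmat) (auto intro!: carrier_matI simp: dims)
  also have "\<dots> = (\<Sum>i<d. g i * (\<Sum>j<d. A $$ (i, j) * B $$ (i, j)))"
    using dims by (intro sum.cong refl, subst index_mult_mat_sum[of _ d d _ d]) (auto intro!: carrier_matI)
  finally show ?thesis by simp
qed

text \<open>Bounds the part of the gradient pairing inside the ranges of \<open>P\<close> and
  \<open>Q\<close>, in a form that the Hessian terms in \<open>L\<close> and \<open>R\<close>
  complete to the full norms of \<open>Us\<close> and \<open>Vs\<close>.\<close>

lemma weighted_trace_le:
  assumes "\<And>i. i < d \<Longrightarrow> 0 \<le> v i" "\<And>i. i < d \<Longrightarrow> v i \<le> \<mu>"
  shows "(\<Sum>i<d. v i * (\<Sum>j<d. A $$ (i, j) * B $$ (i, j))) \<le> \<mu> * (frob_inner A A + frob_inner B B) / 2"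
proof -
  have "(\<Sum>i<d. v i * (\<Sum>j<d. A $$ (i, j) * B $$ (i, j)))
      \<le> (\<Sum>i<d. \<Sum>j<d. \<mu> * (A $$ (i, j) * A $$ (i, j) + B $$ (i, j) * B $$ (i, j)) / 2)"
    unfolding sum_distrib_left
  proof (intro sum_mono)
    fix i j assume ij: "i \<in> {..<d}" "j \<in> {..<d}"
    have "v i * (A $$ (i, j) * B $$ (i, j)) \<le> v i * ((A $$ (i, j) * A $$ (i, j) + B $$ (i, j) * B $$ (i, j)) / 2)"
      using assms ij zero_le_power2[of "A $$ (i, j) - B $$ (i, j)"]
      by (intro mult_left_mono) (auto simp: power2_eq_square algebra_simps)
    also have "\<dots> \<le> \<mu> * ((A $$ (i, j) * A $$ (i, j) + B $$ (i, j) * B $$ (i, j)) / 2)"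
      using assms ij by (intro mult_right_mono) auto
    finally show "v i * (A $$ (i, j) * B $$ (i, j)) \<le> \<mu> * (A $$ (i, j) * A $$ (i, j) + B $$ (i, j) * B $$ (i, j)) / 2"
      by simp
  qed
  also have "\<dots> = \<mu> * (frob_inner A A + frob_inner B B) / 2"
    using frob_inner_carrier[of A d d A] frob_inner_carrier[of B d d B]
    by (simp add: sum.distrib distrib_left sum_distrib_left sum_divide_distrib add_divide_distrib)
  finally show ?thesis .
qed

end

section \<open>Sub-Gaussian noise\<close>

lemma sub_gaussian_uminus:
  assumes "sub_gaussian M X \<sigma>"
  shows "sub_gaussian M (\<lambda>x. - X x) \<sigma>"
  unfolding sub_gaussian_def
proof
  fix t
  show "integrable M (\<lambda>x. exp (t * - X x)) \<and> (\<integral>x. exp (t * - X x) \<partial>M) \<le> exp (\<sigma>\<^sup>2 * t\<^sup>2 / 2)"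
    using assms[unfolded sub_gaussian_def, rule_format, of "- t"] by simp
qed

lemma (in prob_space) sub_gaussian_upper_tail:
  assumes X: "sub_gaussian M X \<sigma>" and "\<sigma> > 0" "a > 0"
  shows "prob {x \<in> space M. X x \<ge> a} \<le> exp (- (a\<^sup>2) / (2 * \<sigma>\<^sup>2))"
proof -
  \<comment> \<open>This parameter minimizes the exponent - s a + \<sigma>^2 s^2 / 2 of the Chernoff
    bound.\<close>
  define s where "s = a / \<sigma>\<^sup>2"
  have s: "s > 0" using assms by (simp add: s_def)
  have int: "integrable M (\<lambda>x. exp (s * X x))" "(\<integral>x. exp (s * X x) \<partial>M) \<le> exp (\<sigma>\<^sup>2 * s\<^sup>2 / 2)"
    using X by (auto simp: sub_gaussian_def)
  have "prob {x \<in> space M. X x \<ge> a} \<le> exp (- s * a) * (\<integral>x\<in>space M. exp (s * X x) \<partial>M)"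
  proof (rule Chernoff_ineq_ge[OF s])
    show "set_integrable M (space M) (\<lambda>x. exp (s * X x))"
      using integrable_mult_indicator[OF sets.top int(1)] by (simp add: set_integrable_def)
  qed simp
  also have "(\<integral>x\<in>space M. exp (s * X x) \<partial>M) = (\<integral>x. exp (s * X x) \<partial>M)"
    using set_integral_space[OF int(1)] .
  also have "exp (- s * a) * (\<integral>x. exp (s * X x) \<partial>M) \<le> exp (- s * a) * exp (\<sigma>\<^sup>2 * s\<^sup>2 / 2)"
    using int(2) by (intro mult_left_mono) auto
  also have "\<dots> = exp (- (a\<^sup>2) / (2 * \<sigma>\<^sup>2))"
    using assms by (simp add: s_def power2_eq_square divide_simps flip: exp_add)
  finally show ?thesis .
qed

lemma (in prob_space) sub_gaussian_tail:
  assumes X: "sub_gaussian M X \<sigma>" "random_variable borel X" and "\<sigma> > 0" "a > 0"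
  shows "prob {x \<in> space M. \<bar>X x\<bar> \<ge> a} \<le> 2 * exp (- (a\<^sup>2) / (2 * \<sigma>\<^sup>2))"
proof -
  note [measurable] = X(2)
  have "{x \<in> space M. \<bar>X x\<bar> \<ge> a} = {x \<in> space M. X x \<ge> a} \<union> {x \<in> space M. - X x \<ge> a}" by auto
  moreover have "prob ({x \<in> space M. X x \<ge> a} \<union> {x \<in> space M. - X x \<ge> a})
     \<le> prob {x \<in> space M. X x \<ge> a} + prob {x \<in> space M. - X x \<ge> a}"
    by (rule measure_Un_le) auto
  ultimately show ?thesis
    using sub_gaussian_upper_tail[OF X(1) assms(3,4)]
      sub_gaussian_upper_tail[OF sub_gaussian_uminus[OF X(1)] assms(3,4)] by simp
qed

text \<open>With parameter 0 the nonnegative variable $e^X + e^{-X} - 2$ has expectation at most 0.\<close>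

lemma (in prob_space) sub_gaussian_zero:
  assumes X: "sub_gaussian M X 0"
  shows "AE x in M. X x = 0"
proof -
  have int: "integrable M (\<lambda>x. exp (X x))" "(\<integral>x. exp (X x) \<partial>M) \<le> 1"
    "integrable M (\<lambda>x. exp (- X x))" "(\<integral>x. exp (- X x) \<partial>M) \<le> 1"
    using X[unfolded sub_gaussian_def, rule_format, of 1] X[unfolded sub_gaussian_def, rule_format, of "-1"] by auto
  define Y where "Y x = exp (X x) + exp (- X x) - 2" for x
  have Y0: "Y x \<ge> 0" and Y1: "Y x = 0 \<Longrightarrow> X x = 0" for x
  proof -
    have "Y x = (exp (X x / 2) - exp (- X x / 2))\<^sup>2"
      by (simp add: Y_def power2_eq_square algebra_simps flip: exp_add)
    thus "Y x \<ge> 0" "Y x = 0 \<Longrightarrow> X x = 0" by auto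
  qed
  have iY: "integrable M Y" unfolding Y_def using int by auto
  have "(\<integral>x. Y x \<partial>M) = (\<integral>x. exp (X x) \<partial>M) + (\<integral>x. exp (- X x) \<partial>M) - 2"
    unfolding Y_def using int by (simp add: prob_space)
  hence "(\<integral>x. Y x \<partial>M) = 0" using int Bochner_Integration.integral_nonneg[of M Y] Y0 by force
  hence "AE x in M. Y x = 0"
    using integral_nonneg_eq_0_iff_AE[OF iY] Y0 by simp
  thus ?thesis by eventually_elim (rule Y1)
qed

definition noise_const :: "nat \<Rightarrow> real" where
  "noise_const l = 2 * real l * (ln (2 * real l) / ln 2 + 1)"

text \<open>
  The constant may depend on \<open>l\<close>, so a union bound over the \<open>l\<close> coordinates suffices;
  $\ln(2lN) \le (\ln(2l)/\ln 2 + 1)\ln N$ absorbs the factor \<open>2l\<close>.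
\<close>

lemma (in prob_space) sub_gaussian_noise_bound:
  assumes \<omega>: "\<And>i. i < l \<Longrightarrow> sub_gaussian M (\<omega> i) \<sigma>" "\<And>i. i < l \<Longrightarrow> random_variable borel (\<omega> i)"
    and \<sigma>: "\<sigma> \<ge> 0" and l: "l \<ge> 1" and N: "N \<ge> (2::nat)"
  shows "holds_with_prob M (1 - 1 / real N) (\<lambda>x. (\<Sum>i<l. (\<omega> i x)\<^sup>2) \<le> noise_const l * \<sigma>\<^sup>2 * ln (real N))"
proof (cases "\<sigma> = 0")
  case True
  \<comment> \<open>The tail bound divides by the variance parameter, so \<sigma> = 0 is separate:
    the noise then vanishes almost surely.\<close>
  have "AE x in M. \<forall>i\<in>{..<l}. \<omega> i x = 0"
    using \<omega>(1) True by (intro AE_finite_allI) (auto intro: sub_gaussian_zero)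
  from AE_E_prob[OF this] obtain E
    where "E \<subseteq> {x \<in> space M. \<forall>i\<in>{..<l}. \<omega> i x = 0}" "E \<in> events" "prob E = 1" .
  hence E: "E \<in> sets M" "prob E = 1" "\<And>x. x \<in> E \<Longrightarrow> \<forall>i\<in>{..<l}. \<omega> i x = 0" by auto
  show ?thesis unfolding holds_with_prob_def
    using E True by (intro bexI[of _ E]) auto
next
  case False
  hence \<sigma>: "\<sigma> > 0" using \<sigma> by simp
  \<comment> \<open>Chosen so that each two-sided tail is at most 1/(l N), which the union bound
    over l coordinates turns into 1/N.\<close>
  define a where "a = sqrt (2 * \<sigma>\<^sup>2 * ln (2 * real l * real N))"
  have big: "2 * real l * real N > 1"
  proof -
    have "1 * 2 \<le> l * N" using l N by (intro mult_mono) auto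
    hence "2 \<le> real l * real N" by (metis of_nat_mult of_nat_numeral of_nat_le_iff mult_1)
    thus ?thesis by simp
  qed
  hence lnpos: "ln (2 * real l * real N) > 0" by (rule ln_gt_zero)
  have a: "a > 0" using \<sigma> lnpos by (simp add: a_def)
  have a2: "a\<^sup>2 = 2 * \<sigma>\<^sup>2 * ln (2 * real l * real N)" using lnpos by (simp add: a_def)
  define B where "B i = {x \<in> space M. \<bar>\<omega> i x\<bar> \<ge> a}" for i
  have Bm: "B i \<in> sets M" if "i < l" for i
  proof -
    note [measurable] = \<omega>(2)[OF that]
    show ?thesis unfolding B_def by measurable
  qed
  have PB: "prob (B i) \<le> 1 / (real l * real N)" if "i < l" for i
  proof -
    have "prob (B i) \<le> 2 * exp (- (a\<^sup>2) / (2 * \<sigma>\<^sup>2))"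
      unfolding B_def by (rule sub_gaussian_tail[OF \<omega>(1)[OF that] \<omega>(2)[OF that] \<sigma> a])
    also have "- (a\<^sup>2) / (2 * \<sigma>\<^sup>2) = - ln (2 * real l * real N)" using \<sigma> by (simp add: a2)
    also have "2 * exp (- ln (2 * real l * real N)) = 1 / (real l * real N)"
      using l N big by (simp add: exp_minus field_simps)
    finally show ?thesis .
  qed
  define E where "E = space M - (\<Union>i<l. B i)"
  have Em: "E \<in> sets M" unfolding E_def using Bm by (intro sets.Diff sets.finite_UN) auto
  have "prob (\<Union>i<l. B i) \<le> (\<Sum>i<l. prob (B i))"
    using Bm by (intro measure_UNION_le) auto
  also have "\<dots> \<le> (\<Sum>i<l. 1 / (real l * real N))" using PB by (intro sum_mono) auto
  also have "\<dots> = 1 / real N" using l by simp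
  finally have "prob (\<Union>i<l. B i) \<le> 1 / real N" .
  moreover have "prob E = 1 - prob (\<Union>i<l. B i)"
    unfolding E_def using Bm by (intro prob_compl sets.finite_UN) auto
  ultimately have PE: "prob E \<ge> 1 - 1 / real N" by simp
  have "(\<Sum>i<l. (\<omega> i x)\<^sup>2) \<le> noise_const l * \<sigma>\<^sup>2 * ln (real N)" if x: "x \<in> E" for x
  proof -
    have "(\<omega> i x)\<^sup>2 \<le> a\<^sup>2" if "i < l" for i
    proof -
      have "\<bar>\<omega> i x\<bar> \<le> a" using x that by (force simp: E_def B_def)
      thus ?thesis using a by (metis abs_le_square_iff abs_of_pos)
    qed
    hence "(\<Sum>i<l. (\<omega> i x)\<^sup>2) \<le> (\<Sum>i<l. a\<^sup>2)" by (intro sum_mono) auto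
    also have "\<dots> = 2 * real l * \<sigma>\<^sup>2 * ln (2 * real l * real N)" by (simp add: a2)
    also have "ln (2 * real l * real N) = ln (2 * real l) + ln (real N)"
      using l N by (subst ln_mult) auto
    also have "2 * real l * \<sigma>\<^sup>2 * (ln (2 * real l) + ln (real N))
        \<le> 2 * real l * \<sigma>\<^sup>2 * ((ln (2 * real l) / ln 2 + 1) * ln (real N))"
    proof (rule mult_left_mono)
      have "ln 2 \<le> ln (real N)" using N by simp
      moreover have "ln (2 * real l) \<ge> 0" using l by simp
      ultimately have "ln (2 * real l) / ln 2 * ln 2 \<le> ln (2 * real l) / ln 2 * ln (real N)"
        by (intro mult_left_mono) auto
      thus "ln (2 * real l) + ln (real N) \<le> (ln (2 * real l) / ln 2 + 1) * ln (real N)"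
        by (simp add: algebra_simps)
    qed simp
    also have "\<dots> = noise_const l * \<sigma>\<^sup>2 * ln (real N)" by (simp only: noise_const_def mult_ac)
    finally show ?thesis .
  qed
  thus ?thesis unfolding holds_with_prob_def using Em PE by blast
qed

section \<open>Derivatives of the objective along lines\<close>

text \<open>With \<open>col_ip\<close>, the power q of a column norm becomes the power q/2 of a
  quadratic polynomial along every line, so that no square root has to be differentiated.\<close>

definition col_ip :: "real mat \<Rightarrow> real mat \<Rightarrow> nat \<Rightarrow> real" where
  "col_ip A B j = (\<Sum>k<dim_row A. A $$ (k, j) * B $$ (k, j))"

definition residual :: "(nat \<Rightarrow> real mat) \<Rightarrow> (nat \<Rightarrow> real) \<Rightarrow> real mat \<Rightarrow> nat \<Rightarrow> real" where
  "residual A y X i = meas A X i - y i"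

text \<open>The gradient of \<open>loss\<close> at \<open>X\<close>: twice the adjoint of the
  measurement map, applied to the residual.\<close>

definition loss_gradient :: "nat \<Rightarrow> nat \<Rightarrow> nat \<Rightarrow> (nat \<Rightarrow> real mat) \<Rightarrow> (nat \<Rightarrow> real) \<Rightarrow> real mat \<Rightarrow> real mat" where
  "loss_gradient m n l A y X = Matrix.mat m n (\<lambda>(a, b). \<Sum>i<l. 2 * residual A y X i * A i $$ (a, b))"

lemma loss_gradient_carrier [simp]: "loss_gradient m n l A y X \<in> carrier_mat m n"
  by (simp add: loss_gradient_def)

lemma frob_loss_gradient:
  assumes A: "\<And>i. i < l \<Longrightarrow> A i \<in> carrier_mat m n"
  shows "frob_inner (loss_gradient m n l A y X) H = (\<Sum>i<l. 2 * residual A y X i * meas A H i)"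
proof -
  have "frob_inner (loss_gradient m n l A y X) H
     = (\<Sum>a<m. \<Sum>b<n. \<Sum>i<l. 2 * residual A y X i * A i $$ (a, b) * H $$ (a, b))"
    unfolding frob_inner_carrier[OF loss_gradient_carrier]
    by (intro sum.cong refl) (auto simp: loss_gradient_def sum_distrib_right)
  also have "\<dots> = (\<Sum>a<m. \<Sum>i<l. \<Sum>b<n. 2 * residual A y X i * A i $$ (a, b) * H $$ (a, b))"
    by (rule sum.cong[OF refl], rule sum.swap)
  also have "\<dots> = (\<Sum>i<l. \<Sum>a<m. \<Sum>b<n. 2 * residual A y X i * A i $$ (a, b) * H $$ (a, b))"
    by (rule sum.swap)
  also have "\<dots> = (\<Sum>i<l. 2 * residual A y X i * meas A H i)"
  proof (rule sum.cong[OF refl])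
    fix i assume "i \<in> {..<l}"
    thus "(\<Sum>a<m. \<Sum>b<n. 2 * residual A y X i * A i $$ (a, b) * H $$ (a, b)) = 2 * residual A y X i * meas A H i"
      unfolding meas_def using frob_inner_carrier[OF A] by (simp add: sum_distrib_left mult_ac)
  qed
  finally show ?thesis .
qed

lemma col_norm_powr:
  assumes "q > 0"
  shows "col_norm A j powr q = col_ip A A j powr (q / 2)"
proof -
  have "col_ip A A j \<ge> 0" by (auto simp: col_ip_def intro!: sum_nonneg)
  thus ?thesis
    by (simp add: col_norm_def L2_set_def col_ip_def power2_eq_square powr_half_sqrt[symmetric] powr_powr)
qed

lemma col_ip_self_nonneg [simp]: "col_ip A A j \<ge> 0"
  by (auto simp: col_ip_def intro!: sum_nonneg)

lemma meas_line:
  assumes A: "\<And>i. i < l \<Longrightarrow> A i \<in> carrier_mat m n" and i: "i < l"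
    and U: "U \<in> carrier_mat m d" "H \<in> carrier_mat m d" and V: "V \<in> carrier_mat n d" "K \<in> carrier_mat n d"
  shows "meas A ((U + t \<cdot>\<^sub>m H) * (V + t \<cdot>\<^sub>m K)\<^sup>T) i =
     meas A (U * V\<^sup>T) i + t * meas A (H * V\<^sup>T + U * K\<^sup>T) i
       + t\<^sup>2 * meas A (H * K\<^sup>T) i"
proof -
  have e: "((U + t \<cdot>\<^sub>m H) * (V + t \<cdot>\<^sub>m K)\<^sup>T) $$ (a, b)
      = (U * V\<^sup>T) $$ (a, b) + t * (H * V\<^sup>T + U * K\<^sup>T) $$ (a, b)
         + t\<^sup>2 * (H * K\<^sup>T) $$ (a, b)" if ab: "a < m" "b < n" for a b
  proof -
    have p: "(X * Y\<^sup>T) $$ (a, b) = (\<Sum>j<d. X $$ (a, j) * Y $$ (b, j))"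
      if "X \<in> carrier_mat m d" "Y \<in> carrier_mat n d" for X Y :: "real mat"
      using index_mult_mat_sum[of X m d "Y\<^sup>T" n a b] that ab by simp
    have "((U + t \<cdot>\<^sub>m H) * (V + t \<cdot>\<^sub>m K)\<^sup>T) $$ (a, b)
       = (\<Sum>j<d. (U $$ (a, j) + t * H $$ (a, j)) * (V $$ (b, j) + t * K $$ (b, j)))"
      using U V ab by (subst p) auto
    also have "\<dots> = (\<Sum>j<d. U $$ (a, j) * V $$ (b, j)) + t * ((\<Sum>j<d. H $$ (a, j) * V $$ (b, j)) + (\<Sum>j<d. U $$ (a, j) * K $$ (b, j)))
       + t\<^sup>2 * (\<Sum>j<d. H $$ (a, j) * K $$ (b, j))"
      by (simp add: sum.distrib sum_distrib_left power2_eq_square algebra_simps)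
    finally show ?thesis using U V ab p by (simp del: index_mult_mat(1))
  qed
  show ?thesis
    unfolding meas_def frob_inner_carrier[OF A[OF i]] using e
    by (simp add: sum.distrib sum_distrib_left algebra_simps del: index_mult_mat(1) index_add_mat(1))
qed

definition col_line :: "real mat \<Rightarrow> real mat \<Rightarrow> nat \<Rightarrow> real \<Rightarrow> real" where
  "col_line U H j t = col_ip U U j + 2 * t * col_ip U H j + t\<^sup>2 * col_ip H H j"

lemma col_ip_line:
  assumes "U \<in> carrier_mat m d" "H \<in> carrier_mat m d" "j < d"
  shows "col_ip (U + t \<cdot>\<^sub>m H) (U + t \<cdot>\<^sub>m H) j = col_line U H j t"
proof -
  have "col_ip (U + t \<cdot>\<^sub>m H) (U + t \<cdot>\<^sub>m H) j
     = (\<Sum>k<m. U $$ (k, j) * U $$ (k, j) + 2 * t * (U $$ (k, j) * H $$ (k, j)) + t\<^sup>2 * (H $$ (k, j) * H $$ (k, j)))"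
    unfolding col_ip_def using assms by (intro sum.cong) (auto simp: power2_eq_square algebra_simps)
  also have "\<dots> = col_line U H j t"
    using assms by (simp add: col_line_def col_ip_def sum.distrib sum_distrib_left)
  finally show ?thesis .
qed

text \<open>All derivatives of the objective are computed from this explicit form along a line, a
  polynomial of degree at most 4 plus powers of quadratics.\<close>

lemma Phi_line:
  assumes A: "\<forall>i<l. A i \<in> carrier_mat m n" and q: "q > 0"
    and U: "U \<in> carrier_mat m d" "H \<in> carrier_mat m d" and V: "V \<in> carrier_mat n d" "K \<in> carrier_mat n d"
  shows "Phi l A y q lam ((U, V) + pair_scale t (H, K)) =
     (\<Sum>i<l. (residual A y (U * V\<^sup>T) i + t * meas A (H * V\<^sup>T + U * K\<^sup>T) i
        + t\<^sup>2 * meas A (H * K\<^sup>T) i)\<^sup>2)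
     + lam / q * ((\<Sum>j<d. col_line U H j t powr (q / 2))
        + (\<Sum>j<d. col_line V K j t powr (q / 2)))"
proof -
  have "loss l A y ((U + t \<cdot>\<^sub>m H) * (V + t \<cdot>\<^sub>m K)\<^sup>T) =
     (\<Sum>i<l. (residual A y (U * V\<^sup>T) i + t * meas A (H * V\<^sup>T + U * K\<^sup>T) i
        + t\<^sup>2 * meas A (H * K\<^sup>T) i)\<^sup>2)"
    using meas_line[OF A[rule_format] _ U V]
    by (simp add: loss_def L2_set_def sum_nonneg residual_def algebra_simps)
  moreover have "norm_2q_pow q (U + t \<cdot>\<^sub>m H) = (\<Sum>j<d. col_line U H j t powr (q / 2))"
    using U by (simp add: norm_2q_pow_def col_norm_powr[OF q] col_ip_line[OF U])
  moreover have "norm_2q_pow q (V + t \<cdot>\<^sub>m K) = (\<Sum>j<d. col_line V K j t powr (q / 2))"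
    using V by (simp add: norm_2q_pow_def col_norm_powr[OF q] col_ip_line[OF V])
  ultimately show ?thesis by (simp add: Phi_def pair_scale_def)
qed

text \<open>The formula for the directional derivative of \<open>Phi\<close> at
  \<open>(U, V)\<close> along \<open>(H, K)\<close>. Since \<open>0 powr _ = 0\<close>, zero columns
  contribute nothing, as is right for directions that keep them zero.\<close>

definition dPhi :: "nat \<Rightarrow> nat \<Rightarrow> (nat \<Rightarrow> real mat) \<Rightarrow> (nat \<Rightarrow> real) \<Rightarrow> real \<Rightarrow> real
    \<Rightarrow> real mat \<Rightarrow> real mat \<Rightarrow> real mat \<Rightarrow> real mat \<Rightarrow> real" where
  "dPhi l d A y q lam U V H K =
     (\<Sum>i<l. 2 * residual A y (U * V\<^sup>T) i * meas A (H * V\<^sup>T + U * K\<^sup>T) i)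
     + lam * ((\<Sum>j<d. col_ip U U j powr (q / 2 - 1) * col_ip U H j)
        + (\<Sum>j<d. col_ip V V j powr (q / 2 - 1) * col_ip V K j))"

text \<open>For \<open>s = 0\<close> the power need not be differentiable; the hypothesis makes the
  function constant in that case.\<close>

lemma has_derivative_powr_quadratic:
  assumes s: "s \<ge> 0" and z: "s = 0 \<Longrightarrow> b = 0 \<and> a = 0"
  shows "((\<lambda>t. (s + 2 * t * b + t\<^sup>2 * a) powr p) has_real_derivative (2 * p * (s powr (p - 1) * b))) (at 0)"
proof (cases "s = 0")
  case True
  thus ?thesis using z by simp
next
  case False
  hence "s > 0" using s by simp
  thus ?thesis by (auto intro!: derivative_eq_intros)
qed

lemma col_ip_zero_imp:
  assumes "col_ip U U j = 0" "k < dim_row U"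
  shows "U $$ (k, j) = 0"
proof -
  have "\<forall>k\<in>{..<dim_row U}. U $$ (k, j) * U $$ (k, j) = 0"
    using assms(1) unfolding col_ip_def by (subst (asm) sum_nonneg_eq_0_iff) auto
  thus ?thesis using assms(2) by auto
qed

text \<open>The hypotheses \<open>zU\<close> and \<open>zV\<close> let zero columns stay zero along
  the line. They are present because the orthogonal pair in \<open>S_critical\<close> may have such
  columns.\<close>

lemma Phi_directional_derivative:
  assumes A: "\<And>i. i < l \<Longrightarrow> A i \<in> carrier_mat m n" and q: "q > 0"
    and U: "U \<in> carrier_mat m d" "H \<in> carrier_mat m d" and V: "V \<in> carrier_mat n d" "K \<in> carrier_mat n d"
    and zU: "\<And>j. j < d \<Longrightarrow> col_ip U U j = 0 \<Longrightarrow> col_ip H H j = 0"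
    and zV: "\<And>j. j < d \<Longrightarrow> col_ip V V j = 0 \<Longrightarrow> col_ip K K j = 0"
  shows "((\<lambda>t. Phi l A y q lam ((U, V) + pair_scale t (H, K))) has_real_derivative
           dPhi l d A y q lam U V H K) (at 0)"
proof -
  have z1: "col_ip U U j = 0 \<Longrightarrow> col_ip U H j = 0 \<and> col_ip H H j = 0" if "j < d" for j
    using zU[OF that] col_ip_zero_imp[of U j] by (simp add: col_ip_def[of U H])
  have z2: "col_ip V V j = 0 \<Longrightarrow> col_ip V K j = 0 \<and> col_ip K K j = 0" if "j < d" for j
    using zV[OF that] col_ip_zero_imp[of V j] by (simp add: col_ip_def[of V K])
  have 1: "((\<lambda>t. \<Sum>i<l. (c i + t * k i + t\<^sup>2 * e i)\<^sup>2) has_real_derivative (\<Sum>i<l. 2 * c i * k i)) (at 0)"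
    for c k e :: "nat \<Rightarrow> real"
    by (rule DERIV_sum) (auto intro!: derivative_eq_intros)
  have 2: "((\<lambda>t. \<Sum>j<d. col_line U H j t powr (q / 2)) has_real_derivative
     q * (\<Sum>j<d. col_ip U U j powr (q / 2 - 1) * col_ip U H j)) (at 0)"
    (is "(_ has_real_derivative ?T) _")
  proof (rule DERIV_cong)
    show "((\<lambda>t. \<Sum>j<d. col_line U H j t powr (q / 2)) has_real_derivative
     (\<Sum>j<d. 2 * (q / 2) * (col_ip U U j powr (q / 2 - 1) * col_ip U H j))) (at 0)"
      (is "(_ has_real_derivative ?S) _")
      unfolding col_line_def using z1 by (intro DERIV_sum has_derivative_powr_quadratic) auto
    have "2 * (q / 2) = q" by simp
    thus "?S = ?T" by (simp only: sum_distrib_left)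
  qed
  have 3: "((\<lambda>t. \<Sum>j<d. col_line V K j t powr (q / 2)) has_real_derivative
     q * (\<Sum>j<d. col_ip V V j powr (q / 2 - 1) * col_ip V K j)) (at 0)"
    (is "(_ has_real_derivative ?T) _")
  proof (rule DERIV_cong)
    show "((\<lambda>t. \<Sum>j<d. col_line V K j t powr (q / 2)) has_real_derivative
     (\<Sum>j<d. 2 * (q / 2) * (col_ip V V j powr (q / 2 - 1) * col_ip V K j))) (at 0)"
      (is "(_ has_real_derivative ?S) _")
      unfolding col_line_def using z2 by (intro DERIV_sum has_derivative_powr_quadratic) auto
    have "2 * (q / 2) = q" by simp
    thus "?S = ?T" by (simp only: sum_distrib_left)
  qed
  have A': "\<forall>i<l. A i \<in> carrier_mat m n" using A by blast
  show ?thesis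
    unfolding Phi_line[OF A' q U V]
  proof (rule DERIV_cong[OF DERIV_add[OF 1 DERIV_cmult[OF DERIV_add[OF 2 3]]]])
    have "lam / q * (q * x + q * y) = lam * (x + y)" for x y using q by (simp add: field_simps)
    thus "(\<Sum>i<l. 2 * residual A y (U * V\<^sup>T) i * meas A (H * V\<^sup>T + U * K\<^sup>T) i) +
      lam / q * (q * (\<Sum>j<d. col_ip U U j powr (q / 2 - 1) * col_ip U H j)
        + q * (\<Sum>j<d. col_ip V V j powr (q / 2 - 1) * col_ip V K j)) = dPhi l d A y q lam U V H K"
      by (simp only: dPhi_def)
  qed
qed

section \<open>Differentiability of functions of factor pairs along lines\<close>

lemma factorsI: "U \<in> carrier_mat m d \<Longrightarrow> V \<in> carrier_mat n d \<Longrightarrow> (U, V) \<in> factors m n d"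
  by (simp add: factors_def)

lemma pair_scale_factors [simp]: "h \<in> factors m n d \<Longrightarrow> pair_scale t h \<in> factors m n d"
  by (auto simp: factors_def pair_scale_def)

lemma pair_inner_scale_right:
  assumes "g \<in> factors m n d" "h \<in> factors m n d"
  shows "pair_inner g (pair_scale t h) = t * pair_inner g h"
  using assms frob_inner_smult_right[of "fst g" m d "fst h" t] frob_inner_smult_right[of "snd g" n d "snd h" t]
  by (auto simp: factors_def pair_inner_def pair_scale_def algebra_simps)

lemma pair_inner_scale_left: "pair_inner (pair_scale t g) h = t * pair_inner g h"
  by (simp add: pair_inner_def pair_scale_def frob_inner_smult_left algebra_simps)

lemma pair_inner_self_nonneg [simp]: "pair_inner h h \<ge> 0"
  by (simp add: pair_inner_def)

lemma factors_minus: "x \<in> factors m n d \<Longrightarrow> y \<in> factors m n d \<Longrightarrow> x - y \<in> factors m n d"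
  by (cases x; cases y) (auto simp: factors_def intro!: carrier_matI)

lemma pair_inner_minus_left:
  assumes "x \<in> factors m n d" "y \<in> factors m n d"
  shows "pair_inner (x - y) h = pair_inner x h - pair_inner y h"
  using assms by (cases x; cases y)
    (simp add: factors_def pair_inner_def frob_inner_minus_left[of _ m d] frob_inner_minus_left[of _ n d])

lemma pair_norm_scale:
  assumes "h \<in> factors m n d"
  shows "pair_norm (pair_scale t h) = \<bar>t\<bar> * pair_norm h"
  using assms by (simp add: pair_norm_def pair_inner_scale_left pair_inner_scale_right[of _ m n d] real_sqrt_mult flip: mult.assoc)

lemma pair_norm_nonneg [simp]: "pair_norm h \<ge> 0"
  by (simp add: pair_norm_def)

text \<open>The summand 1 in the denominator keeps the bound meaningful for a direction of norm
  0.\<close>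

lemma pair_norm_scale_small:
  assumes h: "h \<in> factors m n d" and "\<eta> > 0" and t: "\<bar>t\<bar> < \<eta> / (pair_norm h + 1)"
  shows "pair_norm (pair_scale t h) < \<eta>"
proof -
  have p: "pair_norm h + 1 > 0" using pair_norm_nonneg[of h] by linarith
  have "\<bar>t\<bar> * pair_norm h \<le> \<bar>t\<bar> * (pair_norm h + 1)" by (intro mult_left_mono) auto
  also have "\<dots> < \<eta>" using t p by (simp add: field_simps)
  finally show ?thesis using h by (simp add: pair_norm_scale)
qed

lemma pair_scale_add_line:
  assumes "h \<in> factors m n d" "z \<in> factors m n d"
  shows "z + pair_scale t h + pair_scale s h = z + pair_scale (t + s) h"
  using assms by (auto simp: factors_def pair_scale_def prod_eq_iff algebra_simps intro!: eq_matI)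

text \<open>The direction-dependent factor in \<open>abs_pair_inner_le\<close>. Only its
  independence of the other argument matters, so a sum of absolute entries replaces the sharper
  Cauchy-Schwarz constant.\<close>

definition pair_abs_sum :: "nat \<Rightarrow> nat \<Rightarrow> nat \<Rightarrow> real mat \<times> real mat \<Rightarrow> real" where
  "pair_abs_sum m n d h = (\<Sum>a<m. \<Sum>j<d. \<bar>fst h $$ (a, j)\<bar>) + (\<Sum>b<n. \<Sum>j<d. \<bar>snd h $$ (b, j)\<bar>)"

lemma pair_abs_sum_nonneg [simp]: "pair_abs_sum m n d h \<ge> 0"
  by (auto simp: pair_abs_sum_def intro!: sum_nonneg add_nonneg_nonneg)

lemma entry_le_pair_norm:
  assumes "g \<in> factors m n d"
  shows "a < m \<Longrightarrow> j < d \<Longrightarrow> \<bar>fst g $$ (a, j)\<bar> \<le> pair_norm g"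
    and "b < n \<Longrightarrow> j < d \<Longrightarrow> \<bar>snd g $$ (b, j)\<bar> \<le> pair_norm g"
proof -
  have g: "fst g \<in> carrier_mat m d" "snd g \<in> carrier_mat n d" using assms by (auto simp: factors_def)
  show "\<bar>fst g $$ (a, j)\<bar> \<le> pair_norm g" if "a < m" "j < d"
  proof -
    have "(fst g $$ (a, j))\<^sup>2 \<le> pair_inner g g"
      unfolding pair_inner_def by (rule order_trans[OF square_entry_le_frob_inner[OF g(1) that]]) simp
    from real_sqrt_le_mono[OF this] show ?thesis by (simp add: pair_norm_def)
  qed
  show "\<bar>snd g $$ (b, j)\<bar> \<le> pair_norm g" if "b < n" "j < d"
  proof -
    have "(snd g $$ (b, j))\<^sup>2 \<le> pair_inner g g"
      unfolding pair_inner_def by (rule order_trans[OF square_entry_le_frob_inner[OF g(2) that]]) simp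
    from real_sqrt_le_mono[OF this] show ?thesis by (simp add: pair_norm_def)
  qed
qed

lemma abs_pair_inner_le:
  assumes "g \<in> factors m n d"
  shows "\<bar>pair_inner g h\<bar> \<le> pair_norm g * pair_abs_sum m n d h"
proof -
  have g: "fst g \<in> carrier_mat m d" "snd g \<in> carrier_mat n d" using assms by (auto simp: factors_def)
  have "\<bar>frob_inner (fst g) (fst h)\<bar> \<le> (\<Sum>a<m. \<Sum>j<d. \<bar>fst g $$ (a, j) * fst h $$ (a, j)\<bar>)"
    unfolding frob_inner_carrier[OF g(1)] by (rule order_trans[OF sum_abs]) (intro sum_mono sum_abs)
  also have "\<dots> \<le> (\<Sum>a<m. \<Sum>j<d. pair_norm g * \<bar>fst h $$ (a, j)\<bar>)"
    using entry_le_pair_norm(1)[OF assms] by (intro sum_mono) (auto simp: abs_mult intro!: mult_right_mono)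
  finally have 1: "\<bar>frob_inner (fst g) (fst h)\<bar> \<le> pair_norm g * (\<Sum>a<m. \<Sum>j<d. \<bar>fst h $$ (a, j)\<bar>)"
    by (simp add: sum_distrib_left)
  have "\<bar>frob_inner (snd g) (snd h)\<bar> \<le> (\<Sum>a<n. \<Sum>j<d. \<bar>snd g $$ (a, j) * snd h $$ (a, j)\<bar>)"
    unfolding frob_inner_carrier[OF g(2)] by (rule order_trans[OF sum_abs]) (intro sum_mono sum_abs)
  also have "\<dots> \<le> (\<Sum>a<n. \<Sum>j<d. pair_norm g * \<bar>snd h $$ (a, j)\<bar>)"
    using entry_le_pair_norm(2)[OF assms] by (intro sum_mono) (auto simp: abs_mult intro!: mult_right_mono)
  finally have "\<bar>frob_inner (snd g) (snd h)\<bar> \<le> pair_norm g * (\<Sum>a<n. \<Sum>j<d. \<bar>snd h $$ (a, j)\<bar>)"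
    by (simp add: sum_distrib_left)
  thus ?thesis using 1 by (simp add: pair_inner_def pair_abs_sum_def distrib_left)
qed

text \<open>One-sided bounds suffice, since they hold for \<open>t\<close> of either sign.\<close>

lemma derivative_eq_of_lower_bound:
  fixes \<phi> :: "real \<Rightarrow> real"
  assumes D: "(\<phi> has_real_derivative D) (at 0)" and C: "C \<ge> 0"
    and lb: "\<And>\<epsilon>. \<epsilon> > 0 \<Longrightarrow> \<exists>\<eta>>0. \<forall>t. \<bar>t\<bar> < \<eta> \<longrightarrow> \<phi> t \<ge> \<phi> 0 + t * p - \<epsilon> * (\<bar>t\<bar> * C)"
  shows "D = p"
proof (rule ccontr)
  assume ne: "D \<noteq> p"
  \<comment> \<open>The gap |D - p| is split in halves, one for the difference quotient and one for
    the error term; C + 1 avoids a division by 0.\<close>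
  define e where "e = \<bar>D - p\<bar> / 2 / (C + 1)"
  have e: "e > 0" using ne C by (simp add: e_def)
  obtain \<eta>1 where \<eta>1: "\<eta>1 > 0" "\<And>t. \<bar>t\<bar> < \<eta>1 \<Longrightarrow> \<phi> t \<ge> \<phi> 0 + t * p - e * (\<bar>t\<bar> * C)"
    using lb[OF e] by blast
  have "((\<lambda>t. \<phi> t - t * p) has_real_derivative (D - p)) (at 0)"
    by (rule derivative_eq_intros D | simp)+
  hence "((\<lambda>h. ((\<phi> (0 + h) - (0 + h) * p) - (\<phi> 0 - 0 * p)) / h) \<longlongrightarrow> D - p) (at 0)"
    unfolding has_field_derivative_iff by simp
  hence lim: "((\<lambda>h. (\<phi> h - h * p - \<phi> 0) / h) \<longlongrightarrow> D - p) (at 0)" by simp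
  have "\<bar>D - p\<bar> / 2 > 0" using ne by simp
  from LIM_D[OF lim this] obtain \<eta>2 where \<eta>2: "\<eta>2 > 0"
    "\<And>h. h \<noteq> 0 \<Longrightarrow> \<bar>h\<bar> < \<eta>2 \<Longrightarrow> \<bar>(\<phi> h - h * p - \<phi> 0) / h - (D - p)\<bar> < \<bar>D - p\<bar> / 2"
    by (auto simp: )
  define u where "u = min \<eta>1 \<eta>2 / 2"
  have u: "u > 0" "u < \<eta>1" "u < \<eta>2" using \<eta>1(1) \<eta>2(1) by (auto simp: u_def)
  \<comment> \<open>The sign opposite to D - p makes the linear term negative, against the lower
    bound.\<close>
  define t where "t = (if D > p then - u else u)"
  have t: "t \<noteq> 0" "\<bar>t\<bar> < \<eta>1" "\<bar>t\<bar> < \<eta>2" using u by (auto simp: t_def)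
  have "(\<phi> t - t * p - \<phi> 0) - t * (D - p) = t * ((\<phi> t - t * p - \<phi> 0) / t - (D - p))"
    using t(1) by (simp add: field_simps)
  hence "\<bar>(\<phi> t - t * p - \<phi> 0) - t * (D - p)\<bar> = \<bar>t\<bar> * \<bar>(\<phi> t - t * p - \<phi> 0) / t - (D - p)\<bar>"
    by (simp only: abs_mult)
  also have "\<dots> < \<bar>t\<bar> * (\<bar>D - p\<bar> / 2)" using \<eta>2(2)[OF t(1,3)] t(1) by (intro mult_strict_left_mono) auto
  finally have "\<bar>(\<phi> t - t * p - \<phi> 0) - t * (D - p)\<bar> < \<bar>t\<bar> * (\<bar>D - p\<bar> / 2)" .
  hence 1: "(\<phi> t - t * p - \<phi> 0) < t * (D - p) + \<bar>t\<bar> * \<bar>D - p\<bar> / 2" by linarith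
  have "t * (D - p) = - (\<bar>t\<bar> * \<bar>D - p\<bar>)"
    using ne u by (auto simp: t_def abs_if algebra_simps)
  hence 2: "(\<phi> t - t * p - \<phi> 0) < - (\<bar>t\<bar> * \<bar>D - p\<bar> / 2)" using 1 by linarith
  have "e * (\<bar>t\<bar> * C) \<le> \<bar>t\<bar> * \<bar>D - p\<bar> / 2"
  proof -
    have "e * (\<bar>t\<bar> * C) \<le> e * (\<bar>t\<bar> * (C + 1))" using e by (intro mult_left_mono) auto
    also have "\<dots> = \<bar>t\<bar> * (e * (C + 1))" by (simp only: mult_ac)
    also have "e * (C + 1) = \<bar>D - p\<bar> / 2"
    proof -
      have "x / 2 / b * b = x / 2" if "b \<noteq> 0" for x b :: real using that by simp
      moreover have "C + 1 \<noteq> 0" using C by linarith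
      ultimately show ?thesis unfolding e_def by blast
    qed
    also have "\<bar>t\<bar> * (\<bar>D - p\<bar> / 2) = \<bar>t\<bar> * \<bar>D - p\<bar> / 2" by simp
    finally show ?thesis .
  qed
  thus False using 2 \<eta>1(2)[OF t(2)] by linarith
qed

lemma frechet_subdiff_directional:
  assumes g: "g \<in> frechet_subdiff m n d f z" and h: "h \<in> factors m n d"
    and z: "z \<in> factors m n d"
    and D: "((\<lambda>t. f (z + pair_scale t h)) has_real_derivative D) (at 0)"
  shows "D = pair_inner g h"
proof (rule derivative_eq_of_lower_bound[OF D pair_norm_nonneg])
  fix \<epsilon> :: real assume "\<epsilon> > 0"
  with g obtain \<eta> where \<eta>: "\<eta> > 0"
    "\<And>h. h \<in> factors m n d \<Longrightarrow> pair_norm h < \<eta> \<Longrightarrow> f (z + h) \<ge> f z + pair_inner g h - \<epsilon> * pair_norm h"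
    by (auto simp: frechet_subdiff_def)
  have gf: "g \<in> factors m n d" using g by (simp add: frechet_subdiff_def)
  have z0: "z + pair_scale 0 h = z"
    using z h by (auto simp: factors_def pair_scale_def prod_eq_iff intro!: eq_matI)
  have "\<eta> / (pair_norm h + 1) > 0" using \<eta>(1) pair_norm_nonneg[of h] by (intro divide_pos_pos) linarith+
  moreover have "f (z + pair_scale t h) \<ge> f (z + pair_scale 0 h) + t * pair_inner g h - \<epsilon> * (\<bar>t\<bar> * pair_norm h)"
    if "\<bar>t\<bar> < \<eta> / (pair_norm h + 1)" for t
    using \<eta>(2)[OF pair_scale_factors[OF h] pair_norm_scale_small[OF h \<eta>(1) that]]
    by (simp add: z0 pair_inner_scale_right[OF gf h] pair_norm_scale[OF h])
  ultimately show "\<exists>\<eta>>0. \<forall>t. \<bar>t\<bar> < \<eta> \<longrightarrow>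
     f (z + pair_scale t h) \<ge> f (z + pair_scale 0 h) + t * pair_inner g h - \<epsilon> * (\<bar>t\<bar> * pair_norm h)" by blast
qed

lemma has_gradient_directional:
  assumes g: "has_gradient m n d f z g" and h: "h \<in> factors m n d" and z: "z \<in> factors m n d"
  shows "((\<lambda>t. f (z + pair_scale t h)) has_real_derivative pair_inner g h) (at 0)"
  unfolding DERIV_def
proof (rule LIM_I)
  fix r :: real assume r: "r > 0"
  define \<epsilon> where "\<epsilon> = r / (pair_norm h + 1)"
  have p: "pair_norm h + 1 > 0" using pair_norm_nonneg[of h] by linarith
  have \<epsilon>: "\<epsilon> > 0" using r p by (simp add: \<epsilon>_def)
  obtain \<eta> where \<eta>: "\<eta> > 0"
    "\<And>h. h \<in> factors m n d \<Longrightarrow> pair_norm h < \<eta> \<Longrightarrow> \<bar>f (z + h) - f z - pair_inner g h\<bar> \<le> \<epsilon> * pair_norm h"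
    using g \<epsilon> by (auto simp: has_gradient_def)
  have gf: "g \<in> factors m n d" using g by (simp add: has_gradient_def)
  have z0: "z + pair_scale 0 h = z"
    using z h by (auto simp: factors_def pair_scale_def prod_eq_iff intro!: eq_matI)
  have "\<eta> / (pair_norm h + 1) > 0" using \<eta>(1) p by simp
  moreover have "norm ((f (z + pair_scale (0 + t) h) - f (z + pair_scale 0 h)) / t - pair_inner g h) < r"
    if t: "t \<noteq> 0" "\<bar>t\<bar> < \<eta> / (pair_norm h + 1)" for t
  proof -
    have "t * ((f (z + pair_scale t h) - f z) / t - pair_inner g h) = f (z + pair_scale t h) - f z - t * pair_inner g h"
      using t(1) by (simp add: field_simps)
    hence "\<bar>t\<bar> * \<bar>(f (z + pair_scale t h) - f z) / t - pair_inner g h\<bar> = \<bar>f (z + pair_scale t h) - f z - t * pair_inner g h\<bar>"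
      by (simp only: abs_mult[symmetric])
    also have "\<dots> \<le> \<epsilon> * (\<bar>t\<bar> * pair_norm h)"
      using \<eta>(2)[OF pair_scale_factors[OF h] pair_norm_scale_small[OF h \<eta>(1) t(2)]]
      by (simp add: pair_inner_scale_right[OF gf h] pair_norm_scale[OF h])
    also have "\<dots> < \<bar>t\<bar> * (\<epsilon> * (pair_norm h + 1))" using t(1) \<epsilon> by simp
    also have "\<epsilon> * (pair_norm h + 1) = r" using p by (simp add: \<epsilon>_def)
    finally have "\<bar>t\<bar> * \<bar>(f (z + pair_scale t h) - f z) / t - pair_inner g h\<bar> < \<bar>t\<bar> * r" .
    moreover have "\<bar>t\<bar> > 0" using t(1) by simp
    ultimately have "\<bar>(f (z + pair_scale t h) - f z) / t - pair_inner g h\<bar> < r"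
      using mult_less_cancel_left_pos by blast
    thus ?thesis by (simp add: z0)
  qed
  ultimately show "\<exists>s>0. \<forall>x. x \<noteq> 0 \<and> norm (x - 0) < s \<longrightarrow>
     norm ((f (z + pair_scale (0 + x) h) - f (z + pair_scale 0 h)) / x - pair_inner g h) < r"
    by (metis diff_zero real_norm_def)
qed

text \<open>No Hessian has to be computed. Near 0 the function \<psi> must be the pairing of the
  abstract gradient field with \<open>h\<close>, by uniqueness of derivatives, and the derivative of
  that pairing at 0 is the quadratic form of the Hessian at \<open>h\<close>.\<close>

lemma psd_hessian_directional:
  assumes psd: "psd_hessian m n d f z" and h: "h \<in> factors m n d" and z: "z \<in> factors m n d"
    and D1: "\<And>t. ((\<lambda>t. f (z + pair_scale t h)) has_real_derivative \<psi> t) (at t)"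
    and D2: "(\<psi> has_real_derivative D) (at 0)"
  shows "D \<ge> 0"
proof -
  obtain L G \<rho> where L: "pair_inner h (L h) \<ge> 0" "L h \<in> factors m n d"
      "\<And>a. L (pair_scale a h) = pair_scale a (L h)"
    and \<rho>: "\<rho> > 0" "\<And>h. h \<in> factors m n d \<Longrightarrow> pair_norm h < \<rho> \<Longrightarrow> has_gradient m n d f (z + h) (G (z + h))"
    and G: "\<And>\<epsilon>. \<epsilon> > 0 \<Longrightarrow> \<exists>\<eta>>0. \<forall>h\<in>factors m n d. pair_norm h < \<eta> \<longrightarrow>
             pair_norm (G (z + h) - G z - L h) \<le> \<epsilon> * pair_norm h"
    using psd h unfolding psd_hessian_def has_hessian_def by metis
  have p: "pair_norm h + 1 > 0" using pair_norm_nonneg[of h] by linarith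
  have z0: "z + pair_scale 0 h = z"
    using z h by (auto simp: factors_def pair_scale_def prod_eq_iff intro!: eq_matI)
  have grad: "has_gradient m n d f (z + pair_scale t h) (G (z + pair_scale t h))"
    if "\<bar>t\<bar> < \<rho> / (pair_norm h + 1)" for t
    using \<rho>(2)[OF pair_scale_factors[OF h] pair_norm_scale_small[OF h \<rho>(1) that]] .
  have zt: "z + pair_scale t h \<in> factors m n d" for t
    using z h by (auto simp: factors_def pair_scale_def)
  have \<psi>: "\<psi> t = pair_inner (G (z + pair_scale t h)) h" if t: "\<bar>t\<bar> < \<rho> / (pair_norm h + 1)" for t
  proof -
    have "((\<lambda>s. f (z + pair_scale t h + pair_scale s h)) has_real_derivative pair_inner (G (z + pair_scale t h)) h) (at 0)"
      by (rule has_gradient_directional[OF grad[OF t] h zt])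
    hence "((\<lambda>s. f (z + pair_scale (t + s) h)) has_real_derivative pair_inner (G (z + pair_scale t h)) h) (at 0)"
      by (simp add: pair_scale_add_line[OF h z])
    moreover have "((\<lambda>s. f (z + pair_scale (t + s) h)) has_real_derivative \<psi> t) (at 0)"
      using DERIV_shift[of "\<lambda>s. f (z + pair_scale s h)" "\<psi> t" 0 t] D1[of t] by (simp add: add.commute)
    ultimately show ?thesis using DERIV_unique by blast
  qed
  have Gf: "G (z + pair_scale t h) \<in> factors m n d" if "\<bar>t\<bar> < \<rho> / (pair_norm h + 1)" for t
    using grad[OF that] by (simp add: has_gradient_def)
  define C where "C = pair_norm h * pair_abs_sum m n d h"
  have \<rho>p: "\<rho> / (pair_norm h + 1) > 0" using \<rho>(1) p by simp
  have "D = pair_inner (L h) h"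
  proof (rule derivative_eq_of_lower_bound[OF D2, of C])
    show "C \<ge> 0" by (simp add: C_def)
    fix \<epsilon> :: real assume "\<epsilon> > 0"
    from G[OF this] obtain \<eta> where \<eta>: "\<eta> > 0"
      "\<And>h. h \<in> factors m n d \<Longrightarrow> pair_norm h < \<eta> \<Longrightarrow> pair_norm (G (z + h) - G z - L h) \<le> \<epsilon> * pair_norm h" by blast
    define \<eta>' where "\<eta>' = min (\<rho> / (pair_norm h + 1)) (\<eta> / (pair_norm h + 1))"
    have "\<eta>' > 0" using \<rho>p \<eta>(1) p by (simp add: \<eta>'_def)
    moreover have "\<psi> t \<ge> \<psi> 0 + t * pair_inner (L h) h - \<epsilon> * (\<bar>t\<bar> * C)" if t: "\<bar>t\<bar> < \<eta>'" for t
    proof -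
      have t1: "\<bar>t\<bar> < \<rho> / (pair_norm h + 1)" and t2: "\<bar>t\<bar> < \<eta> / (pair_norm h + 1)" using t by (auto simp: \<eta>'_def)
      define W where "W = G (z + pair_scale t h) - G z - L (pair_scale t h)"
      have f1: "G (z + pair_scale t h) \<in> factors m n d" "G z \<in> factors m n d" "pair_scale t (L h) \<in> factors m n d"
        using Gf[OF t1] Gf[of 0] \<rho>p L(2) by (auto simp: z0)
      hence Wf: "W \<in> factors m n d" by (auto simp: W_def L(3) intro: factors_minus)
      have "pair_inner W h = pair_inner (G (z + pair_scale t h)) h - pair_inner (G z) h - pair_inner (pair_scale t (L h)) h"
        using f1 unfolding W_def L(3) by (simp add: pair_inner_minus_left[of _ m n d] factors_minus)
      hence "pair_inner W h = \<psi> t - \<psi> 0 - t * pair_inner (L h) h"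
        using \<psi>[OF t1] \<psi>[of 0] \<rho>p by (simp add: z0 pair_inner_scale_left)
      moreover have "\<bar>pair_inner W h\<bar> \<le> pair_norm W * pair_abs_sum m n d h"
        by (rule abs_pair_inner_le[OF Wf])
      moreover have "pair_norm W \<le> \<epsilon> * (\<bar>t\<bar> * pair_norm h)"
        using \<eta>(2)[OF pair_scale_factors[OF h] pair_norm_scale_small[OF h \<eta>(1) t2]]
        by (simp add: W_def pair_norm_scale[OF h])
      hence "pair_norm W * pair_abs_sum m n d h \<le> \<epsilon> * (\<bar>t\<bar> * pair_norm h) * pair_abs_sum m n d h"
        by (intro mult_right_mono) auto
      ultimately show ?thesis by (simp add: C_def mult.assoc)
    qed
    ultimately show "\<exists>\<eta>>0. \<forall>t. \<bar>t\<bar> < \<eta> \<longrightarrow> \<psi> t \<ge> \<psi> 0 + t * pair_inner (L h) h - \<epsilon> * (\<bar>t\<bar> * C)" by blast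
  qed
  moreover have "pair_inner (L h) h = pair_inner h (L h)"
    using L(2) h frob_inner_commute[of "fst (L h)" m d "fst h"] frob_inner_commute[of "snd (L h)" n d "snd h"]
    by (auto simp: pair_inner_def factors_def)
  ultimately show ?thesis using L(1) by simp
qed

section \<open>Passage to the limit in the first-order condition\<close>

lemma index_mult_transpose:
  assumes "X \<in> carrier_mat m d" "Y \<in> carrier_mat n d" "a < m" "b < n"
  shows "(X * Y\<^sup>T) $$ (a, b) = (\<Sum>j<d. X $$ (a, j) * Y $$ (b, j))"
  using index_mult_mat_sum[of X m d "Y\<^sup>T" n a b] assms by simp

text \<open>Entrywise convergence with the dimensions bundled in reduces limits of matrix
  expressions to limits of finite sums.\<close>

definition mat_tendsto :: "nat \<Rightarrow> nat \<Rightarrow> (nat \<Rightarrow> real mat) \<Rightarrow> real mat \<Rightarrow> bool" where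
  "mat_tendsto m n Zs Z \<longleftrightarrow> (\<forall>k. Zs k \<in> carrier_mat m n) \<and> Z \<in> carrier_mat m n \<and>
     (\<forall>a<m. \<forall>j<n. (\<lambda>k. Zs k $$ (a, j)) \<longlonglongrightarrow> Z $$ (a, j))"

lemma mat_tendstoD:
  assumes "mat_tendsto m n Zs Z"
  shows "Zs k \<in> carrier_mat m n" "Z \<in> carrier_mat m n"
    "a < m \<Longrightarrow> j < n \<Longrightarrow> (\<lambda>k. Zs k $$ (a, j)) \<longlonglongrightarrow> Z $$ (a, j)"
  using assms by (auto simp: mat_tendsto_def)

lemma mat_tendsto_const: "Z \<in> carrier_mat m n \<Longrightarrow> mat_tendsto m n (\<lambda>_. Z) Z"
  by (auto simp: mat_tendsto_def)

lemma mat_tendsto_add: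
  assumes "mat_tendsto m n Xs X" "mat_tendsto m n Ys Y"
  shows "mat_tendsto m n (\<lambda>k. Xs k + Ys k) (X + Y)"
  unfolding mat_tendsto_def
proof (intro conjI allI impI)
  fix a j assume aj: "a < m" "j < n"
  have "(V + W) $$ (a, j) = V $$ (a, j) + W $$ (a, j)" if "W \<in> carrier_mat m n" for V W :: "real mat"
    using that aj by simp
  thus "(\<lambda>k. (Xs k + Ys k) $$ (a, j)) \<longlonglongrightarrow> (X + Y) $$ (a, j)"
    using tendsto_add[OF mat_tendstoD(3)[OF assms(1) aj] mat_tendstoD(3)[OF assms(2) aj]]
    by (simp only: mat_tendstoD(1,2)[OF assms(2)])
qed (use mat_tendstoD(1,2)[OF assms(2)] in auto)

lemma mat_tendsto_mult_transpose:
  assumes "mat_tendsto m d Xs X" "mat_tendsto n d Ys Y"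
  shows "mat_tendsto m n (\<lambda>k. Xs k * (Ys k)\<^sup>T) (X * Y\<^sup>T)"
  unfolding mat_tendsto_def
proof (intro conjI allI impI)
  note D = mat_tendstoD[OF assms(1)] mat_tendstoD[OF assms(2)]
  show "Xs k * (Ys k)\<^sup>T \<in> carrier_mat m n" for k
    using D(1)[of k] D(4)[of k] by simp
  show "X * Y\<^sup>T \<in> carrier_mat m n" using D(2,5) by simp
  fix a j assume aj: "a < m" "j < n"
  show "(\<lambda>k. (Xs k * (Ys k)\<^sup>T) $$ (a, j)) \<longlonglongrightarrow> (X * Y\<^sup>T) $$ (a, j)"
    unfolding index_mult_transpose[OF D(1,4) aj] index_mult_transpose[OF D(2,5) aj]
    by (intro tendsto_sum tendsto_mult D(3,6)) (use aj in auto)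
qed

lemma pair_norm_tendsto:
  assumes zf: "\<And>k::nat. zs k \<in> factors m n d" and z: "z \<in> factors m n d"
    and zc: "(\<lambda>k. pair_norm (zs k - z)) \<longlonglongrightarrow> 0"
  shows "mat_tendsto m d (\<lambda>k. fst (zs k)) (fst z)" "mat_tendsto n d (\<lambda>k. snd (zs k)) (snd z)"
proof -
  have c: "fst (zs k) \<in> carrier_mat m d" "snd (zs k) \<in> carrier_mat n d"
    "fst z \<in> carrier_mat m d" "snd z \<in> carrier_mat n d" for k
    using zf[of k] z by (auto simp: factors_def)
  note le = entry_le_pair_norm[OF factors_minus[OF zf z]]
  have "(\<lambda>k. fst (zs k) $$ (a, j) - fst z $$ (a, j)) \<longlonglongrightarrow> 0" if "a < m" "j < d" for a j
    by (rule Lim_null_comparison[OF always_eventually zc]) (use le(1)[OF that] c that in simp)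
  moreover have "(\<lambda>k. snd (zs k) $$ (a, j) - snd z $$ (a, j)) \<longlonglongrightarrow> 0" if "a < n" "j < d" for a j
    by (rule Lim_null_comparison[OF always_eventually zc]) (use le(2)[OF that] c that in simp)
  ultimately show "mat_tendsto m d (\<lambda>k. fst (zs k)) (fst z)" "mat_tendsto n d (\<lambda>k. snd (zs k)) (snd z)"
    using c by (auto simp: mat_tendsto_def LIM_zero_iff)
qed

lemma meas_tendsto:
  assumes "A i \<in> carrier_mat m n" "mat_tendsto m n Zs Z"
  shows "(\<lambda>k. meas A (Zs k) i) \<longlonglongrightarrow> meas A Z i"
  unfolding meas_def frob_inner_carrier[OF assms(1)]
  by (intro tendsto_sum tendsto_mult tendsto_const mat_tendstoD(3)[OF assms(2)]) auto

lemma col_ip_tendsto: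
  assumes "mat_tendsto m d Zs Z" "mat_tendsto m d Ws W" "j < d"
  shows "(\<lambda>k. col_ip (Zs k) (Ws k) j) \<longlonglongrightarrow> col_ip Z W j"
proof -
  have "dim_row (Zs k) = m" "dim_row Z = m" for k
    using mat_tendstoD(1)[OF assms(1), of k] mat_tendstoD(2)[OF assms(1)] by auto
  thus ?thesis unfolding col_ip_def
    by (simp only:) (intro tendsto_sum tendsto_mult mat_tendstoD(3)[OF assms(1)] mat_tendstoD(3)[OF assms(2)],
      use assms(3) in auto)
qed

text \<open>A negative power of the column norm may blow up when the limit column is 0, but then the
  column of \<open>H\<close> vanishes and every term is 0.\<close>

lemma regularizer_derivative_tendsto:
  assumes Z: "mat_tendsto m d Zs Z" and H: "H \<in> carrier_mat m d" and j: "j < d"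
    and z: "col_ip Z Z j = 0 \<Longrightarrow> col_ip H H j = 0"
  shows "(\<lambda>k. col_ip (Zs k) (Zs k) j powr p * col_ip (Zs k) H j) \<longlonglongrightarrow> col_ip Z Z j powr p * col_ip Z H j"
proof (cases "col_ip Z Z j = 0")
  case True
  have "H $$ (a, j) = 0" if "a < m" for a using col_ip_zero_imp[OF z[OF True]] that H by simp
  hence "col_ip V H j = 0" if "V \<in> carrier_mat m d" for V
    unfolding col_ip_def using that by (intro sum.neutral) auto
  thus ?thesis using mat_tendstoD(1,2)[OF Z] by simp
next
  case False
  show ?thesis
    by (intro tendsto_mult tendsto_powr col_ip_tendsto[OF Z Z j]
      col_ip_tendsto[OF Z mat_tendsto_const[OF H] j] tendsto_const False)
qed

text \<open>Columns that are nonzero in the limit are eventually nonzero, so a direction admissible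
  at the limit is eventually admissible along the sequence.\<close>

lemma eventually_zero_columns:
  assumes Z: "mat_tendsto m d Zs Z" and z: "\<And>j. j < d \<Longrightarrow> col_ip Z Z j = 0 \<Longrightarrow> col_ip H H j = 0"
  shows "eventually (\<lambda>k. \<forall>j\<in>{..<d}. col_ip (Zs k) (Zs k) j = 0 \<longrightarrow> col_ip H H j = 0) sequentially"
proof (intro eventually_ball_finite ballI)
  fix j assume "j \<in> {..<d}"
  hence j: "j < d" by simp
  show "eventually (\<lambda>k. col_ip (Zs k) (Zs k) j = 0 \<longrightarrow> col_ip H H j = 0) sequentially"
  proof (cases "col_ip Z Z j = 0")
    case True thus ?thesis using z[OF j] by simp
  next
    case False
    hence "0 < col_ip Z Z j" using col_ip_self_nonneg[of Z j] by linarith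
    from order_tendstoD(1)[OF col_ip_tendsto[OF Z Z j] this] show ?thesis by eventually_elim simp
  qed
qed simp

lemma dPhi_tendsto:
  assumes A: "\<And>i. i < l \<Longrightarrow> A i \<in> carrier_mat m n"
    and U: "mat_tendsto m d Us U" and V: "mat_tendsto n d Vs V"
    and H: "H \<in> carrier_mat m d" and K: "K \<in> carrier_mat n d"
    and zU: "\<And>j. j < d \<Longrightarrow> col_ip U U j = 0 \<Longrightarrow> col_ip H H j = 0"
    and zV: "\<And>j. j < d \<Longrightarrow> col_ip V V j = 0 \<Longrightarrow> col_ip K K j = 0"
  shows "(\<lambda>k. dPhi l d A y q lam (Us k) (Vs k) H K) \<longlonglongrightarrow> dPhi l d A y q lam U V H K"
proof -
  have X: "mat_tendsto m n (\<lambda>k. Us k * (Vs k)\<^sup>T) (U * V\<^sup>T)"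
    by (rule mat_tendsto_mult_transpose[OF U V])
  have Y: "mat_tendsto m n (\<lambda>k. H * (Vs k)\<^sup>T + Us k * K\<^sup>T) (H * V\<^sup>T + U * K\<^sup>T)"
    by (rule mat_tendsto_add[OF mat_tendsto_mult_transpose[OF mat_tendsto_const[OF H] V]
      mat_tendsto_mult_transpose[OF U mat_tendsto_const[OF K]]])
  have 1: "(\<lambda>k. \<Sum>i<l. 2 * (meas A (Us k * (Vs k)\<^sup>T) i - y i) * meas A (H * (Vs k)\<^sup>T + Us k * K\<^sup>T) i)
      \<longlonglongrightarrow> (\<Sum>i<l. 2 * (meas A (U * V\<^sup>T) i - y i) * meas A (H * V\<^sup>T + U * K\<^sup>T) i)"
    by (intro tendsto_sum tendsto_mult tendsto_diff tendsto_const meas_tendsto[OF A X] meas_tendsto[OF A Y]) auto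
  have 2: "(\<lambda>k. \<Sum>j<d. col_ip (Us k) (Us k) j powr (q / 2 - 1) * col_ip (Us k) H j)
      \<longlonglongrightarrow> (\<Sum>j<d. col_ip U U j powr (q / 2 - 1) * col_ip U H j)"
    by (rule tendsto_sum, rule regularizer_derivative_tendsto[OF U H]) (auto intro: zU)
  have 3: "(\<lambda>k. \<Sum>j<d. col_ip (Vs k) (Vs k) j powr (q / 2 - 1) * col_ip (Vs k) K j)
      \<longlonglongrightarrow> (\<Sum>j<d. col_ip V V j powr (q / 2 - 1) * col_ip V K j)"
    by (rule tendsto_sum, rule regularizer_derivative_tendsto[OF V K]) (auto intro: zV)
  show ?thesis
    unfolding dPhi_def residual_def
    by (rule tendsto_add[OF 1 tendsto_mult[OF tendsto_const tendsto_add[OF 2 3]]])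
qed

text \<open>
  A direction that leaves the zero columns of \<open>U\<close> and \<open>V\<close> fixed is one along which the objective
  is differentiable at all nearby points, so the limiting subdifferential gives an equation.
\<close>

lemma critical_point_dPhi:
  assumes A: "\<And>i. i < l \<Longrightarrow> A i \<in> carrier_mat m n" and q: "q > 0"
    and crit: "critical_point m n d (Phi l A y q lam) (U, V)"
    and H: "H \<in> carrier_mat m d" and K: "K \<in> carrier_mat n d"
    and zU: "\<And>j. j < d \<Longrightarrow> col_ip U U j = 0 \<Longrightarrow> col_ip H H j = 0"
    and zV: "\<And>j. j < d \<Longrightarrow> col_ip V V j = 0 \<Longrightarrow> col_ip K K j = 0"
  shows "dPhi l d A y q lam U V H K = 0"
proof -
  let ?f = "Phi l A y q lam"
  have UV: "(U, V) \<in> factors m n d" and lim: "(0\<^sub>m m d, 0\<^sub>m n d) \<in> limiting_subdiff m n d ?f (U, V)"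
    using crit by (auto simp: critical_point_def)
  have U: "U \<in> carrier_mat m d" and V: "V \<in> carrier_mat n d" using UV by (auto simp: factors_def)
  obtain zs gs where zf: "\<And>k::nat. zs k \<in> factors m n d" and gs: "\<And>k. gs k \<in> frechet_subdiff m n d ?f (zs k)"
    and zc: "(\<lambda>k. pair_norm (zs k - (U, V))) \<longlonglongrightarrow> 0" and gc: "(\<lambda>k. pair_norm (gs k - (0\<^sub>m m d, 0\<^sub>m n d))) \<longlonglongrightarrow> 0"
    using lim unfolding limiting_subdiff_def by blast
  have Us: "fst (zs k) \<in> carrier_mat m d" and Vs: "snd (zs k) \<in> carrier_mat n d" for k
    using zf[of k] by (auto simp: factors_def)
  have tU: "mat_tendsto m d (\<lambda>k. fst (zs k)) U" and tV: "mat_tendsto n d (\<lambda>k. snd (zs k)) V"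
    using pair_norm_tendsto[OF zf UV zc] by auto
  have HK: "(H, K) \<in> factors m n d" using H K by (rule factorsI)
  have T1: "(\<lambda>k. dPhi l d A y q lam (fst (zs k)) (snd (zs k)) H K) \<longlonglongrightarrow> dPhi l d A y q lam U V H K"
    by (rule dPhi_tendsto[OF _ tU tV H K zU zV]) (rule A)
  have ev1: "eventually (\<lambda>k. \<forall>j\<in>{..<d}. col_ip (fst (zs k)) (fst (zs k)) j = 0 \<longrightarrow> col_ip H H j = 0) sequentially"
    by (rule eventually_zero_columns[OF tU zU])
  have ev2: "eventually (\<lambda>k. \<forall>j\<in>{..<d}. col_ip (snd (zs k)) (snd (zs k)) j = 0 \<longrightarrow> col_ip K K j = 0) sequentially"
    by (rule eventually_zero_columns[OF tV zV])
  \<comment> \<open>Both sides have known limits: the left tends to 0 with the subgradients, the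
    right to \<open>dPhi\<close> at \<open>(U, V)\<close>.\<close>
  have "eventually (\<lambda>k. pair_inner (gs k) (H, K) = dPhi l d A y q lam (fst (zs k)) (snd (zs k)) H K) sequentially"
    using ev1 ev2
  proof eventually_elim
    case (elim k)
    have D: "((\<lambda>t. ?f ((fst (zs k), snd (zs k)) + pair_scale t (H, K))) has_real_derivative
         dPhi l d A y q lam (fst (zs k)) (snd (zs k)) H K) (at 0)"
      by (rule Phi_directional_derivative[OF A q Us H Vs K]) (use elim in auto)
    hence "((\<lambda>t. ?f (zs k + pair_scale t (H, K))) has_real_derivative
         dPhi l d A y q lam (fst (zs k)) (snd (zs k)) H K) (at 0)" by simp
    from frechet_subdiff_directional[OF gs HK zf this] show ?case by simp
  qed
  with T1 have "(\<lambda>k. pair_inner (gs k) (H, K)) \<longlonglongrightarrow> dPhi l d A y q lam U V H K"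
    by (rule Lim_transform_eventually[OF _ eventually_mono]) simp
  moreover have "(\<lambda>k. pair_inner (gs k) (H, K)) \<longlonglongrightarrow> 0"
  proof (rule Lim_null_comparison)
    show "eventually (\<lambda>k. norm (pair_inner (gs k) (H, K)) \<le> pair_norm (gs k - (0\<^sub>m m d, 0\<^sub>m n d)) * pair_abs_sum m n d (H, K)) sequentially"
    proof (rule always_eventually, rule allI)
      fix k
      have gf: "gs k \<in> factors m n d" using gs[of k] by (simp add: frechet_subdiff_def)
      have zf: "(0\<^sub>m m d, 0\<^sub>m n d) \<in> factors m n d" by (simp add: factors_def)
      have "pair_inner (gs k) (H, K) = pair_inner (gs k - (0\<^sub>m m d, 0\<^sub>m n d)) (H, K)"
        unfolding pair_inner_minus_left[OF gf zf] by (simp add: pair_inner_def)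
      thus "norm (pair_inner (gs k) (H, K)) \<le> pair_norm (gs k - (0\<^sub>m m d, 0\<^sub>m n d)) * pair_abs_sum m n d (H, K)"
        using abs_pair_inner_le[OF factors_minus[OF gf zf], of "(H, K)"] by simp
    qed
    show "(\<lambda>k. pair_norm (gs k - (0\<^sub>m m d, 0\<^sub>m n d)) * pair_abs_sum m n d (H, K)) \<longlonglongrightarrow> 0"
      using tendsto_mult_right[OF gc, of "pair_abs_sum m n d (H, K)"] by simp
  qed
  ultimately show ?thesis using LIMSEQ_unique by blast
qed

text \<open>Testing with matrix units gives one equation per entry. A unit in column
  \<open>i\<close> is an admissible direction because that column is nonzero, and the other factor
  is left unchanged.\<close>

lemma critical_point_columns:
  assumes A: "\<And>i. i < l \<Longrightarrow> A i \<in> carrier_mat m n" and q: "q > 0"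
    and crit: "critical_point m n d (Phi l A y q lam) (U, V)"
  defines "G \<equiv> loss_gradient m n l A y (U * V\<^sup>T)"
  shows "\<And>a i. a < m \<Longrightarrow> i < d \<Longrightarrow> col_ip U U i \<noteq> 0 \<Longrightarrow>
      (G * V) $$ (a, i) = - lam * (col_ip U U i powr (q / 2 - 1)) * U $$ (a, i)"
    and "\<And>b i. b < n \<Longrightarrow> i < d \<Longrightarrow> col_ip V V i \<noteq> 0 \<Longrightarrow>
      (G\<^sup>T * U) $$ (b, i) = - lam * (col_ip V V i powr (q / 2 - 1)) * V $$ (b, i)"
proof -
  have U: "U \<in> carrier_mat m d" and V: "V \<in> carrier_mat n d"
    using crit by (auto simp: critical_point_def factors_def)
  have G: "G \<in> carrier_mat m n" by (simp add: G_def)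
  have dims: "dim_row U = m" "dim_col U = d" "dim_row V = n" "dim_col V = d" "dim_row G = m" "dim_col G = n"
    using U V G by auto
  have dPhi: "dPhi l d A y q lam U V H K = frob_inner G (H * V\<^sup>T + U * K\<^sup>T)
     + lam * ((\<Sum>j<d. col_ip U U j powr (q / 2 - 1) * col_ip U H j)
        + (\<Sum>j<d. col_ip V V j powr (q / 2 - 1) * col_ip V K j))" for H K
    unfolding dPhi_def G_def by (subst frob_loss_gradient) (auto intro: A)
  define E where "E r a i = Matrix.mat r d (\<lambda>(k, j). if k = a \<and> j = i then 1 else 0 :: real)" for r a i
  have E: "E r a i \<in> carrier_mat r d" for r a i by (simp add: E_def)
  have EE: "col_ip (E r a i) (E r a i) j = 0" if "j < d" "j \<noteq> i" for r a i j
    using that unfolding col_ip_def E_def by (intro sum.neutral) auto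
  have FE: "frob_inner M (E r a i) = M $$ (a, i)" if "M \<in> carrier_mat r d" "a < r" "i < d" for M r a i
  proof -
    have "frob_inner M (E r a i) = (\<Sum>k<r. \<Sum>j<d. if j = i then (if k = a then M $$ (a, i) else 0) else 0)"
      unfolding frob_inner_carrier[OF that(1)] by (intro sum.cong refl) (auto simp: E_def)
    also have "\<dots> = (\<Sum>k<r. if k = a then M $$ (a, i) else 0)" using that by simp
    finally show ?thesis using that by simp
  qed
  have IE: "(\<Sum>j<d. c j * col_ip M (E r a i) j) = c i * M $$ (a, i)" if "M \<in> carrier_mat r d" "a < r" "i < d" for M r a i and c :: "nat \<Rightarrow> real"
  proof -
    have "col_ip M (E r a i) j = (if j = i then M $$ (a, i) else 0)" if "j < d" for j
    proof -
      have "col_ip M (E r a i) j = (\<Sum>k<r. if k = a then (if j = i then M $$ (a, i) else 0) else 0)"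
        unfolding col_ip_def using \<open>M \<in> carrier_mat r d\<close> that by (intro sum.cong) (auto simp: E_def)
      thus ?thesis using \<open>a < r\<close> by simp
    qed
    hence "(\<Sum>j<d. c j * col_ip M (E r a i) j) = (\<Sum>j<d. if j = i then c i * M $$ (a, i) else 0)"
      by (intro sum.cong) auto
    thus ?thesis using that by simp
  qed
  have col0: "(\<Sum>j<d. c j * col_ip M (0\<^sub>m r d) j) = 0" if "M \<in> carrier_mat r d" for M r and c :: "nat \<Rightarrow> real"
    unfolding col_ip_def using that by (auto intro!: sum.neutral)
  have col00: "col_ip (0\<^sub>m r d) (0\<^sub>m r d) j = 0" if "j < d" for r j
    unfolding col_ip_def using that by (auto intro!: sum.neutral)
  fix a i
  show "(G * V) $$ (a, i) = - lam * (col_ip U U i powr (q / 2 - 1)) * U $$ (a, i)"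
    if ai: "a < m" "i < d" and nz: "col_ip U U i \<noteq> 0"
  proof -
    have "dPhi l d A y q lam U V (E m a i) (0\<^sub>m n d) = 0"
    proof (rule critical_point_dPhi[OF A q crit E zero_carrier_mat])
      fix j assume j: "j < d" "col_ip U U j = 0"
      thus "col_ip (E m a i) (E m a i) j = 0" using nz by (intro EE) auto
    qed (use col00 in auto)
    moreover have "frob_inner G (E m a i * V\<^sup>T + U * (0\<^sub>m n d)\<^sup>T) = (G * V) $$ (a, i)"
    proof -
      have "E m a i * V\<^sup>T + U * (0\<^sub>m n d)\<^sup>T = E m a i * V\<^sup>T"
        using U V E[of m a i] by (simp add: zero_transpose_mat right_mult_zero_mat[of U m d n] right_add_zero_mat[of _ m n])
      hence "frob_inner G (E m a i * V\<^sup>T + U * (0\<^sub>m n d)\<^sup>T) = frob_inner (G * V) (E m a i)"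
        using G V E[of m a i] frob_inner_mult_right'[of "E m a i" m d "V\<^sup>T" n G] by simp
      also have "\<dots> = (G * V) $$ (a, i)" using G V ai by (intro FE[of _ m]) auto
      finally show ?thesis .
    qed
    ultimately show ?thesis
      unfolding dPhi IE[OF U ai] col0[OF V] by (simp add: algebra_simps del: index_mult_mat(1))
  qed
  show "(G\<^sup>T * U) $$ (a, i) = - lam * (col_ip V V i powr (q / 2 - 1)) * V $$ (a, i)"
    if ai: "a < n" "i < d" and nz: "col_ip V V i \<noteq> 0"
  proof -
    have "dPhi l d A y q lam U V (0\<^sub>m m d) (E n a i) = 0"
    proof (rule critical_point_dPhi[OF A q crit zero_carrier_mat E])
      fix j assume j: "j < d" "col_ip V V j = 0"
      thus "col_ip (E n a i) (E n a i) j = 0" using nz by (intro EE) auto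
    qed (use col00 in auto)
    moreover have "frob_inner G (0\<^sub>m m d * V\<^sup>T + U * (E n a i)\<^sup>T) = (G\<^sup>T * U) $$ (a, i)"
    proof -
      have "0\<^sub>m m d * V\<^sup>T + U * (E n a i)\<^sup>T = U * (E n a i)\<^sup>T"
        using U V E[of n a i] by (simp add: left_mult_zero_mat[of _ d n] left_add_zero_mat[of _ m n])
      hence "frob_inner G (0\<^sub>m m d * V\<^sup>T + U * (E n a i)\<^sup>T) = frob_inner (U\<^sup>T * G) ((E n a i)\<^sup>T)"
        using G U E[of n a i] frob_inner_mult_right[of U m d "(E n a i)\<^sup>T" n G] by simp
      also have "\<dots> = frob_inner (G\<^sup>T * U) (E n a i)"
        using G U E[of n a i] frob_inner_transpose[of "G\<^sup>T * U" n d "E n a i"] dims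
        by (simp add: mat_simps)
      also have "\<dots> = (G\<^sup>T * U) $$ (a, i)" using G U ai by (intro FE[of _ n]) auto
      finally show ?thesis .
    qed
    ultimately show ?thesis
      unfolding dPhi IE[OF V ai] col0[OF U] by (simp add: algebra_simps del: index_mult_mat(1))
  qed
qed

section \<open>The second-order condition in columnwise orthogonal directions\<close>

lemma has_derivative_powr_square:
  assumes "s > 0" "a \<ge> 0"
  shows "((\<lambda>t. (s + 2 * t * 0 + t\<^sup>2 * a) powr p) has_real_derivative p * ((s + t\<^sup>2 * a) powr (p - 1) * (2 * t * a))) (at t)"
    and "((\<lambda>t. p * ((s + t\<^sup>2 * a) powr (p - 1) * (2 * t * a))) has_real_derivative 2 * p * (s powr (p - 1) * a)) (at 0)"
proof -
  have pos: "s + t\<^sup>2 * a > 0" for t using assms by (intro add_pos_nonneg) auto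
  have "((\<lambda>t. s + t\<^sup>2 * a) has_real_derivative 2 * t * a) (at t)"
    by (auto intro!: derivative_eq_intros)
  from DERIV_chain2[OF has_real_derivative_powr[OF pos] this]
  show "((\<lambda>t. (s + 2 * t * 0 + t\<^sup>2 * a) powr p) has_real_derivative p * ((s + t\<^sup>2 * a) powr (p - 1) * (2 * t * a))) (at t)"
    by (simp add: mult.assoc)
  \<comment> \<open>Without a linear term the base is stationary at 0, so the second derivative
    loses its summand with factor p - 1.\<close>
  have "((\<lambda>t. (s + t\<^sup>2 * a) powr (p - 1)) has_real_derivative 0) (at 0)"
    using has_derivative_powr_quadratic[of s 0 a "p - 1"] assms by simp
  moreover have "((\<lambda>t. 2 * t * a) has_real_derivative 2 * a) (at 0)"
    by (auto intro!: derivative_eq_intros)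
  ultimately have "((\<lambda>t. (s + t\<^sup>2 * a) powr (p - 1) * (2 * t * a)) has_real_derivative
      0 * (2 * 0 * a) + 2 * a * (s + 0\<^sup>2 * a) powr (p - 1)) (at 0)"
    by (rule DERIV_mult)
  from DERIV_cmult[OF this, of p]
  show "((\<lambda>t. p * ((s + t\<^sup>2 * a) powr (p - 1) * (2 * t * a))) has_real_derivative 2 * p * (s powr (p - 1) * a)) (at 0)"
    by (simp add: mult_ac)
qed

text \<open>Along the line the product has linear coefficient
  \<open>H * V\<^sup>T + U * K\<^sup>T\<close>, which enters through its measured square, and
  quadratic coefficient \<open>H * K\<^sup>T\<close>, which is paired with the gradient.
  Orthogonality to the columns leaves only the squared column norms of \<open>H\<close> and
  \<open>K\<close> in the regularizer.\<close>

lemma psd_hessian_inequality: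
  assumes A: "\<And>i. i < l \<Longrightarrow> A i \<in> carrier_mat m n" and q: "q > 0"
    and psd: "psd_hessian m n d (Phi l A y q lam) (U, V)"
    and U: "U \<in> carrier_mat m d" and V: "V \<in> carrier_mat n d"
    and H: "H \<in> carrier_mat m d" and K: "K \<in> carrier_mat n d"
    and posU: "\<And>j. j < d \<Longrightarrow> col_ip U U j > 0" and posV: "\<And>j. j < d \<Longrightarrow> col_ip V V j > 0"
    and UH: "\<And>j. j < d \<Longrightarrow> col_ip U H j = 0" and VK: "\<And>j. j < d \<Longrightarrow> col_ip V K j = 0"
  shows "0 \<le> 2 * (\<Sum>i<l. (meas A (H * V\<^sup>T + U * K\<^sup>T) i)\<^sup>2)
     + 2 * frob_inner (loss_gradient m n l A y (U * V\<^sup>T)) (H * K\<^sup>T)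
     + lam * ((\<Sum>j<d. col_ip U U j powr (q / 2 - 1) * col_ip H H j) + (\<Sum>j<d. col_ip V V j powr (q / 2 - 1) * col_ip K K j))"
proof -
  define c k e where "c i = residual A y (U * V\<^sup>T) i"
    and "k i = meas A (H * V\<^sup>T + U * K\<^sup>T) i"
    and "e i = meas A (H * K\<^sup>T) i" for i
  have A': "\<forall>i<l. A i \<in> carrier_mat m n" using A by blast
  define F where "F s a t = (q / 2) * ((s + t\<^sup>2 * a) powr (q / 2 - 1) * (2 * t * a))" for s a t :: real
  define \<psi> where "\<psi> t = (\<Sum>i<l. 2 * (c i + t * k i + t\<^sup>2 * e i) * (k i + 2 * t * e i))
     + lam / q * ((\<Sum>j<d. F (col_ip U U j) (col_ip H H j) t) + (\<Sum>j<d. F (col_ip V V j) (col_ip K K j) t))" for t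
  have line: "Phi l A y q lam ((U, V) + pair_scale t (H, K)) =
     (\<Sum>i<l. (c i + t * k i + t\<^sup>2 * e i)\<^sup>2)
     + lam / q * ((\<Sum>j<d. (col_ip U U j + 2 * t * 0 + t\<^sup>2 * col_ip H H j) powr (q / 2))
        + (\<Sum>j<d. (col_ip V V j + 2 * t * 0 + t\<^sup>2 * col_ip K K j) powr (q / 2)))" for t
    using Phi_line[OF A' q U H V K, of y lam t] UH VK unfolding c_def k_def e_def col_line_def by simp
  have p: "((\<lambda>t. \<Sum>i<l. (c i + t * k i + t\<^sup>2 * e i)\<^sup>2) has_real_derivative
      (\<Sum>i<l. 2 * (c i + t * k i + t\<^sup>2 * e i) * (k i + 2 * t * e i))) (at t)" for t
    by (rule DERIV_sum) (auto intro!: derivative_eq_intros)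
  have D1: "((\<lambda>t. Phi l A y q lam ((U, V) + pair_scale t (H, K))) has_real_derivative \<psi> t) (at t)" for t
    unfolding line \<psi>_def F_def
    by (intro DERIV_add DERIV_cmult DERIV_sum p has_derivative_powr_square(1)) (use posU posV in auto)
  have pp: "((\<lambda>t. \<Sum>i<l. 2 * (c i + t * k i + t\<^sup>2 * e i) * (k i + 2 * t * e i)) has_real_derivative
      (\<Sum>i<l. 2 * (k i)\<^sup>2 + 4 * c i * e i)) (at 0)"
    by (rule DERIV_sum) (auto intro!: derivative_eq_intros simp: power2_eq_square algebra_simps)
  have D2: "(\<psi> has_real_derivative (\<Sum>i<l. 2 * (k i)\<^sup>2 + 4 * c i * e i)
     + lam / q * ((\<Sum>j<d. 2 * (q / 2) * (col_ip U U j powr (q / 2 - 1) * col_ip H H j))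
         + (\<Sum>j<d. 2 * (q / 2) * (col_ip V V j powr (q / 2 - 1) * col_ip K K j)))) (at 0)"
    unfolding \<psi>_def[abs_def] F_def
    by (intro DERIV_add DERIV_cmult DERIV_sum pp has_derivative_powr_square(2)) (use posU posV in auto)
  have "(\<Sum>i<l. 2 * (k i)\<^sup>2 + 4 * c i * e i)
     + lam / q * ((\<Sum>j<d. 2 * (q / 2) * (col_ip U U j powr (q / 2 - 1) * col_ip H H j))
         + (\<Sum>j<d. 2 * (q / 2) * (col_ip V V j powr (q / 2 - 1) * col_ip K K j))) \<ge> 0"
    by (rule psd_hessian_directional[OF psd factorsI[OF H K] factorsI[OF U V] D1 D2])
  moreover have "(\<Sum>j<d. 2 * (q / 2) * (x j * z j)) = q * (\<Sum>j<d. x j * z j)" for x z :: "nat \<Rightarrow> real"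
    by (simp add: sum_distrib_left)
  moreover have "lam / q * (q * x + q * z) = lam * (x + z)" for x z using q by (simp add: field_simps)
  moreover have "(\<Sum>i<l. 2 * (k i)\<^sup>2 + 4 * c i * e i) = 2 * (\<Sum>i<l. (k i)\<^sup>2) + 2 * (\<Sum>i<l. 2 * c i * e i)"
    by (simp add: sum.distrib sum_distrib_left mult_ac)
  moreover have "(\<Sum>i<l. 2 * c i * e i) = frob_inner (loss_gradient m n l A y (U * V\<^sup>T)) (H * K\<^sup>T)"
    unfolding c_def e_def by (rule frob_loss_gradient[symmetric]) (rule A)
  ultimately show ?thesis unfolding k_def by simp
qed

section \<open>Orthogonality at S-critical points\<close>

lemma powr_inj_pos:
  assumes "(a :: real) > 0" "b > 0" "p \<noteq> 0" "a powr p = b powr p"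
  shows "a = b"
proof -
  have "p * ln a = p * ln b" using assms by (simp add: powr_def)
  thus ?thesis using assms by simp
qed

lemma gram_index:
  assumes "U \<in> carrier_mat m d" "W \<in> carrier_mat m k" "i < d" "j < k"
  shows "(U\<^sup>T * W) $$ (i, j) = (\<Sum>a<m. U $$ (a, i) * W $$ (a, j))"
  using index_mult_mat_sum[of "U\<^sup>T" d m W k i j] assms by simp

lemma col_ip_eq_gram:
  assumes "U \<in> carrier_mat m d" "W \<in> carrier_mat m d" "j < d"
  shows "col_ip U W j = (U\<^sup>T * W) $$ (j, j)"
  using gram_index[OF assms(1,2) assms(3,3)] assms by (simp add: col_ip_def)

text \<open>Pairs the first-order condition with the column itself. Zero columns are no exception,
  as both sides are then 0.\<close>

lemma weighted_column_sum:
  assumes Z: "Z \<in> carrier_mat r d"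
    and F: "\<And>a. a < r \<Longrightarrow> col_ip Z Z i \<noteq> 0 \<Longrightarrow> F a = c * (col_ip Z Z i powr p) * Z $$ (a, i)"
  shows "(\<Sum>a<r. Z $$ (a, i) * F a) = c * (col_ip Z Z i powr (p + 1))"
proof (cases "col_ip Z Z i = 0")
  case True
  thus ?thesis using col_ip_zero_imp[of Z i] Z by simp
next
  case False
  have "(\<Sum>a<r. Z $$ (a, i) * F a) = (\<Sum>a<r. c * (col_ip Z Z i powr p) * (Z $$ (a, i) * Z $$ (a, i)))"
    by (intro sum.cong refl) (simp only: lessThan_iff F[OF _ False] mult_ac)
  also have "\<dots> = c * (col_ip Z Z i powr p) * col_ip Z Z i"
    using Z by (simp add: col_ip_def sum_distrib_left)
  also have "\<dots> = c * (col_ip Z Z i powr (p + 1))"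
    using False col_ip_self_nonneg[of Z i] by (simp add: powr_add)
  finally show ?thesis .
qed

lemma gram_sym:
  fixes U :: "real mat"
  assumes "U \<in> carrier_mat m d" "i < d" "j < d"
  shows "(U\<^sup>T * U) $$ (i, j) = (U\<^sup>T * U) $$ (j, i)"
  unfolding gram_index[OF assms(1) assms(1) assms(2,3)] gram_index[OF assms(1) assms(1) assms(3,2)]
  by (simp add: mult.commute)

text \<open>
  Column by column the first-order condition says that the columns of \<open>U\<close> and \<open>V\<close> are singular
  vectors of the gradient, with the multiplier determined by the column norm.
\<close>

locale singular_columns =
  fixes m n d :: nat and G U V :: "real mat" and p lam :: real
  assumes G: "G \<in> carrier_mat m n" and U: "U \<in> carrier_mat m d" and V: "V \<in> carrier_mat n d"
    and lam: "lam > 0" and p: "p \<noteq> 0" "p \<noteq> - 1"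
    and GV: "\<And>a i. a < m \<Longrightarrow> i < d \<Longrightarrow> col_ip U U i \<noteq> 0 \<Longrightarrow>
      (G * V) $$ (a, i) = - lam * (col_ip U U i powr p) * U $$ (a, i)"
    and GU: "\<And>b i. b < n \<Longrightarrow> i < d \<Longrightarrow> col_ip V V i \<noteq> 0 \<Longrightarrow>
      (G\<^sup>T * U) $$ (b, i) = - lam * (col_ip V V i powr p) * V $$ (b, i)"
begin

lemma dims: "dim_row U = m" "dim_col U = d" "dim_row V = n" "dim_col V = d" "dim_row G = m" "dim_col G = n"
  using U V G by auto

lemma GVc: "G * V \<in> carrier_mat m d" and GUc: "G\<^sup>T * U \<in> carrier_mat n d"
  using dims by (auto intro!: carrier_matI)

text \<open>The number u_i^T G v_i can be computed from either family of equations. It equals -lam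
  times the power p + 1 of either squared column norm, and p \<noteq> -1 makes that power
  injective.\<close>

lemma col_norms_eq:
  assumes i: "i < d"
  shows "col_ip U U i = col_ip V V i"
proof -
  have *: "(\<Sum>a<m. U $$ (a, i) * (G * V) $$ (a, i)) = (\<Sum>b<n. V $$ (b, i) * (G\<^sup>T * U) $$ (b, i))"
  proof -
    have "V\<^sup>T * (G\<^sup>T * U) = (U\<^sup>T * (G * V))\<^sup>T"
      using dims by (simp add: mat_simps)
    hence "(V\<^sup>T * (G\<^sup>T * U)) $$ (i, i) = (U\<^sup>T * (G * V)) $$ (i, i)"
      using i dims by (simp del: index_mult_mat(1))
    thus ?thesis by (simp only: gram_index[OF U GVc i i] gram_index[OF V GUc i i])
  qed
  have s1: "(\<Sum>a<m. U $$ (a, i) * (G * V) $$ (a, i)) = - lam * (col_ip U U i powr (p + 1))"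
    using GV i by (intro weighted_column_sum[OF U]) blast
  have s2: "(\<Sum>b<n. V $$ (b, i) * (G\<^sup>T * U) $$ (b, i)) = - lam * (col_ip V V i powr (p + 1))"
    using GU i by (intro weighted_column_sum[OF V]) blast
  have e: "col_ip U U i powr (p + 1) = col_ip V V i powr (p + 1)" using * s1 s2 lam by simp
  have "col_ip U U i = 0 \<longleftrightarrow> col_ip V V i = 0"
    using e by (metis powr_eq_0_iff)
  thus ?thesis using powr_inj_pos[OF _ _ _ e] col_ip_self_nonneg[of U i] col_ip_self_nonneg[of V i] p
    by (cases "col_ip U U i = 0") force+
qed

text \<open>When the columns of both factors are orthogonal, these squared norms are the singular
  values of \<open>U * V\<^sup>T\<close>, since \<open>U\<close> and \<open>V\<close> contribute
  equal norms.\<close>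

definition s :: "nat \<Rightarrow> real" where "s i = col_ip U U i"

lemma zero_cols: "s i = 0 \<Longrightarrow> i < d \<Longrightarrow> a < m \<Longrightarrow> U $$ (a, i) = 0" "s i = 0 \<Longrightarrow> i < d \<Longrightarrow> b < n \<Longrightarrow> V $$ (b, i) = 0"
  using col_ip_zero_imp[of U i a] col_ip_zero_imp[of V i b] dims col_norms_eq[of i] by (auto simp: s_def)

lemma GV_mat: "G * V = U * dmat d (\<lambda>i. - lam * (s i powr p))"
proof (rule eq_matI)
  fix a i assume "a < dim_row (U * dmat d (\<lambda>i. - lam * (s i powr p)))" "i < dim_col (U * dmat d (\<lambda>i. - lam * (s i powr p)))"
  hence ai: "a < m" "i < d" using dims by auto
  have z: "(G * V) $$ (a, i) = 0" if "s i = 0"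
    using index_mult_mat_sum[OF G V ai] zero_cols(2)[OF that ai(2)] by simp
  show "(G * V) $$ (a, i) = (U * dmat d (\<lambda>i. - lam * (s i powr p))) $$ (a, i)"
    unfolding index_mult_dmat_right[OF U ai] using z GV[OF ai] zero_cols(1)[OF _ ai(2,1)]
    by (cases "s i = 0") (auto simp: s_def simp del: index_mult_mat(1))
qed (use dims in auto)

lemma swap: "singular_columns n m d (G\<^sup>T) V U p lam"
  by unfold_locales (use G U V lam p GV GU in \<open>simp_all del: index_mult_mat(1)\<close>)

lemma GU_mat: "G\<^sup>T * U = V * dmat d (\<lambda>i. - lam * (s i powr p))"
proof -
  have "dmat d (\<lambda>i. - lam * (singular_columns.s V i powr p)) = dmat d (\<lambda>i. - lam * (s i powr p))"
    using col_norms_eq by (intro dmat_cong) (simp add: singular_columns.s_def[OF swap] s_def)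
  thus ?thesis using singular_columns.GV_mat[OF swap] by simp
qed

text \<open>Evaluating U^T G V from both sides relates entries x and y of the two Gram matrices by x
  b = a y, where a and b are the powers p of s_i and s_j. The transposed entry gives x a = b y, and
  adding the two leaves (a + b)(x - y) = 0.\<close>

lemma gram_commute:
  assumes ij: "i < d" "j < d" and pos: "\<And>i. i < d \<Longrightarrow> s i > 0"
  shows "(U\<^sup>T * U) $$ (i, j) = (V\<^sup>T * V) $$ (i, j)"
proof -
  have UU: "U\<^sup>T * U \<in> carrier_mat d d" and VV: "V\<^sup>T * V \<in> carrier_mat d d"
    using dims by (auto intro!: carrier_matI)
  have "U\<^sup>T * (G * V) = (G\<^sup>T * U)\<^sup>T * V"
    using dims by (simp add: mat_simps)
  hence e: "(U\<^sup>T * U) * dmat d (\<lambda>i. - lam * (s i powr p)) = dmat d (\<lambda>i. - lam * (s i powr p)) * (V\<^sup>T * V)"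
    unfolding GV_mat GU_mat using dims by (simp add: mat_simps)
  have E: "(U\<^sup>T * U) $$ (i, j) * s j powr p = s i powr p * (V\<^sup>T * V) $$ (i, j)" if "i < d" "j < d" for i j
    using arg_cong[OF e, of "\<lambda>M. M $$ (i, j)"] lam
    unfolding index_mult_dmat_right[OF UU that] index_mult_dmat_left[OF VV that] by simp
  define x where "x = (U\<^sup>T * U) $$ (i, j)"
  define y where "y = (V\<^sup>T * V) $$ (i, j)"
  define a where "a = s i powr p"
  define b where "b = s j powr p"
  have ab: "a > 0" "b > 0" using pos[OF ij(1)] pos[OF ij(2)] by (auto simp: a_def b_def)
  have 1: "x * b = a * y" using E[OF ij] by (simp only: x_def y_def a_def b_def)
  have 2: "x * a = b * y" using E[OF ij(2,1)] gram_sym[OF U ij] gram_sym[OF V ij] by (simp only: x_def y_def a_def b_def)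
  have "(a + b) * (x - y) = 0" using 1 2 by (simp add: algebra_simps)
  thus ?thesis using ab by (simp add: x_def y_def)
qed

end

lemma mult_index_zero_sum:
  fixes C D :: "real mat"
  assumes "C \<in> carrier_mat d d" "D \<in> carrier_mat d d" "j < d"
  shows "(\<Sum>k<d. C $$ (i, k) * (C - D) $$ (k, j)) = (\<Sum>k<d. C $$ (i, k) * C $$ (k, j)) - (\<Sum>k<d. C $$ (i, k) * D $$ (k, j))"
  using assms by (simp add: right_diff_distrib sum_subtractf)

text \<open>
  With $t = V'^T V$ and $w = U'^T U$ the two sets of singular vector equations give $w = t$ and
  $t (C - S) = 0$ for $C = U^T U$ and $S = \mathrm{diag}(s)$; as $V C = V' t$, this yields
  $C^2 (C - S) = 0$, hence $C (C - S) = 0$, whose diagonal forces the off-diagonal of \<open>C\<close> to vanish.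
\<close>

lemma S_critical_orthogonal:
  assumes c: "singular_columns m n d G U V p lam" and c': "singular_columns m n d G U' V' p lam"
    and X: "U * V\<^sup>T = U' * V'\<^sup>T"
    and oU: "\<And>i j. i < d \<Longrightarrow> j < d \<Longrightarrow> i \<noteq> j \<Longrightarrow> (U'\<^sup>T * U') $$ (i, j) = 0"
    and oV: "\<And>i j. i < d \<Longrightarrow> j < d \<Longrightarrow> i \<noteq> j \<Longrightarrow> (V'\<^sup>T * V') $$ (i, j) = 0"
    and pos: "\<And>i. i < d \<Longrightarrow> col_ip U U i > 0"
  shows "U\<^sup>T * U = dmat d (col_ip U U)" "V\<^sup>T * V = dmat d (col_ip U U)"
proof -
  interpret c: singular_columns m n d G U V p lam by (rule c)
  interpret c': singular_columns m n d G U' V' p lam by (rule c')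
  note dims = c.dims c'.dims
  have s: "c.s i = col_ip U U i" for i by (simp add: c.s_def)
  have spos: "c.s i > 0" if "i < d" for i using pos[OF that] by (simp add: s)
  define C where "C = U\<^sup>T * U"
  define t where "t = V'\<^sup>T * V"
  define w where "w = U'\<^sup>T * U"
  have Cc: "C \<in> carrier_mat d d" and tc: "t \<in> carrier_mat d d" and wc: "w \<in> carrier_mat d d"
    using dims by (auto simp: C_def t_def w_def intro!: carrier_matI)
  have CV: "V\<^sup>T * V = C"
    using c.gram_commute spos dims by (intro eq_matI) (auto simp: C_def simp del: index_mult_mat(1))
  have U'U': "U'\<^sup>T * U' = dmat d c'.s"
    using oU dims col_ip_eq_gram[OF c'.U c'.U]
    by (intro eq_matI) (auto simp: dmat_def c'.s_def simp del: index_mult_mat(1))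
  have V'V': "V'\<^sup>T * V' = dmat d c'.s"
    using oV dims col_ip_eq_gram[OF c'.V c'.V] c'.col_norms_eq
    by (intro eq_matI) (auto simp: dmat_def c'.s_def simp del: index_mult_mat(1))
  have i1: "c'.s i powr p * w $$ (i, j) = t $$ (i, j) * c.s j powr p" if ij: "i < d" "j < d" for i j
  proof -
    have "(G * V')\<^sup>T * U = V'\<^sup>T * (G\<^sup>T * U)"
      using dims by (simp add: mat_simps)
    hence "dmat d (\<lambda>i. - lam * (c'.s i powr p)) * w = t * dmat d (\<lambda>i. - lam * (c.s i powr p))"
      unfolding c'.GV_mat c.GU_mat w_def t_def using dims by (simp add: mat_simps)
    from arg_cong[OF this, of "\<lambda>M. M $$ (i, j)"] show ?thesis
      unfolding index_mult_dmat_right[OF tc ij] index_mult_dmat_left[OF wc ij] using c.lam by simp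
  qed
  have i2: "c'.s i powr p * t $$ (i, j) = w $$ (i, j) * c.s j powr p" if ij: "i < d" "j < d" for i j
  proof -
    have "(G\<^sup>T * U')\<^sup>T * V = U'\<^sup>T * (G * V)"
      using dims by (simp add: mat_simps)
    hence "dmat d (\<lambda>i. - lam * (c'.s i powr p)) * t = w * dmat d (\<lambda>i. - lam * (c.s i powr p))"
      unfolding c'.GU_mat c.GV_mat w_def t_def using dims by (simp add: mat_simps)
    from arg_cong[OF this, of "\<lambda>M. M $$ (i, j)"] show ?thesis
      unfolding index_mult_dmat_right[OF wc ij] index_mult_dmat_left[OF tc ij] using c.lam by simp
  qed
  have tw: "w $$ (i, j) = t $$ (i, j)" and ts: "c'.s i * t $$ (i, j) = c.s j * t $$ (i, j)" if ij: "i < d" "j < d" for i j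
  proof -
    define a where "a = c'.s i powr p"
    define b where "b = c.s j powr p"
    have b: "b > 0" using spos[OF ij(2)] by (simp add: b_def)
    have a: "a \<ge> 0" by (simp add: a_def)
    have 1: "a * w $$ (i, j) = t $$ (i, j) * b" using i1[OF ij] by (simp only: a_def b_def)
    have 2: "a * t $$ (i, j) = w $$ (i, j) * b" using i2[OF ij] by (simp only: a_def b_def)
    have "(a + b) * (w $$ (i, j) - t $$ (i, j)) = 0" using 1 2 by (simp add: algebra_simps)
    moreover have "a + b \<noteq> 0" using a b by linarith
    ultimately show eq: "w $$ (i, j) = t $$ (i, j)" by simp
    show "c'.s i * t $$ (i, j) = c.s j * t $$ (i, j)"
    \<comment> \<open>A nonzero entry forces the two multipliers to agree, and p \<noteq> 0 lets the
      squared column norms be recovered from them.\<close>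
    proof (cases "t $$ (i, j) = 0")
      case False
      have "a = b" using 1 False unfolding eq by simp
      have "c'.s i > 0"
      proof -
        have "c'.s i \<noteq> 0" using \<open>a = b\<close> b by (auto simp: a_def)
        thus ?thesis using col_ip_self_nonneg[of U' i] by (simp add: c'.s_def less_le)
      qed
      moreover have "c'.s i powr p = c.s j powr p" using \<open>a = b\<close> by (simp only: a_def b_def)
      ultimately have "c'.s i = c.s j" using powr_inj_pos[OF _ spos[OF ij(2)] c.p(1)] by blast
      thus ?thesis by simp
    qed simp
  qed
  have dtw: "dim_row t = d" "dim_col t = d" "dim_row w = d" "dim_col w = d" using tc wc by auto
  have weq: "w = t" by (rule eq_matI) (simp_all add: tw dtw)
  \<comment> \<open>Apply the transpose of the common product to \<open>U\<close>, once in each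
    factorization.\<close>
  have VC: "V * C = V' * t"
  proof -
    have "(U * V\<^sup>T)\<^sup>T * U = (U' * V'\<^sup>T)\<^sup>T * U" by (simp only: X)
    thus ?thesis unfolding C_def weq[symmetric] w_def using dims by (simp add: mat_simps)
  qed
  define Z where "Z = C - dmat d c.s"
  have Zc: "Z \<in> carrier_mat d d" unfolding Z_def by (rule minus_carrier_mat) simp
  have dm: "dim_row C = d" "dim_col C = d" "dim_row t = d" "dim_col t = d" "dim_row Z = d" "dim_col Z = d"
    using Cc tc Zc by auto
  have tC: "t * C = dmat d c'.s * t"
  proof -
    have "t * C = V'\<^sup>T * (V * C)" unfolding t_def using dims dm by (simp add: mult_assoc_dim)
    also have "\<dots> = (V'\<^sup>T * V') * t" unfolding VC using dims dm by (simp add: mult_assoc_dim)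
    finally show ?thesis unfolding V'V' .
  qed
  have tS: "dmat d c'.s * t = t * dmat d c.s"
    using ts index_mult_dmat_left[OF tc] index_mult_dmat_right[OF tc] dm
    by (intro eq_matI) (auto simp: mult.commute simp del: index_mult_mat(1))
  have tZ: "t * Z = 0\<^sub>m d d"
  proof -
    have "t * Z = t * C - t * dmat d c.s" unfolding Z_def using dm by (simp add: mat_simps)
    also have "\<dots> = 0\<^sub>m d d" unfolding tC tS using dm by (intro eq_matI) auto
    finally show ?thesis .
  qed
  have Csym: "C\<^sup>T = C" unfolding C_def using dims by (simp add: mat_simps)
  \<comment> \<open>\<open>C\<close> is also the Gram matrix of \<open>V\<close>, so this product is
    \<open>(V * C)\<^sup>T * (V * Z)\<close>; replacing \<open>V * C\<close> by
    \<open>V' * t\<close> produces the factor \<open>t * Z\<close>, which is 0.\<close>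
  have CCZ: "C * (C * Z) = 0\<^sub>m d d"
  proof -
    have "C * Z = V\<^sup>T * (V * Z)" unfolding CV[symmetric] using dims dm by (simp add: mult_assoc_dim)
    hence "C * (C * Z) = (V * C)\<^sup>T * (V * Z)"
      using dims dm Csym by (simp add: mat_simps)
    also have "\<dots> = t\<^sup>T * (t * Z)"
      unfolding VC using dims dm by (simp add: mat_simps t_def)
    also have "\<dots> = 0\<^sub>m d d" unfolding tZ using tc by simp
    finally show ?thesis .
  qed
  have "frob_inner (C * Z) (C * Z) = frob_inner Z (C * (C * Z))"
    using frob_inner_mult_left[OF Cc Zc, of "C * Z"] Cc Zc Csym by simp
  hence "frob_inner (C * Z) (C * Z) = 0" unfolding CCZ using frob_inner_zero_right[OF Zc] by simp
  hence CZ: "C * Z = 0\<^sub>m d d" using frob_inner_self_eq_0[of "C * Z" d d] Cc Zc by simp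
  have diag: "C $$ (j, j) = c.s j" if "j < d" for j
    using col_ip_eq_gram[OF c.U c.U that] by (simp add: C_def s)
  have off: "C $$ (k, j) = 0" if kj: "k < d" "j < d" "k \<noteq> j" for k j
  proof -
    have "0 = (C * Z) $$ (j, j)" using CZ kj by simp
    also have "\<dots> = (\<Sum>k<d. C $$ (j, k) * C $$ (k, j)) - (\<Sum>k<d. C $$ (j, k) * dmat d c.s $$ (k, j))"
      unfolding index_mult_mat_sum[OF Cc Zc kj(2,2)] unfolding Z_def
      by (rule mult_index_zero_sum[OF Cc dmat_carrier kj(2)])
    also have "(\<Sum>k<d. C $$ (j, k) * dmat d c.s $$ (k, j)) = (\<Sum>k<d. if k = j then C $$ (j, j) * C $$ (j, j) else 0)"
      using kj diag by (intro sum.cong) (auto simp: dmat_def)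
    also have "\<dots> = C $$ (j, j) * C $$ (j, j)" using kj by simp
    also have "(\<Sum>k<d. C $$ (j, k) * C $$ (k, j)) = C $$ (j, j) * C $$ (j, j) + (\<Sum>k\<in>{..<d} - {j}. C $$ (j, k) * C $$ (k, j))"
      using kj by (subst sum.remove[of _ j]) auto
    finally have z: "(\<Sum>k\<in>{..<d} - {j}. C $$ (j, k) * C $$ (k, j)) = 0" by simp
    have "(\<Sum>k\<in>{..<d} - {j}. C $$ (j, k) * C $$ (k, j)) = (\<Sum>k\<in>{..<d} - {j}. (C $$ (k, j))\<^sup>2)"
      using gram_sym[OF c.U] kj by (intro sum.cong refl) (auto simp: C_def power2_eq_square simp del: index_mult_mat(1))
    hence "(\<Sum>k\<in>{..<d} - {j}. (C $$ (k, j))\<^sup>2) = 0" using z by simp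
    moreover have "((\<Sum>k\<in>{..<d} - {j}. (C $$ (k, j))\<^sup>2) = 0) = (\<forall>k\<in>{..<d} - {j}. (C $$ (k, j))\<^sup>2 = 0)"
      by (rule sum_nonneg_eq_0_iff) auto
    ultimately have "\<forall>k\<in>{..<d} - {j}. (C $$ (k, j))\<^sup>2 = 0" by blast
    thus ?thesis using kj by auto
  qed
  have "C = dmat d (col_ip U U)"
    using off diag dm by (intro eq_matI) (auto simp: dmat_def s)
  thus "U\<^sup>T * U = dmat d (col_ip U U)" "V\<^sup>T * V = dmat d (col_ip U U)"
    using CV by (simp_all add: C_def)
qed

section \<open>The error bound\<close>

lemma RIP_bounds:
  assumes "RIP m n l A s \<delta>" "l \<ge> 1" "H \<in> carrier_mat m n" "mat_rank H \<le> s"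
  shows "real l * (1 - \<delta>) * frob_inner H H \<le> (\<Sum>i<l. (meas A H i)\<^sup>2)"
    and "(\<Sum>i<l. (meas A H i)\<^sup>2) \<le> real l * (1 + \<delta>) * frob_inner H H"
  using assms by (auto simp: RIP_def frob_norm_square field_simps)

text \<open>Without measurements the middle term of the restricted isometry inequality is 0, and its
  lower bound would force \<open>X = 0\<close>.\<close>

lemma RIP_imp_measurements:
  assumes "RIP m n l A s \<delta>" "X \<in> carrier_mat m n" "mat_rank X \<le> s" "mat_rank X \<noteq> 0" "\<delta> < 1"
  shows "l \<ge> 1"
proof (rule ccontr)
  assume "\<not> l \<ge> 1"
  hence "l = 0" by simp
  hence "(1 - \<delta>) * frob_inner X X \<le> 0"
    using assms(1)[unfolded RIP_def, rule_format, OF assms(2,3)] by (simp add: frob_norm_square)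
  hence "frob_inner X X = 0" using assms(5) frob_inner_self_nonneg[of X] by (simp add: mult_le_0_iff)
  hence "X = 0\<^sub>m m n" using frob_inner_self_eq_0[OF assms(2)] by simp
  hence "mat_rank X = 0" using vec_space.rank_0I[where n = m and nc = n and 'a = real] by (simp only: mat_rank_def index_zero_mat(2))
  thus False using assms(4) by simp
qed

text \<open>Randomness is confined to \<open>W\<close>, a bound for the squared norm of one
  realization \<open>w\<close> of the noise; everything else holds pointwise.\<close>

lemma deterministic_bound:
  fixes w :: "nat \<Rightarrow> real"
  assumes q: "0 < q" "q < 2" and Xs: "Xs \<in> carrier_mat m n" and rk: "mat_rank Xs = r" "1 \<le> r" "r \<le> d"
    and A: "\<And>i. i < l \<Longrightarrow> A i \<in> carrier_mat m n"
    and \<delta>: "0 < \<delta>" "\<delta> < 19 / 119" and rip: "RIP m n l A (4 * r) \<delta>" and lam: "0 < lam"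
    and W: "(\<Sum>i<l. (w i)\<^sup>2) \<le> W"
    and y: "y = (\<lambda>i. meas A Xs i + w i)" and X: "X = U * V\<^sup>T"
    and S: "S_critical m n d (Phi l A y q lam) U V"
    and nz: "\<And>i. i < d \<Longrightarrow> col U i \<noteq> 0\<^sub>v m" "\<And>i. i < d \<Longrightarrow> col V i \<noteq> 0\<^sub>v n"
    and rX: "mat_rank X \<le> r" and sX: "sigma_min X \<ge> 1 / 10 * sigma_min Xs"
    and psd: "psd_hessian m n d (Phi l A y q lam) (U, V)"
  shows "(frob_norm (X - Xs))\<^sup>2 \<le> 100 / (2 * real l * (1 - \<delta>)) *
     (5 / 3 * W + lam * (10 powr (1 - q / 2) * sigma_min Xs powr (q / 2 - 1)) * nuclear_norm Xs
       - lam * schatten_pow (q / 2) X)"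
proof -
  have l: "l \<ge> 1" by (rule RIP_imp_measurements[OF rip Xs]) (use rk \<delta> in auto)
  have crit: "critical_point m n d (Phi l A y q lam) (U, V)" using S by (simp add: S_critical_def)
  have U: "U \<in> carrier_mat m d" and V: "V \<in> carrier_mat n d"
    using crit by (auto simp: critical_point_def factors_def)
  obtain U' V' where U': "U' \<in> carrier_mat m d" and V': "V' \<in> carrier_mat n d"
    and orth: "orthogonal_cols U'" "orthogonal_cols V'" and XX: "U * V\<^sup>T = U' * V'\<^sup>T"
    and crit': "critical_point m n d (Phi l A y q lam) (U', V')"
    using S unfolding S_critical_def by blast
  define p where "p = q / 2 - 1"
  have p: "p \<noteq> 0" "p \<noteq> - 1" "p < 0" using q by (auto simp: p_def)
  define G where "G = loss_gradient m n l A y X"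
  have G: "G \<in> carrier_mat m n" by (simp add: G_def)
  note cc = critical_point_columns[where A = A and m = m and n = n and l = l, OF _ q(1)]
  have sc: "singular_columns m n d G U V p lam"
    unfolding G_def X p_def
    by (unfold_locales; (fact loss_gradient_carrier U V lam | fact p[unfolded p_def] | rule cc[OF A crit] ; assumption)?)
  have sc': "singular_columns m n d G U' V' p lam"
    unfolding G_def X XX p_def
    by (unfold_locales; (fact loss_gradient_carrier U' V' lam | fact p[unfolded p_def] | rule cc[OF A crit'] ; assumption)?)
  define s where "s = col_ip U U"
  have pos: "s i > 0" if i: "i < d" for i
  proof (rule ccontr)
    assume "\<not> s i > 0"
    hence "col_ip U U i = 0" using col_ip_self_nonneg[of U i] by (simp add: s_def)
    hence "U $$ (k, i) = 0" if "k < m" for k using col_ip_zero_imp[of U i k] U that by simp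
    hence "col U i = 0\<^sub>v m" using U i by (intro eq_vecI) auto
    thus False using nz(1)[OF i] by simp
  qed
  have oc: "(Z\<^sup>T * Z) $$ (i, j) = 0" if "orthogonal_cols Z" "Z \<in> carrier_mat k d" "i < d" "j < d" "i \<noteq> j" for Z k i j
    using that by (auto simp: orthogonal_cols_def)
  have UU: "U\<^sup>T * U = dmat d s" and VV: "V\<^sup>T * V = dmat d s"
    unfolding s_def
    using S_critical_orthogonal[OF sc sc' XX oc[OF orth(1) U'] oc[OF orth(2) V']] pos by (auto simp: s_def)
  have VVs: "col_ip V V i = s i" if "i < d" for i
    using col_ip_eq_gram[OF V V that] VV that by (simp add: dmat_def)
  define \<rho> where "\<rho> i = sqrt (s i)" for i
  have \<rho>: "\<rho> i > 0" "\<rho> i * \<rho> i = s i" if "i < d" for i using pos[OF that] by (auto simp: \<rho>_def)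
  define P where "P = U * dmat d (\<lambda>i. 1 / \<rho> i)"
  define Q where "Q = V * dmat d (\<lambda>i. 1 / \<rho> i)"
  have dUV: "dim_row U = m" "dim_col U = d" "dim_row V = n" "dim_col V = d" "dim_row G = m" "dim_col G = n"
    "dim_row Xs = m" "dim_col Xs = n"
    using U V G Xs by auto
  have P: "P \<in> carrier_mat m d" and Q: "Q \<in> carrier_mat n d" using dUV by (auto simp: P_def Q_def intro!: carrier_matI)
  have dPQ: "dim_row P = m" "dim_col P = d" "dim_row Q = n" "dim_col Q = d" using P Q by auto
  have diag1: "dmat d (\<lambda>i. 1 / \<rho> i) * (dmat d s * dmat d (\<lambda>i. 1 / \<rho> i)) = 1\<^sub>m d"
    unfolding dmat_mult dmat_one[symmetric] using \<rho> by (intro dmat_cong) (fastforce simp: field_simps)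
  have PP: "P\<^sup>T * P = 1\<^sub>m d"
  proof -
    have "P\<^sup>T * P = dmat d (\<lambda>i. 1 / \<rho> i) * ((U\<^sup>T * U) * dmat d (\<lambda>i. 1 / \<rho> i))"
      unfolding P_def using dUV by (simp add: mat_simps)
    thus ?thesis unfolding UU diag1 .
  qed
  have QQ: "Q\<^sup>T * Q = 1\<^sub>m d"
  proof -
    have "Q\<^sup>T * Q = dmat d (\<lambda>i. 1 / \<rho> i) * ((V\<^sup>T * V) * dmat d (\<lambda>i. 1 / \<rho> i))"
      unfolding Q_def using dUV by (simp add: mat_simps)
    thus ?thesis unfolding VV diag1 .
  qed
  have diag2: "dmat d (\<lambda>i. 1 / \<rho> i) * dmat d \<rho> = 1\<^sub>m d"
    unfolding dmat_mult dmat_one[symmetric] using \<rho>(1) by (intro dmat_cong) fastforce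
  have UP: "U = P * dmat d \<rho>" and VQ: "V = Q * dmat d \<rho>"
    unfolding P_def Q_def using dUV by (simp_all add: mult_assoc_dim diag2)
  \<comment> \<open>\<open>U\<^sup>T * X * V\<close> is the invertible diagonal matrix of the
    squares of \<open>s i\<close>. Together with \<open>rX\<close> and \<open>r \<le> d\<close> this
    pins \<open>d\<close> to \<open>r\<close>, so that \<open>K\<close> and \<open>E\<close>, sums
    of two products of width \<open>d\<close>, stay within reach of the isometry property.\<close>
  have "d \<le> mat_rank X"
  proof (rule mat_rank_ge)
    show "X \<in> carrier_mat m n" unfolding X using dUV by (auto intro!: carrier_matI)
    show "dmat d (\<lambda>i. 1 / (s i * s i)) * U\<^sup>T \<in> carrier_mat d m" using dUV by (auto intro!: carrier_matI)
    show "V \<in> carrier_mat n d" by (rule V)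
    have "dmat d (\<lambda>i. 1 / (s i * s i)) * U\<^sup>T * X * V
       = dmat d (\<lambda>i. 1 / (s i * s i)) * ((U\<^sup>T * U) * (V\<^sup>T * V))"
      unfolding X using dUV by (simp add: mat_simps)
    also have "\<dots> = 1\<^sub>m d"
      unfolding UU VV dmat_mult dmat_one[symmetric] using pos by (intro dmat_cong) (fastforce simp: field_simps)
    finally show "dmat d (\<lambda>i. 1 / (s i * s i)) * U\<^sup>T * X * V = 1\<^sub>m d" .
  qed
  hence dr: "d \<le> r" using rX by simp
  have Xc: "X \<in> carrier_mat m n" unfolding X using dUV by (auto intro!: carrier_matI)
  have rk0: "mat_rank Xs \<noteq> 0" and rkd: "mat_rank Xs \<le> d" using rk by auto
  obtain Us Vs where Us: "Us \<in> carrier_mat m d" and Vs: "Vs \<in> carrier_mat n d"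
    and XsUV: "Xs = Us * Vs\<^sup>T" and bal: "Us\<^sup>T * Us = Vs\<^sup>T * Vs"
    and nuc: "frob_inner Us Us = nuclear_norm Xs" "frob_inner Vs Vs = nuclear_norm Xs"
    and sym: "\<And>i j. i < d \<Longrightarrow> j < d \<Longrightarrow> (P\<^sup>T * Us) $$ (i, j) + (Q\<^sup>T * Vs) $$ (i, j)
       = (P\<^sup>T * Us) $$ (j, i) + (Q\<^sup>T * Vs) $$ (j, i)"
    by (fact ex_aligned_factorization[OF Xs rkd rk0 P Q])
  interpret f: factor_frame m n d P Q U V Us Vs \<rho>
    by unfold_locales (fact P PP Q QQ UP VQ Us Vs bal sym)+
  define K where "K = f.L * V\<^sup>T + U * f.R\<^sup>T"
  define E where "E = X - Xs"
  have dE: "E \<in> carrier_mat m n" and dK: "K \<in> carrier_mat m n"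
    using f.dims dUV Xs Xc by (auto simp: E_def K_def intro!: carrier_matI)
  have KE: "frob_inner K K \<le> frob_inner E E"
    unfolding K_def E_def X XsUV by (rule f.hessian_direction_le)
  have c2: "V\<^sup>T \<in> carrier_mat d n" "f.R\<^sup>T \<in> carrier_mat d n" "Vs\<^sup>T \<in> carrier_mat d n"
    using V Vs by auto
  have rK: "mat_rank K \<le> 4 * r"
    using mat_rank_add_le[OF mult_carrier_mat[OF f.carriers(3) c2(1)] mult_carrier_mat[OF U c2(2)]]
      mat_rank_mult_le[OF f.carriers(3) c2(1)] mat_rank_mult_le[OF U c2(2)] dr by (simp add: K_def)
  have "E = U * V\<^sup>T + (- Us) * Vs\<^sup>T"
    unfolding E_def X XsUV using f.dims dUV by (intro eq_matI) auto
  hence rE: "mat_rank E \<le> 4 * r"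
    using mat_rank_add_le[OF mult_carrier_mat[OF U c2(1)] mult_carrier_mat[OF uminus_carrier_mat[OF Us] c2(3)]]
      mat_rank_mult_le[OF U c2(1)] mat_rank_mult_le[OF uminus_carrier_mat[OF Us] c2(3)] dr by simp
  define SE where "SE = (\<Sum>i<l. (meas A E i)\<^sup>2)"
  define SK where "SK = (\<Sum>i<l. (meas A K i)\<^sup>2)"
  define N where "N = real l * (1 - \<delta>) * frob_inner E E"
  have SEN: "N \<le> SE" unfolding SE_def N_def by (rule RIP_bounds(1)[OF rip l dE rE])
  have "SK \<le> real l * (1 + \<delta>) * frob_inner K K" unfolding SK_def by (rule RIP_bounds(2)[OF rip l dK rK])
  also have "\<dots> \<le> real l * (1 + \<delta>) * frob_inner E E" using KE \<delta> by (intro mult_left_mono) auto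
  \<comment> \<open>The inequality 1 + \<delta> \<le> 69/50 (1 - \<delta>) is equivalent to \<delta>
    \<le> 19/119; the threshold originates here.\<close>
  also have "\<dots> \<le> real l * (69 / 50 * (1 - \<delta>)) * frob_inner E E"
    using \<delta> by (intro mult_right_mono mult_left_mono) auto
  also have "\<dots> = 69 / 50 * N" by (simp only: N_def mult_ac)
  finally have SKN: "SK \<le> 69 / 50 * N" .
  define v where "v i = s i powr p" for i
  \<comment> \<open>The exponent p is negative, so the lower bound \<open>sigma_min Xs / 10\<close>
    for all \<open>s i\<close> becomes the upper bound \<mu> for all \<open>v i\<close>.\<close>
  define \<mu> where "\<mu> = (sigma_min Xs / 10) powr p"
  have sXs: "sigma_min Xs > 0" by (rule balanced_factorization(2)[OF Xs rkd rk0])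
  have XtX: "X\<^sup>T * X = Q * dmat d (\<lambda>i. s i * s i) * Q\<^sup>T"
  proof -
    have "X\<^sup>T * X = V * (U\<^sup>T * U) * V\<^sup>T"
      unfolding X using dUV by (simp add: mat_simps)
    also have "\<dots> = (Q * dmat d \<rho>) * dmat d s * (Q * dmat d \<rho>)\<^sup>T"
      by (simp only: UU VQ[symmetric])
    also have "\<dots> = Q * (dmat d \<rho> * (dmat d s * dmat d \<rho>)) * Q\<^sup>T"
      using dPQ by (simp add: mat_simps)
    also have "dmat d \<rho> * (dmat d s * dmat d \<rho>) = dmat d (\<lambda>i. s i * s i)"
      unfolding dmat_mult
    proof (rule dmat_cong)
      fix i assume "i < d"
      thus "\<rho> i * (s i * \<rho> i) = s i * s i" using \<rho>(2)[of i] by (metis mult.left_commute)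
    qed
    finally show ?thesis .
  qed
  have ss: "sqrt (s i * s i) = s i" if "i < d" for i using pos[OF that] by simp
  have sigma: "sigma_min Xs / 10 \<le> s i" if i: "i < d" for i
  proof -
    have "sigma_min X \<le> sqrt (s i * s i)"
      by (rule sigma_min_le[OF Xc Q QQ XtX _ i]) (use pos in auto)
    thus ?thesis using sX ss[OF i] by simp
  qed
  have v: "0 \<le> v i" "v i \<le> \<mu>" if "i < d" for i
    using powr_mono2'[of p "sigma_min Xs / 10" "s i"] sigma[OF that] sXs p(3) by (auto simp: v_def \<mu>_def)
  have sch: "schatten_pow (q / 2) X = (\<Sum>i<d. s i powr (q / 2))"
  proof -
    have "schatten_pow (q / 2) X = (\<Sum>i<d. sqrt (s i * s i) powr (q / 2))"
      unfolding schatten_pow_def by (rule sum_singular_values[OF Xc Q QQ XtX]) (use pos in auto)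
    thus ?thesis using ss by simp
  qed
  define g where "g i = - lam * v i" for i
  have GV: "G * V = U * dmat d g"
    using singular_columns.GV_mat[OF sc] by (simp add: g_def[abs_def] v_def singular_columns.s_def[OF sc] s_def)
  have GU: "G\<^sup>T * U = V * dmat d g"
    using singular_columns.GU_mat[OF sc] by (simp add: g_def[abs_def] v_def singular_columns.s_def[OF sc] s_def)
  have comm: "dmat d g * dmat d (\<lambda>i. 1 / \<rho> i) = dmat d (\<lambda>i. 1 / \<rho> i) * dmat d g"
    unfolding dmat_mult by (simp add: mult.commute)
  have GQ: "G * Q = P * dmat d g"
  proof -
    have "G * Q = (G * V) * dmat d (\<lambda>i. 1 / \<rho> i)" unfolding Q_def using dUV by (simp add: mat_simps)
    also have "\<dots> = U * (dmat d g * dmat d (\<lambda>i. 1 / \<rho> i))" unfolding GV using dUV by (simp add: mat_simps)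
    also have "\<dots> = P * dmat d g" unfolding comm P_def using dUV by (simp add: mat_simps)
    finally show ?thesis .
  qed
  have GP: "G\<^sup>T * P = Q * dmat d g"
  proof -
    have "G\<^sup>T * P = (G\<^sup>T * U) * dmat d (\<lambda>i. 1 / \<rho> i)" unfolding P_def using dUV by (simp add: mat_simps)
    also have "\<dots> = V * (dmat d g * dmat d (\<lambda>i. 1 / \<rho> i))" unfolding GU using dUV by (simp add: mat_simps)
    also have "\<dots> = Q * dmat d g" unfolding comm Q_def using dUV by (simp add: mat_simps)
    finally show ?thesis .
  qed
  \<comment> \<open>The Schatten term appears here as an equality: up to the factor -lam, each
    singular value contributes s_i^p s_i = s_i^(q/2).\<close>
  have GX: "frob_inner G X = - lam * schatten_pow (q / 2) X"
  proof -
    have "frob_inner G X = frob_inner (G * V) U"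
      unfolding X using frob_inner_mult_right'[OF U c2(1) G] by simp
    also have "\<dots> = frob_inner (dmat d g) (dmat d s)"
      unfolding GV UU[symmetric] by (rule frob_inner_mult_left[OF U dmat_carrier U])
    also have "\<dots> = (\<Sum>i<d. g i * s i)"
      unfolding frob_inner_dmat[OF dmat_carrier] by (simp add: dmat_def)
    also have "\<dots> = (\<Sum>i<d. - lam * s i powr (q / 2))"
    proof (rule sum.cong[OF refl])
      fix i assume "i \<in> {..<d}"
      hence i: "i < d" by simp
      have "s i powr p * s i powr 1 = s i powr (p + 1)" by (rule powr_add[symmetric])
      hence "s i powr p * s i = s i powr (q / 2)" using pos[OF i] by (simp add: p_def)
      thus "g i * s i = - lam * s i powr (q / 2)" by (simp add: g_def v_def)
    qed
    also have "\<dots> = - lam * schatten_pow (q / 2) X" unfolding sch by (simp add: sum_distrib_left)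
    finally show ?thesis .
  qed
  have trace_ip: "(\<Sum>j<d. col_ip Z Z j) = frob_inner Z Z" if "Z \<in> carrier_mat k d" for Z k
    unfolding frob_inner_eq_trace[OF that that] using col_ip_eq_gram[OF that that]
    by (intro sum.cong refl) (simp del: index_mult_mat(1))
  have reg: "(\<Sum>j<d. v j * col_ip Z Z j) \<le> \<mu> * frob_inner Z Z" if "Z \<in> carrier_mat k d" for Z k
    unfolding trace_ip[OF that, symmetric] sum_distrib_left
    using v by (intro sum_mono mult_right_mono) auto
  have UL: "col_ip U f.L j = 0" if "j < d" for j
    using col_ip_eq_gram[OF U f.carriers(3) that] that by (simp add: f.U_orthogonal_L)
  have VR: "col_ip V f.R j = 0" if "j < d" for j
    using col_ip_eq_gram[OF V f.carriers(4) that] that by (simp add: f.V_orthogonal_R)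
  have posU: "col_ip U U j > 0" if "j < d" for j using pos[OF that] by (simp add: s_def)
  have posV: "col_ip V V j > 0" if "j < d" for j using pos[OF that] VVs[OF that] by simp
  have hess: "0 \<le> 2 * SK + 2 * frob_inner G (f.L * f.R\<^sup>T)
     + lam * ((\<Sum>j<d. v j * col_ip f.L f.L j) + (\<Sum>j<d. v j * col_ip f.R f.R j))"
  proof -
    have "0 \<le> 2 * (\<Sum>i<l. (meas A (f.L * V\<^sup>T + U * f.R\<^sup>T) i)\<^sup>2)
     + 2 * frob_inner (loss_gradient m n l A y (U * V\<^sup>T)) (f.L * f.R\<^sup>T)
     + lam * ((\<Sum>j<d. col_ip U U j powr (q / 2 - 1) * col_ip f.L f.L j) + (\<Sum>j<d. col_ip V V j powr (q / 2 - 1) * col_ip f.R f.R j))"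
      by (rule psd_hessian_inequality[OF _ q(1) psd U V f.carriers(3,4) posU posV UL VR]) (rule A)
    moreover have "(\<Sum>j<d. col_ip V V j powr (q / 2 - 1) * col_ip f.R f.R j) = (\<Sum>j<d. v j * col_ip f.R f.R j)"
      using VVs by (intro sum.cong) (auto simp: v_def p_def)
    ultimately show ?thesis
      by (simp add: SK_def K_def G_def X v_def p_def s_def)
  qed
  have GXs: "frob_inner G Xs = - lam * (\<Sum>i<d. v i * (\<Sum>j<d. f.A $$ (i, j) * f.B $$ (i, j))) + frob_inner G (f.L * f.R\<^sup>T)"
    unfolding XsUV f.frob_gradient_split[OF G GQ GP] by (simp add: g_def sum_distrib_left mult.assoc)
  have tr: "lam * (\<Sum>i<d. v i * (\<Sum>j<d. f.A $$ (i, j) * f.B $$ (i, j))) \<le> lam * (\<mu> * (frob_inner f.A f.A + frob_inner f.B f.B) / 2)"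
    using lam v by (intro mult_left_mono f.weighted_trace_le) auto
  have rg: "lam * ((\<Sum>j<d. v j * col_ip f.L f.L j) + (\<Sum>j<d. v j * col_ip f.R f.R j))
      \<le> lam * (\<mu> * frob_inner f.L f.L + \<mu> * frob_inner f.R f.R)"
    using lam reg[OF f.carriers(3)] reg[OF f.carriers(4)] by (intro mult_left_mono add_mono) auto
  have nn: "frob_inner f.A f.A + frob_inner f.L f.L = nuclear_norm Xs" "frob_inner f.B f.B + frob_inner f.R f.R = nuclear_norm Xs"
    using f.frob_split_U f.frob_split_V nuc by simp_all
  \<comment> \<open>Halving the Hessian inequality gives its terms in \<open>L\<close> and
    \<open>R\<close> the same weight as those in \<open>A\<close> and \<open>B\<close>; the
    Pythagorean identities \<open>nn\<close> then restore two nuclear norms, each with weight lam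
    \<mu>/2.\<close>
  have "lam * (\<mu> * (frob_inner f.A f.A + frob_inner f.B f.B) / 2)
      + lam * (\<mu> * frob_inner f.L f.L + \<mu> * frob_inner f.R f.R) / 2
      = lam * \<mu> / 2 * ((frob_inner f.A f.A + frob_inner f.L f.L) + (frob_inner f.B f.B + frob_inner f.R f.R))"
    by (simp add: field_simps)
  also have "\<dots> = lam * \<mu> * nuclear_norm Xs" unfolding nn by simp
  finally have "- frob_inner G Xs \<le> lam * \<mu> * nuclear_norm Xs + SK"
    using GXs tr rg hess by linarith
  moreover have "frob_inner G E = frob_inner G X - frob_inner G Xs"
    unfolding E_def by (rule frob_inner_minus_right[OF G Xc Xs])
  ultimately have up: "frob_inner G E \<le> - lam * schatten_pow (q / 2) X + lam * \<mu> * nuclear_norm Xs + SK"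
    using GX by linarith
  have res: "residual A y X i = meas A E i - w i" if "i < l" for i
    using frob_inner_minus_right[OF A[OF that] Xc Xs] by (simp add: residual_def y meas_def E_def)
  have "frob_inner G E = (\<Sum>i<l. 2 * residual A y X i * meas A E i)"
    unfolding G_def by (rule frob_loss_gradient) (rule A)
  \<comment> \<open>The two summands differ by (3 e - 5 w)^2 / 15 with e the measured error. The
    coefficient 7/5 = 70/50 lies just above 69/50, which leaves 1/50 of \<open>N\<close>.\<close>
  also have "\<dots> \<ge> (\<Sum>i<l. 7 / 5 * (meas A E i)\<^sup>2 - 5 / 3 * (w i)\<^sup>2)"
  proof (rule sum_mono)
    fix i assume "i \<in> {..<l}"
    hence r: "residual A y X i = meas A E i - w i" using res by simp
    have "0 \<le> (3 * meas A E i - 5 * w i)\<^sup>2" by simp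
    thus "7 / 5 * (meas A E i)\<^sup>2 - 5 / 3 * (w i)\<^sup>2 \<le> 2 * residual A y X i * meas A E i"
      unfolding r by (simp add: power2_eq_square algebra_simps)
  qed
  also have "(\<Sum>i<l. 7 / 5 * (meas A E i)\<^sup>2 - 5 / 3 * (w i)\<^sup>2) = 7 / 5 * SE - 5 / 3 * (\<Sum>i<l. (w i)\<^sup>2)"
    by (simp add: SE_def sum_subtractf sum_distrib_left)
  finally have low: "7 / 5 * SE - 5 / 3 * W \<le> frob_inner G E" using W by linarith
  have main: "N / 50 \<le> 5 / 3 * W + lam * \<mu> * nuclear_norm Xs - lam * schatten_pow (q / 2) X"
    using low up SEN SKN by linarith
  \<comment> \<open>The power of 10 stems from the factor 1/10 in the hypothesis on
    \<open>sigma_min X\<close>.\<close>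
  have \<mu>: "\<mu> = 10 powr (1 - q / 2) * sigma_min Xs powr (q / 2 - 1)"
  proof -
    have "\<mu> = sigma_min Xs powr p / 10 powr p" using sXs by (simp add: \<mu>_def powr_divide)
    also have "\<dots> = 10 powr (- p) * sigma_min Xs powr p" by (simp add: powr_minus field_simps)
    finally show ?thesis by (simp add: p_def)
  qed
  have a: "2 * real l * (1 - \<delta>) > 0" using l \<delta> by simp
  have "frob_inner E E = 100 / (2 * real l * (1 - \<delta>)) * (N / 50)"
    using l \<delta> by (simp add: N_def field_simps)
  also have "\<dots> \<le> 100 / (2 * real l * (1 - \<delta>)) * (5 / 3 * W + lam * \<mu> * nuclear_norm Xs - lam * schatten_pow (q / 2) X)"
    using main a by (intro mult_left_mono) auto
  finally show ?thesis unfolding frob_norm_square E_def \<mu> .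
qed

section \<open>From one noise realization to the probability statement\<close>

lemma noise_const_pos: "l \<ge> 1 \<Longrightarrow> noise_const l > 0"
  unfolding noise_const_def by (intro mult_pos_pos add_nonneg_pos divide_nonneg_pos) auto

text \<open>The existential quantifier stands before the dimensions, the rank and the noise, so that
  the constants depend on c, \<alpha>, \<beta> and q alone; \<alpha> and \<beta> are tied to l and
  \<delta> only afterwards. The sample space has a fixed type because the measure is quantified
  below the constants.\<close>

theorem proposition3p5:
  fixes c \<alpha> \<beta> q :: real
  assumes "c > 0" and "0 < q" and "q < 2"
  shows "\<exists>\<gamma>1 \<gamma>2 \<gamma>3 :: real. \<gamma>1 > 0 \<and> \<gamma>2 > 0 \<and> \<gamma>3 > 0 \<and>
    (\<forall>(m::nat) (n::nat) (d::nat) (l::nat) (r::nat) (Xs :: real mat) (A :: nat \<Rightarrow> real mat)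
       (\<delta>::real) (\<sigma>::real) (lam::real)
       (M :: (nat \<Rightarrow> real) measure) (\<omega> :: nat \<Rightarrow> (nat \<Rightarrow> real) \<Rightarrow> real).
       Xs \<in> carrier_mat m n \<longrightarrow> mat_rank Xs = r \<longrightarrow> 1 \<le> r \<longrightarrow> r \<le> d \<longrightarrow>
       (\<forall>i<l. A i \<in> carrier_mat m n) \<longrightarrow>
       0 < \<delta> \<longrightarrow> \<delta> < 19 / 119 \<longrightarrow> RIP m n l A (4 * r) \<delta> \<longrightarrow>
       \<alpha> = 2 * real l * (1 - \<delta>) \<longrightarrow> \<beta> = 2 * real l * (1 + \<delta>) \<longrightarrow>
       prob_space M \<longrightarrow> 0 \<le> \<sigma> \<longrightarrow> iid_sub_gaussian M l \<omega> \<sigma> \<longrightarrow> tail_constant M m n l \<omega> \<sigma> c \<longrightarrow>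
       0 < lam \<longrightarrow>
       holds_with_prob M (1 - 1 / real (m * n)) (\<lambda>x.
         let \<Phi> = Phi l A (\<lambda>i. meas A Xs i + \<omega> i x) q lam in
         \<forall>U V. let X = U * transpose_mat V in
           S_critical m n d \<Phi> U V \<longrightarrow>
           (\<forall>i<d. col U i \<noteq> 0\<^sub>v m \<and> col V i \<noteq> 0\<^sub>v n) \<longrightarrow>
           mat_rank X \<le> r \<longrightarrow>
           sigma_min X \<ge> 1 / 10 * sigma_min Xs \<longrightarrow>
           psd_hessian m n d \<Phi> (U, V) \<longrightarrow>
           (frob_norm (X - Xs))\<^sup>2
             \<le> \<gamma>1 * real r * \<sigma>\<^sup>2 * ln (real (n * m)) * (1 + \<delta>)
               + \<gamma>2 * lam * sigma_min Xs powr (q / 2 - 1) * nuclear_norm Xs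
               - \<gamma>3 * lam * schatten_pow (q / 2) X))"
proof -
  \<comment> \<open>The floor and the case distinctions only make the constants total and positive;
    for \<alpha> and \<beta> that come from some l and \<delta>, \<open>L\<close> is that l.\<close>
  define L where "L = nat \<lfloor>(\<alpha> + \<beta>) / 4\<rfloor>"
  define a where "a = (if \<alpha> > 0 then 100 / \<alpha> else 1)"
  define \<gamma>1 where "\<gamma>1 = a * (5 / 3 * (if L \<ge> 1 then noise_const L else 1))"
  define \<gamma>2 where "\<gamma>2 = a * 10 powr (1 - q / 2)"
  have a: "a > 0" by (simp add: a_def)
  have \<gamma>: "\<gamma>1 > 0" "\<gamma>2 > 0"
    using a noise_const_pos[of L] by (auto simp: \<gamma>1_def \<gamma>2_def)
  show ?thesis
  proof (rule exI[of _ \<gamma>1], rule exI[of _ \<gamma>2], rule exI[of _ a], intro conjI allI impI \<gamma> a)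
    fix m n d l r :: nat and Xs :: "real mat" and A :: "nat \<Rightarrow> real mat" and \<delta> \<sigma> lam :: real
      and M :: "(nat \<Rightarrow> real) measure" and \<omega> :: "nat \<Rightarrow> (nat \<Rightarrow> real) \<Rightarrow> real"
    assume Xs: "Xs \<in> carrier_mat m n" and rk: "mat_rank Xs = r" "1 \<le> r" "r \<le> d"
      and A: "\<forall>i<l. A i \<in> carrier_mat m n" and \<delta>: "0 < \<delta>" "\<delta> < 19 / 119" and rip: "RIP m n l A (4 * r) \<delta>"
      and \<alpha>: "\<alpha> = 2 * real l * (1 - \<delta>)" and \<beta>: "\<beta> = 2 * real l * (1 + \<delta>)"
      and M: "prob_space M" and \<sigma>: "0 \<le> \<sigma>" and iid: "iid_sub_gaussian M l \<omega> \<sigma>"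
      and lam: "0 < lam"
    interpret prob_space M by (rule M)
    have l: "l \<ge> 1" by (rule RIP_imp_measurements[OF rip Xs]) (use rk \<delta> in auto)
    have "(\<alpha> + \<beta>) / 4 = real l" by (simp add: \<alpha> \<beta> algebra_simps)
    hence L: "L = l" by (simp add: L_def)
    have "\<alpha> > 0" using l \<delta> by (simp add: \<alpha>)
    hence aa: "a = 100 / (2 * real l * (1 - \<delta>))" by (simp add: a_def \<alpha>)
    have "m * n \<noteq> 0"
    proof
      assume "m * n = 0"
      hence "Xs = 0\<^sub>m m n" using Xs by (intro eq_matI) auto
      hence "mat_rank Xs = 0"
        using vec_space.rank_0I[where n = m and nc = n and 'a = real] by (simp only: mat_rank_def index_zero_mat(2))
      thus False using rk by simp
    qed
    then consider "m * n = 1" | "m * n \<ge> 2" by linarith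
    thus "holds_with_prob M (1 - 1 / real (m * n)) (\<lambda>x.
         let \<Phi> = Phi l A (\<lambda>i. meas A Xs i + \<omega> i x) q lam in
         \<forall>U V. let X = U * V\<^sup>T in
           S_critical m n d \<Phi> U V \<longrightarrow>
           (\<forall>i<d. col U i \<noteq> 0\<^sub>v m \<and> col V i \<noteq> 0\<^sub>v n) \<longrightarrow>
           mat_rank X \<le> r \<longrightarrow>
           sigma_min X \<ge> 1 / 10 * sigma_min Xs \<longrightarrow>
           psd_hessian m n d \<Phi> (U, V) \<longrightarrow>
           (frob_norm (X - Xs))\<^sup>2
             \<le> \<gamma>1 * real r * \<sigma>\<^sup>2 * ln (real (n * m)) * (1 + \<delta>)
               + \<gamma>2 * lam * sigma_min Xs powr (q / 2 - 1) * nuclear_norm Xs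
               - a * lam * schatten_pow (q / 2) X)" (is "holds_with_prob M _ ?B")
    proof cases
      case 1
      \<comment> \<open>The required probability is 0, so the empty event serves; ln 1 = 0 would
        leave no room for noise.\<close>
      thus ?thesis unfolding holds_with_prob_def by (intro bexI[of _ "{}"]) auto
    next
      case 2
      define W where "W = noise_const l * \<sigma>\<^sup>2 * ln (real (m * n))"
      have "holds_with_prob M (1 - 1 / real (m * n)) (\<lambda>x. (\<Sum>i<l. (\<omega> i x)\<^sup>2) \<le> W)"
        unfolding W_def
        by (rule sub_gaussian_noise_bound[OF _ _ \<sigma> l 2])
          (use iid in \<open>auto simp: iid_sub_gaussian_def indep_vars_def\<close>)
      moreover have "?B x" if W: "(\<Sum>i<l. (\<omega> i x)\<^sup>2) \<le> W" for x
        unfolding Let_def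
      proof (intro allI impI)
        fix U V
        assume S: "S_critical m n d (Phi l A (\<lambda>i. meas A Xs i + \<omega> i x) q lam) U V"
          and nz: "\<forall>i<d. col U i \<noteq> 0\<^sub>v m \<and> col V i \<noteq> 0\<^sub>v n"
          and rX: "mat_rank (U * V\<^sup>T) \<le> r" and sX: "1 / 10 * sigma_min Xs \<le> sigma_min (U * V\<^sup>T)"
          and psd: "psd_hessian m n d (Phi l A (\<lambda>i. meas A Xs i + \<omega> i x) q lam) (U, V)"
        let ?S = "schatten_pow (q / 2) (U * V\<^sup>T)"
        have "(frob_norm (U * V\<^sup>T - Xs))\<^sup>2 \<le> a *
          (5 / 3 * W + lam * (10 powr (1 - q / 2) * sigma_min Xs powr (q / 2 - 1)) * nuclear_norm Xs - lam * ?S)"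
          unfolding aa
          by (rule deterministic_bound[OF assms(2,3) Xs rk _ \<delta> rip lam W refl refl S _ _ rX sX psd]) (use A nz in auto)
        also have "\<dots> = a * (5 / 3 * W) + \<gamma>2 * lam * sigma_min Xs powr (q / 2 - 1) * nuclear_norm Xs - a * lam * ?S"
          by (simp add: \<gamma>2_def algebra_simps)
        also have "a * (5 / 3 * W) \<le> \<gamma>1 * real r * \<sigma>\<^sup>2 * ln (real (n * m)) * (1 + \<delta>)"
        proof -
          have "1 \<le> n * m" using 2 by (subst mult.commute) linarith
          hence "1 \<le> real (n * m)" using of_nat_mono[of 1 "n * m", where 'a = real] by (simp only: of_nat_1)
          hence "ln (real (n * m)) \<ge> 0" by (rule ln_ge_zero)
          \<comment> \<open>The union bound yields no factor r (1 + \<delta>); this factor is at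
            least 1 and can only enlarge the right-hand side.\<close>
          moreover have "1 \<le> real r * (1 + \<delta>)" using mult_mono[of 1 "real r" 1 "1 + \<delta>"] rk \<delta> by simp
          ultimately have "\<gamma>1 * \<sigma>\<^sup>2 * ln (real (n * m)) * 1 \<le> \<gamma>1 * \<sigma>\<^sup>2 * ln (real (n * m)) * (real r * (1 + \<delta>))"
            using \<gamma>(1) by (intro mult_left_mono mult_nonneg_nonneg) auto
          moreover have "a * (5 / 3 * W) = \<gamma>1 * \<sigma>\<^sup>2 * ln (real (n * m))"
            using l by (simp add: \<gamma>1_def L W_def mult_ac)
          ultimately show ?thesis by (simp add: mult_ac)
        qed
        finally show "(frob_norm (U * V\<^sup>T - Xs))\<^sup>2
             \<le> \<gamma>1 * real r * \<sigma>\<^sup>2 * ln (real (n * m)) * (1 + \<delta>)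
               + \<gamma>2 * lam * sigma_min Xs powr (q / 2 - 1) * nuclear_norm Xs
               - a * lam * ?S" by simp
      qed
      ultimately show ?thesis unfolding holds_with_prob_def by meson
    qed
  qed
qed

end
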